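(* Let $T>0$, let $\{a_N\}_{N\ge1}$ be a positive sequence with $\lim_{N\to\infty} a_N/N=\lim_{N\to\infty}\sqrt N/a_N=0$, and let $\phi\in C(\mathbb{T})$ satisfy $0<\phi(u)<1$ for all $u\in\mathbb{T}$. For each $N\ge 1$ let $\{\eta_t^N\}_{t\ge0}$ be the simple exclusion process on $\mathbb{T}^N$ with generator $\mathcal{L}_N$ such that $\{\eta_0^N(x)\}_{x\in\mathbb{T}^N}$ are independent with $P(\eta_0^N(x)=1)=\phi(x/N)$ for all $x\in\mathbb{T}^N$. Then the scaled density fields $\{\theta^N\}_{N\ge1}$, $\theta^N=\{\theta_t^N\}_{0\le t\le T}$, are exponentially tight in $\mathcal{D}([0,T],\mathcal{S})$ with speed $a_N^2/N$; that is, for every $L>0$ there is a compact set $K\subseteq\mathcal{D}([0,T],\mathcal{S})$ such that $$\limsup_{N\to+\infty}\frac{N}{a_N^2}\log P\left(\theta^N\notin K\right)\le -L.$$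
   Context: Process: for $N\ge1$, $\mathbb{T}^N=\{0,1,\dots,N-1\}$ with arithmetic modulo $N$. The process $\{\eta^N_t\}_{t\ge0}$ is the continuous-time Markov process with state space $\{0,1\}^{\mathbb{T}^N}$ and generator $$\mathcal{L}_Nf(\eta)=N^2\sum_{x\in\mathbb{T}^N}\left[f(\eta^{x,x+1})-f(\eta)\right],$$ where $\eta^{x,x+1}$ is obtained from $\eta$ by exchanging the values $\eta(x)$ and $\eta(x+1)$. Spaces: $\mathbb{T}=[0,1)$ is the one-dimensional torus (arithmetic modulo $1$). $\mathcal{S}$ is the dual of $C^\infty(\mathbb{T})$ endowed with the weak topology: $\nu_n\to\nu$ in $\mathcal{S}$ if and only if $\nu_n(f)\to\nu(f)$ for every $f\in C^\infty(\mathbb{T})$. $\mathcal{D}([0,T],\mathcal{S})$ is the set of càdlàg functions from $[0,T]$ to $\mathcal{S}$ endowed with the Skorokhod topology. Scaled density field: for $t\ge0$ and $f\in C^\infty(\mathbb{T})$, $$\theta_t^N(f)=\frac1{a_N}\sum_{x\in\mathbb{T}^N}\left(\eta_t^N(x)-\mathbb{E}\eta_t^N(x)\right)f\left(\frac xN\right).$$ Convention: $\log0=-\infty$. *)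

theory Defs
  imports "HOL-Probability.Probability" "HOL-Combinatorics.Transposition"
begin

section \<open>Functions and distributions on the torus\<close>

text \<open>Functions on the torus \<open>[0,1)\<close> with arithmetic modulo 1 are represented by their
  1-periodic extensions to the real line.\<close>

definition torus_continuous :: "(real \<Rightarrow> real) set" where
  "torus_continuous = {f. (\<forall>x. f (x + 1) = f x) \<and> continuous_on UNIV f}"

definition torus_smooth :: "(real \<Rightarrow> real) set" where
  "torus_smooth =
    {f. (\<forall>x. f (x + 1) = f x) \<and> (\<forall>k x. (deriv ^^ k) f differentiable (at x))}"

text \<open>The usual Frechet topology: uniform convergence of all derivatives. By periodicity the
  derivatives are bounded and attain their suprema, so the pointwise strict bound below says that
  the supremum distance of the \<open>k\<close>-th derivatives is less than \<open>e\<close>.\<close>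

definition smooth_topology :: "(real \<Rightarrow> real) topology" where
  "smooth_topology = topology_generated_by
    {{g \<in> torus_smooth. \<forall>x. \<bar>(deriv ^^ k) g x - (deriv ^^ k) f x\<bar> < e} | f k e.
       f \<in> torus_smooth \<and> 0 < e}"

text \<open>The topological dual. Functionals are made extensional (\<open>undefined\<close> off \<open>torus_smooth\<close>), so
  that equality of functionals is equality on test functions.\<close>

definition torus_distributions :: "((real \<Rightarrow> real) \<Rightarrow> real) set" where
  "torus_distributions =
    {\<nu> \<in> extensional torus_smooth.
       (\<forall>f\<in>torus_smooth. \<forall>g\<in>torus_smooth. \<nu> (\<lambda>x. f x + g x) = \<nu> f + \<nu> g) \<and>
       (\<forall>c. \<forall>f\<in>torus_smooth. \<nu> (\<lambda>x. c * f x) = c * \<nu> f) \<and>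
       continuous_map smooth_topology euclideanreal \<nu>}"

definition distribution_topology :: "((real \<Rightarrow> real) \<Rightarrow> real) topology" where
  "distribution_topology =
    subtopology (product_topology (\<lambda>_. euclideanreal) torus_smooth) torus_distributions"

section \<open>Cadlag paths and the Skorokhod topology\<close>

text \<open>At an endpoint of \<open>A\<close> the corresponding one-sided filter is trivial, so no condition is
  imposed there beyond \<open>x\<close> taking values in the space.\<close>

definition cadlag_on :: "'a topology \<Rightarrow> real set \<Rightarrow> (real \<Rightarrow> 'a) \<Rightarrow> bool" where
  "cadlag_on X A x \<longleftrightarrow>
    (\<forall>t\<in>A. x t \<in> topspace X \<and>
       limitin X x (x t) (at t within A \<inter> {t<..}) \<and>
       (\<exists>l. limitin X x l (at t within A \<inter> {..<t})))"

definition cadlag_paths :: "real \<Rightarrow> (real \<Rightarrow> (real \<Rightarrow> real) \<Rightarrow> real) set" where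
  "cadlag_paths T = {x \<in> extensional {0..T}. cadlag_on distribution_topology {0..T} x}"

text \<open>A strictly increasing surjection of \<open>[0,T]\<close> onto itself is automatically a homeomorphism.\<close>

definition time_changes :: "real \<Rightarrow> (real \<Rightarrow> real) set" where
  "time_changes T = {\<gamma>. strict_mono_on {0..T} \<gamma> \<and> \<gamma> ` {0..T} = {0..T}}"

text \<open>The weak topology on distributions is not metrizable; it is given by the seminorms
  \<open>\<nu> \<mapsto> max\<^sub>f\<^sub>\<in>\<^sub>F \<bar>\<nu> f\<bar>\<close> for finite sets \<open>F\<close> of test functions. As usual for such spaces (Mitoma,
  Jakubowski), the Skorokhod topology is the one generated by the Skorokhod pseudometrics of these
  seminorms; all \<open>f \<in> F\<close> share one time change.\<close>

definition skorokhod_near ::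
  "real \<Rightarrow> (real \<Rightarrow> real) set \<Rightarrow> real \<Rightarrow> (real \<Rightarrow> (real \<Rightarrow> real) \<Rightarrow> real) \<Rightarrow>
   (real \<Rightarrow> (real \<Rightarrow> real) \<Rightarrow> real) set" where
  "skorokhod_near T F e x =
    {y \<in> cadlag_paths T. \<exists>\<gamma>\<in>time_changes T. \<forall>t\<in>{0..T}.
       \<bar>\<gamma> t - t\<bar> < e \<and> (\<forall>f\<in>F. \<bar>x (\<gamma> t) f - y t f\<bar> < e)}"

definition skorokhod_open :: "real \<Rightarrow> (real \<Rightarrow> (real \<Rightarrow> real) \<Rightarrow> real) set \<Rightarrow> bool" where
  "skorokhod_open T U \<longleftrightarrow> U \<subseteq> cadlag_paths T \<and>
    (\<forall>x\<in>U. \<exists>F e. finite F \<and> F \<subseteq> torus_smooth \<and> 0 < e \<and> skorokhod_near T F e x \<subseteq> U)"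

definition skorokhod_topology ::
  "real \<Rightarrow> (real \<Rightarrow> (real \<Rightarrow> real) \<Rightarrow> real) topology" where
  "skorokhod_topology T = topology (skorokhod_open T)"

lemma skorokhod_near_mono:
  assumes "F \<subseteq> F'" "e' \<le> e"
  shows "skorokhod_near T F' e' x \<subseteq> skorokhod_near T F e x"
proof
  fix y assume "y \<in> skorokhod_near T F' e' x"
  then obtain \<gamma> where y: "y \<in> cadlag_paths T" and g: "\<gamma> \<in> time_changes T"
    and near: "\<And>t. t \<in> {0..T} \<Longrightarrow> \<bar>\<gamma> t - t\<bar> < e' \<and> (\<forall>f\<in>F'. \<bar>x (\<gamma> t) f - y t f\<bar> < e')"
    unfolding skorokhod_near_def by blast
  have "\<bar>\<gamma> t - t\<bar> < e \<and> (\<forall>f\<in>F. \<bar>x (\<gamma> t) f - y t f\<bar> < e)" if "t \<in> {0..T}" for t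
    using near[OF that] assms by (meson less_le_trans subsetD)
  with y g show "y \<in> skorokhod_near T F e x"
    unfolding skorokhod_near_def by blast
qed

lemma istopology_skorokhod_open: "istopology (skorokhod_open T)"
  unfolding istopology_def
proof (intro conjI allI impI)
  fix U V
  assume U: "skorokhod_open T U" and V: "skorokhod_open T V"
  show "skorokhod_open T (U \<inter> V)"
    unfolding skorokhod_open_def
  proof (intro conjI ballI)
    show "U \<inter> V \<subseteq> cadlag_paths T"
      using U unfolding skorokhod_open_def by blast
    fix x assume x: "x \<in> U \<inter> V"
    obtain F e where F: "finite F" "F \<subseteq> torus_smooth" "0 < e" "skorokhod_near T F e x \<subseteq> U"
      using U x unfolding skorokhod_open_def by (meson IntD1)
    obtain G d where G: "finite G" "G \<subseteq> torus_smooth" "0 < d" "skorokhod_near T G d x \<subseteq> V"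
      using V x unfolding skorokhod_open_def by (meson IntD2)
    have "skorokhod_near T (F \<union> G) (min e d) x \<subseteq> skorokhod_near T F e x"
      "skorokhod_near T (F \<union> G) (min e d) x \<subseteq> skorokhod_near T G d x"
      by (rule skorokhod_near_mono; simp)+
    then have "skorokhod_near T (F \<union> G) (min e d) x \<subseteq> U \<inter> V"
      using F(4) G(4) by blast
    moreover have "finite (F \<union> G)" "F \<union> G \<subseteq> torus_smooth" "0 < min e d"
      using F(1-3) G(1-3) by simp_all
    ultimately show "\<exists>F e. finite F \<and> F \<subseteq> torus_smooth \<and> 0 < e \<and> skorokhod_near T F e x \<subseteq> U \<inter> V"
      by meson
  qed
next
  fix \<K>
  assume K: "\<forall>K\<in>\<K>. skorokhod_open T K"
  show "skorokhod_open T (\<Union>\<K>)"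
    unfolding skorokhod_open_def
  proof (intro conjI ballI)
    show "\<Union>\<K> \<subseteq> cadlag_paths T"
      using K unfolding skorokhod_open_def by blast
    fix x assume "x \<in> \<Union>\<K>"
    then obtain U where U: "U \<in> \<K>" "x \<in> U" by blast
    then obtain F e where F: "finite F" "F \<subseteq> torus_smooth" "0 < e" "skorokhod_near T F e x \<subseteq> U"
      using K unfolding skorokhod_open_def by meson
    have "skorokhod_near T F e x \<subseteq> \<Union>\<K>"
      using F(4) U(1) by (meson Union_upper order_trans)
    with F(1-3) show
      "\<exists>F e. finite F \<and> F \<subseteq> torus_smooth \<and> 0 < e \<and> skorokhod_near T F e x \<subseteq> \<Union>\<K>"
      by meson
  qed
qed

lemma openin_skorokhod_topology: "openin (skorokhod_topology T) = skorokhod_open T"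
  unfolding skorokhod_topology_def by (rule topology_inverse'[OF istopology_skorokhod_open])

section \<open>Markov processes on a finite state space\<close>

definition transition_function :: "'s set \<Rightarrow> (real \<Rightarrow> 's \<Rightarrow> 's \<Rightarrow> real) \<Rightarrow> bool" where
  "transition_function E p \<longleftrightarrow>
    (\<forall>t\<ge>0. \<forall>x\<in>E. (\<forall>y\<in>E. 0 \<le> p t x y) \<and> (\<Sum>y\<in>E. p t x y) = 1) \<and>
    (\<forall>x\<in>E. \<forall>y\<in>E. p 0 x y = (if x = y then 1 else 0)) \<and>
    (\<forall>s\<ge>0. \<forall>t\<ge>0. \<forall>x\<in>E. \<forall>y\<in>E. p (s + t) x y = (\<Sum>z\<in>E. p s x z * p t z y))"

definition has_generator ::
  "'s set \<Rightarrow> (real \<Rightarrow> 's \<Rightarrow> 's \<Rightarrow> real) \<Rightarrow> (('s \<Rightarrow> real) \<Rightarrow> 's \<Rightarrow> real) \<Rightarrow> bool" where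
  "has_generator E p L \<longleftrightarrow>
    (\<forall>f. \<forall>x\<in>E. ((\<lambda>t. ((\<Sum>y\<in>E. p t x y * f y) - f x) / t) \<longlongrightarrow> L f x) (at_right 0))"

text \<open>The last conjunct is the Markov property in terms of finite-dimensional distributions,
  multiplied out to avoid conditioning on null events.\<close>

definition markov_process ::
  "'w measure \<Rightarrow> 's set \<Rightarrow> (('s \<Rightarrow> real) \<Rightarrow> 's \<Rightarrow> real) \<Rightarrow> (real \<Rightarrow> 'w \<Rightarrow> 's) \<Rightarrow> bool" where
  "markov_process M E L X \<longleftrightarrow>
    prob_space M \<and> finite E \<and>
    (\<forall>t\<ge>0. X t \<in> measurable M (count_space E)) \<and>
    (\<forall>\<omega>\<in>space M. cadlag_on (discrete_topology E) {0..} (\<lambda>t. X t \<omega>)) \<and>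
    (\<exists>p. transition_function E p \<and> has_generator E p L \<and>
      (\<forall>n (t :: nat \<Rightarrow> real) s.
         0 \<le> t 0 \<and> (\<forall>i\<le>n. t i < t (Suc i)) \<and> (\<forall>i\<le>Suc n. s i \<in> E) \<longrightarrow>
         measure M {\<omega> \<in> space M. \<forall>i\<le>Suc n. X (t i) \<omega> = s i} =
         measure M {\<omega> \<in> space M. \<forall>i\<le>n. X (t i) \<omega> = s i} *
           p (t (Suc n) - t n) (s n) (s (Suc n))))"

section \<open>The symmetric exclusion process and its density field\<close>

definition configurations :: "nat \<Rightarrow> (nat \<Rightarrow> nat) set" where
  "configurations N = {..<N} \<rightarrow>\<^sub>E {0, 1}"

definition exclusion_generator :: "nat \<Rightarrow> ((nat \<Rightarrow> nat) \<Rightarrow> real) \<Rightarrow> (nat \<Rightarrow> nat) \<Rightarrow> real" where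
  "exclusion_generator N f \<eta> =
    (real N)\<^sup>2 * (\<Sum>x<N. f (\<eta> \<circ> Transposition.transpose x ((x + 1) mod N)) - f \<eta>)"

definition density_field ::
  "real \<Rightarrow> nat \<Rightarrow> real \<Rightarrow> 'w measure \<Rightarrow> (real \<Rightarrow> 'w \<Rightarrow> nat \<Rightarrow> nat) \<Rightarrow>
   'w \<Rightarrow> real \<Rightarrow> (real \<Rightarrow> real) \<Rightarrow> real" where
  "density_field T N a M \<eta> \<omega> =
    (\<lambda>t\<in>{0..T}. \<lambda>f\<in>torus_smooth.
       1 / a * (\<Sum>x<N. (real (\<eta> t \<omega> x) - (\<integral>\<omega>'. real (\<eta> t \<omega>' x) \<partial>M)) * f (real x / real N)))"

definition ln_ereal :: "real \<Rightarrow> ereal" where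
  "ln_ereal p = (if p = 0 then - \<infinity> else ereal (ln p))"

end

theory Submission
  imports Defs "HOL-Library.Periodic_Fun" "HOL-Library.Diagonal_Subsequence"
begin

text \<open>Independence enters only through the exponential moments at time 0. Let \<open>Z t c\<close> be the centred pairing of the
  configuration at time \<open>t\<close> with \<open>c\<close>. Applied to \<open>exp (Z t c)\<close>, the generator moves \<open>c\<close> by the
  discrete heat flow up to quadratic errors, which the energy dissipated by that flow absorbs; so
  \<open>Z t c\<close> is sub-Gaussian with variance proxy of order \<open>\<Sum>x. (c x)\<^sup>2\<close>. An increment over a window of
  length \<open>\<delta>\<close> splits into a part controlled by an exponential supermartingale (Doob) and a drift, the
  time integral of \<open>Z\<close> at the discrete Laplacian of \<open>c\<close>, controlled by the fixed-time bound through
  Jensen's inequality. With \<open>c\<close> of size \<open>a/N\<close> both give probabilities \<open>exp (- L a\<^sup>2/N)\<close> for the modulus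
  of continuity of a fixed test function, and, summing over Fourier modes, for the bound
  \<open>\<bar>\<theta> f\<bar> \<le> A (sup \<bar>f\<bar> + sup \<bar>f''\<bar>)\<close> simultaneously in \<open>f\<close>. Bounded fields with a modulus of continuity
  for each of countably many test functions are compact. The modulus for the \<open>i\<close>-th test function is
  imposed only for large \<open>N\<close>; each single \<open>N\<close> is handled by the compact set of fields of
  configuration paths with well separated jumps.\<close>

section \<open>Exponential supermartingales of finite Markov processes\<close>

text \<open>Test functions enter with amplitude \<open>l * a / N\<close>. The sum of squares, the
  energy cost and the scaled threshold are then all multiples of the speed
  \<open>a\<^sup>2 / N\<close>: the gain is linear in \<open>l\<close> and in the threshold, the
  loss is quadratic in \<open>l\<close>, and for increments the loss also carries the window length.
  Since \<open>a / N\<close> tends to 0, amplitudes are eventually below 1/2, where the exponential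
  is controlled by its quadratic expansion. Since \<open>a\<^sup>2 / N\<close> tends to infinity,
  numbers of windows and other constants are absorbed by a spare exponent.

  The process is given through its finite-dimensional distributions and the right derivative of the
  transition function at 0. The estimates therefore run along time grids of small mesh
  \<open>h\<close>, with one-step errors \<open>e * h\<close> that add up to a multiple of an
  arbitrary \<open>e\<close>, and reach continuous time through right continuity of the
  paths.\<close>

lemma (in prob_space) finite_rv:
  fixes h :: "'b \<Rightarrow> real"
  assumes Y: "Y \<in> measurable M (count_space A)" and A: "finite A"
  shows integrable_finite_rv: "integrable M (\<lambda>\<omega>. h (Y \<omega>))"
    and expectation_finite_rv:
      "expectation (\<lambda>\<omega>. h (Y \<omega>)) = (\<Sum>a\<in>A. h a * prob {\<omega>\<in>space M. Y \<omega> = a})"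
proof -
  have YA: "Y \<omega> \<in> A" if "\<omega> \<in> space M" for \<omega>
    using measurable_space[OF Y that] by simp
  have ev: "{\<omega>\<in>space M. Y \<omega> = a} \<in> sets M" if "a \<in> A" for a
    using measurable_sets[OF Y, of "{a}"] that by (simp add: vimage_def Int_def conj_commute)
  have eq: "h (Y \<omega>) = (\<Sum>a\<in>A. h a * indicator {\<omega>\<in>space M. Y \<omega> = a} \<omega>)"
    if "\<omega> \<in> space M" for \<omega>
  proof -
    have "(\<Sum>a\<in>A. h a * indicator {\<omega>\<in>space M. Y \<omega> = a} \<omega>) = (\<Sum>a\<in>A. if Y \<omega> = a then h a else 0)"
      using that by (intro sum.cong) auto
    then show ?thesis using YA[OF that] A by simp
  qed
  have int: "integrable M (\<lambda>\<omega>. \<Sum>a\<in>A. h a * indicator {\<omega>\<in>space M. Y \<omega> = a} \<omega>)"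
    using ev by (intro Bochner_Integration.integrable_sum integrable_mult_right)
      (auto simp: integrable_indicator_iff emeasure_eq_measure)
  show "integrable M (\<lambda>\<omega>. h (Y \<omega>))"
    using int by (subst Bochner_Integration.integrable_cong[OF refl eq]) auto
  have "expectation (\<lambda>\<omega>. h (Y \<omega>)) =
      expectation (\<lambda>\<omega>. \<Sum>a\<in>A. h a * indicator {\<omega>\<in>space M. Y \<omega> = a} \<omega>)"
    by (rule Bochner_Integration.integral_cong) (auto simp: eq)
  also have "\<dots> = (\<Sum>a\<in>A. h a * prob {\<omega>\<in>space M. Y \<omega> = a})"
    using ev by (subst Bochner_Integration.integral_sum)
      (auto simp: integrable_indicator_iff emeasure_eq_measure intro!: integrable_mult_right sum.cong)
  finally show "expectation (\<lambda>\<omega>. h (Y \<omega>)) = (\<Sum>a\<in>A. h a * prob {\<omega>\<in>space M. Y \<omega> = a})" .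
qed

text \<open>The exponential supermartingale stopped when it first reaches \<open>c\<close>. With the
  stopping built in, the maximal inequality reduces to Markov's inequality at the final
  index.\<close>

primrec stopped_product ::
  "real \<Rightarrow> (nat \<Rightarrow> 's \<Rightarrow> 's \<Rightarrow> real) \<Rightarrow> (nat \<Rightarrow> 's) \<Rightarrow> nat \<Rightarrow> real" where
  "stopped_product c w x 0 = 1"
| "stopped_product c w x (Suc i) =
     (if c \<le> stopped_product c w x i then stopped_product c w x i
      else stopped_product c w x i * exp (w i (x i) (x (Suc i))))"

lemma stopped_product_cong:
  "(\<And>j. j \<le> i \<Longrightarrow> x j = y j) \<Longrightarrow> stopped_product c w x i = stopped_product c w y i"
proof (induction i)
  case (Suc i)
  then have "stopped_product c w x i = stopped_product c w y i" "x i = y i" "x (Suc i) = y (Suc i)"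
    by auto
  then show ?case by simp
qed simp

lemma stopped_product_pos: "0 < stopped_product c w x i"
  by (induction i) auto

text \<open>A product that had been frozen would still be at least \<open>exp r\<close> at the end;
  a smaller final value shows that no freezing occurred, so every partial product is the plain
  exponential and lies below \<open>exp r\<close>.\<close>

lemma stopped_product_eq:
  assumes "stopped_product (exp r) w x n < exp r" "i \<le> n"
  shows "stopped_product (exp r) w x i = exp (\<Sum>j<i. w j (x j) (x (Suc j)))"
    "(\<Sum>j<i. w j (x j) (x (Suc j))) < r"
proof -
  have less: "stopped_product (exp r) w x i < exp r" if "i \<le> n" for i
  proof (rule ccontr)
    assume "\<not> stopped_product (exp r) w x i < exp r"
    then have ge: "exp r \<le> stopped_product (exp r) w x i" by simp
    have "stopped_product (exp r) w x n = stopped_product (exp r) w x i"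
      using that by (induction n rule: dec_induct) (use ge in auto)
    with ge assms(1) show False by simp
  qed
  have *: "stopped_product (exp r) w x i = exp (\<Sum>j<i. w j (x j) (x (Suc j)))" if "i \<le> n" for i
    using that
  proof (induction i)
    case (Suc i)
    with less[of i] show ?case by (auto simp: exp_add)
  qed simp
  from *[OF assms(2)] show "stopped_product (exp r) w x i = exp (\<Sum>j<i. w j (x j) (x (Suc j)))" .
  with less[OF assms(2)] show "(\<Sum>j<i. w j (x j) (x (Suc j))) < r" by simp
qed

text \<open>Only finite-dimensional distributions appear here: they suffice for supermartingales
  along a time grid. Generator and path regularity are added in
  \<open>exclusion_process\<close>.\<close>

locale finite_markov = prob_space M for M :: "'w measure" +
  fixes E :: "'s set" and p :: "real \<Rightarrow> 's \<Rightarrow> 's \<Rightarrow> real" and X :: "real \<Rightarrow> 'w \<Rightarrow> 's"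
  assumes finite_states: "finite E"
    and X_measurable: "\<And>t. 0 \<le> t \<Longrightarrow> X t \<in> measurable M (count_space E)"
    and transition: "transition_function E p"
    and finite_dim: "\<And>(t :: nat \<Rightarrow> real) n s. 0 \<le> t 0 \<Longrightarrow> (\<And>i. i \<le> n \<Longrightarrow> t i < t (Suc i)) \<Longrightarrow> (\<And>i. i \<le> Suc n \<Longrightarrow> s i \<in> E) \<Longrightarrow>
         prob {\<omega> \<in> space M. \<forall>i\<le>Suc n. X (t i) \<omega> = s i} =
         prob {\<omega> \<in> space M. \<forall>i\<le>n. X (t i) \<omega> = s i} * p (t (Suc n) - t n) (s n) (s (Suc n))"
begin

lemma X_in: "0 \<le> t \<Longrightarrow> \<omega> \<in> space M \<Longrightarrow> X t \<omega> \<in> E"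
  using measurable_space[OF X_measurable] by simp

lemma X_eq_sets: "0 \<le> t \<Longrightarrow> {\<omega>\<in>space M. X t \<omega> = s} \<in> sets M"
proof (cases "s \<in> E")
  case True
  assume "0 \<le> t"
  with measurable_sets[OF X_measurable, of t "{s}"] True show ?thesis
    by (simp add: vimage_def Int_def conj_commute)
next
  case False
  assume "0 \<le> t"
  with False X_in have "{\<omega>\<in>space M. X t \<omega> = s} = {}" by auto
  then show ?thesis by (simp only: sets.empty_sets)
qed

lemma X_function_measurable:
  "0 \<le> t \<Longrightarrow> (\<lambda>\<omega>. (g (X t \<omega>) :: real)) \<in> borel_measurable M"
  by (rule measurable_compose[OF X_measurable]) auto

definition path :: "nat \<Rightarrow> (nat \<Rightarrow> real) \<Rightarrow> 'w \<Rightarrow> nat \<Rightarrow> 's" where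
  "path n t \<omega> = (\<lambda>i\<in>{..n}. X (t i) \<omega>)"

lemma path_eq_iff:
  "s \<in> {..n} \<rightarrow>\<^sub>E E \<Longrightarrow> path n t \<omega> = s \<longleftrightarrow> (\<forall>i\<le>n. X (t i) \<omega> = s i)"
  by (auto simp: path_def PiE_def extensional_def fun_eq_iff restrict_def)

lemma path_measurable:
  assumes "\<And>i. i \<le> n \<Longrightarrow> 0 \<le> t i"
  shows "path n t \<in> measurable M (count_space ({..n} \<rightarrow>\<^sub>E E))"
proof (subst measurable_count_space_eq2)
  show "finite ({..n} \<rightarrow>\<^sub>E E)" by (simp add: finite_PiE finite_states)
  have "path n t -` {s} \<inter> space M \<in> sets M" if "s \<in> {..n} \<rightarrow>\<^sub>E E" for s
  proof -
    have "path n t -` {s} \<inter> space M = (\<Inter>i\<in>{..n}. {\<omega>\<in>space M. X (t i) \<omega> = s i})"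
      using path_eq_iff[OF that, of t] by auto
    also have "\<dots> \<in> sets M"
      using assms X_eq_sets by (intro sets.finite_INT) auto
    finally show ?thesis .
  qed
  then show "path n t \<in> space M \<rightarrow> {..n} \<rightarrow>\<^sub>E E \<and>
      (\<forall>s\<in>{..n} \<rightarrow>\<^sub>E E. path n t -` {s} \<inter> space M \<in> sets M)"
    using X_in assms by (auto simp: path_def)
qed

lemma finite_paths: "finite ({..n::nat} \<rightarrow>\<^sub>E E)"
  by (simp add: finite_PiE finite_states)

text \<open>The Markov property tested against a function of the past. All quantities depend on
  finitely many values, so expanding over the joint law of past and next state reduces it to
  \<open>finite_dim\<close>.\<close>

lemma markov_step:
  assumes t: "0 \<le> t 0" "\<And>i. i \<le> n \<Longrightarrow> t i < t (Suc i)"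
  shows "expectation (\<lambda>\<omega>. \<Phi> (path n t \<omega>) * G (X (t n) \<omega>) (X (t (Suc n)) \<omega>)) =
    expectation (\<lambda>\<omega>. \<Phi> (path n t \<omega>) * (\<Sum>z\<in>E. p (t (Suc n) - t n) (X (t n) \<omega>) z * G (X (t n) \<omega>) z))"
proof -
  have tpos: "0 \<le> t i" if "i \<le> Suc n" for i
    using that
  proof (induction i)
    case (Suc i)
    then show ?case using t(2)[of i] by force
  qed (use t in simp)
  have pm: "path n t \<in> measurable M (count_space ({..n} \<rightarrow>\<^sub>E E))"
    using tpos by (intro path_measurable) auto
  have Xm: "X (t (Suc n)) \<in> measurable M (count_space E)"
    using X_measurable tpos by auto
  have Y: "(\<lambda>\<omega>. (path n t \<omega>, X (t (Suc n)) \<omega>)) \<in>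
      measurable M (count_space (({..n} \<rightarrow>\<^sub>E E) \<times> E))"
    using pm Xm finite_paths finite_states
    by (subst pair_measure_countable[symmetric]) (auto intro: countable_finite)
  have last: "X (t n) \<omega> = path n t \<omega> n" for \<omega>
    by (simp add: path_def)
  have pr: "prob {\<omega>\<in>space M. (path n t \<omega>, X (t (Suc n)) \<omega>) = (s, z)} =
      prob {\<omega>\<in>space M. path n t \<omega> = s} * p (t (Suc n) - t n) (s n) z"
    if s: "s \<in> {..n} \<rightarrow>\<^sub>E E" and z: "z \<in> E" for s z
  proof -
    define s' where "s' = s(Suc n := z)"
    have "{\<omega>\<in>space M. (path n t \<omega>, X (t (Suc n)) \<omega>) = (s, z)} =
        {\<omega>\<in>space M. \<forall>i\<le>Suc n. X (t i) \<omega> = s' i}"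
      using path_eq_iff[OF s, of t] by (auto simp: s'_def le_Suc_eq)
    moreover have "{\<omega>\<in>space M. path n t \<omega> = s} = {\<omega>\<in>space M. \<forall>i\<le>n. X (t i) \<omega> = s' i}"
      using path_eq_iff[OF s, of t] by (auto simp: s'_def)
    moreover have "s' i \<in> E" if "i \<le> Suc n" for i
      using that s z by (auto simp: s'_def PiE_iff le_Suc_eq)
    ultimately show ?thesis
      using finite_dim[of t n s'] t by (simp add: s'_def)
  qed
  have "expectation (\<lambda>\<omega>. \<Phi> (path n t \<omega>) * G (X (t n) \<omega>) (X (t (Suc n)) \<omega>)) =
      expectation (\<lambda>\<omega>. (\<lambda>(s, z). \<Phi> s * G (s n) z) (path n t \<omega>, X (t (Suc n)) \<omega>))"
    by (simp add: last)
  also have "\<dots> = (\<Sum>(s, z)\<in>({..n} \<rightarrow>\<^sub>E E) \<times> E. \<Phi> s * G (s n) z *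
      prob {\<omega>\<in>space M. (path n t \<omega>, X (t (Suc n)) \<omega>) = (s, z)})"
    by (subst expectation_finite_rv[OF Y]) (auto simp: finite_paths finite_states intro!: sum.cong)
  also have "\<dots> = (\<Sum>(s, z)\<in>({..n} \<rightarrow>\<^sub>E E) \<times> E. \<Phi> s * G (s n) z *
      (prob {\<omega>\<in>space M. path n t \<omega> = s} * p (t (Suc n) - t n) (s n) z))"
    by (intro sum.cong) (auto simp: pr simp del: prod.inject)
  also have "\<dots> = (\<Sum>s\<in>{..n} \<rightarrow>\<^sub>E E. \<Phi> s * (\<Sum>z\<in>E. p (t (Suc n) - t n) (s n) z * G (s n) z) *
      prob {\<omega>\<in>space M. path n t \<omega> = s})"
    by (simp add: sum.cartesian_product[symmetric] sum_distrib_left sum_distrib_right mult_ac)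
  also have "\<dots> = expectation (\<lambda>\<omega>. (\<lambda>s. \<Phi> s * (\<Sum>z\<in>E. p (t (Suc n) - t n) (s n) z * G (s n) z)) (path n t \<omega>))"
    by (rule expectation_finite_rv[OF pm finite_paths, symmetric])
  finally show ?thesis by (simp add: last)
qed

lemma expectation_step:
  assumes "0 \<le> s" "0 < h"
  shows "expectation (\<lambda>\<omega>. g (X (s + h) \<omega>)) = expectation (\<lambda>\<omega>. \<Sum>z\<in>E. p h (X s \<omega>) z * g z)"
  using markov_step[of "\<lambda>i. s + real i * h" 0 "\<lambda>_. 1" "\<lambda>_. g"] assms by simp

text \<open>Doob's inequality. The hypothesis on \<open>w\<close> bounds the conditional mean of
  each new factor by 1, so the stopped product keeps expectation at most 1.\<close>

lemma maximal_inequality: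
  assumes t: "0 \<le> t 0" "\<And>i. i < n \<Longrightarrow> t i < t (Suc i)"
    and w: "\<And>i \<xi>. i < n \<Longrightarrow> \<xi> \<in> E \<Longrightarrow> (\<Sum>z\<in>E. p (t (Suc i) - t i) \<xi> z * exp (w i \<xi> z)) \<le> 1"
  shows "{\<omega>\<in>space M. \<exists>i\<le>n. r \<le> (\<Sum>j<i. w j (X (t j) \<omega>) (X (t (Suc j)) \<omega>))} \<in> sets M"
    and "prob {\<omega>\<in>space M. \<exists>i\<le>n. r \<le> (\<Sum>j<i. w j (X (t j) \<omega>) (X (t (Suc j)) \<omega>))} \<le> exp (- r)"
proof -
  define V where "V = stopped_product (exp r) w"
  have tpos: "0 \<le> t i" if "i \<le> n" for i
    using that
  proof (induction i)
    case (Suc i)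
    then show ?case using t(2)[of i] by force
  qed (use t in simp)
  have Vpath: "V (path k t \<omega>) i = V (\<lambda>i. X (t i) \<omega>) i" if "i \<le> k" for i k \<omega>
    unfolding V_def by (rule stopped_product_cong) (use that in \<open>auto simp: path_def\<close>)
  have pm: "path i t \<in> measurable M (count_space ({..i} \<rightarrow>\<^sub>E E))" if "i \<le> n" for i
    using tpos that by (intro path_measurable) auto
  have EV: "expectation (\<lambda>\<omega>. V (path i t \<omega>) i) \<le> 1" if "i \<le> n" for i
    using that
  proof (induction i)
    case 0
    then show ?case by (simp add: V_def prob_space)
  next
    case (Suc i)
    \<comment> \<open>\<open>\<Phi>1\<close> is the part already frozen, \<open>\<Phi>2\<close> the
      part still running. Only the latter receives the next factor, whose conditional mean is at
      most 1.\<close>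
    define \<Phi>1 where "\<Phi>1 x = (if exp r \<le> V x i then V x i else 0)" for x
    define \<Phi>2 where "\<Phi>2 x = (if exp r \<le> V x i then 0 else V x i)" for x
    define G where "G \<xi> z = exp (w i \<xi> z)" for \<xi> z
    note int = integrable_finite_rv[OF pm finite_paths]
    have lastS: "X (t i) \<omega> = path (Suc i) t \<omega> i" "X (t (Suc i)) \<omega> = path (Suc i) t \<omega> (Suc i)" for \<omega>
      by (simp_all add: path_def)
    have last: "X (t i) \<omega> = path i t \<omega> i" for \<omega>
      by (simp add: path_def)
    have Phi2: "\<Phi>2 (path i t \<omega>) = \<Phi>2 (path (Suc i) t \<omega>)" for \<omega>
      by (simp add: \<Phi>2_def Vpath)
    have i1: "integrable M (\<lambda>\<omega>. \<Phi>1 (path i t \<omega>))"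
      using int[of i \<Phi>1] Suc by auto
    have i2: "integrable M (\<lambda>\<omega>. \<Phi>2 (path i t \<omega>) * G (X (t i) \<omega>) (X (t (Suc i)) \<omega>))"
      using int[of "Suc i" "\<lambda>x. \<Phi>2 x * G (x i) (x (Suc i))"] Suc unfolding Phi2 lastS by auto
    have i3: "integrable M (\<lambda>\<omega>. \<Phi>2 (path i t \<omega>) *
        (\<Sum>z\<in>E. p (t (Suc i) - t i) (X (t i) \<omega>) z * G (X (t i) \<omega>) z))"
      using int[of i "\<lambda>x. \<Phi>2 x * (\<Sum>z\<in>E. p (t (Suc i) - t i) (x i) z * G (x i) z)"] Suc
      unfolding last by auto
    have i4: "integrable M (\<lambda>\<omega>. \<Phi>2 (path i t \<omega>))"
      using int[of i \<Phi>2] Suc by auto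
    have "expectation (\<lambda>\<omega>. V (path (Suc i) t \<omega>) (Suc i)) =
        expectation (\<lambda>\<omega>. \<Phi>1 (path i t \<omega>) + \<Phi>2 (path i t \<omega>) * G (X (t i) \<omega>) (X (t (Suc i)) \<omega>))"
      by (intro Bochner_Integration.integral_cong refl)
        (simp add: V_def \<Phi>1_def \<Phi>2_def G_def Vpath[unfolded V_def] lastS[symmetric])
    also have "\<dots> = expectation (\<lambda>\<omega>. \<Phi>1 (path i t \<omega>)) +
        expectation (\<lambda>\<omega>. \<Phi>2 (path i t \<omega>) * G (X (t i) \<omega>) (X (t (Suc i)) \<omega>))"
      using i1 i2 by simp
    also have "expectation (\<lambda>\<omega>. \<Phi>2 (path i t \<omega>) * G (X (t i) \<omega>) (X (t (Suc i)) \<omega>)) =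
        expectation (\<lambda>\<omega>. \<Phi>2 (path i t \<omega>) *
          (\<Sum>z\<in>E. p (t (Suc i) - t i) (X (t i) \<omega>) z * G (X (t i) \<omega>) z))"
      using Suc t by (intro markov_step) auto
    also have "\<dots> \<le> expectation (\<lambda>\<omega>. \<Phi>2 (path i t \<omega>))"
    proof (intro integral_mono i3 i4)
      fix \<omega> assume "\<omega> \<in> space M"
      then have "(\<Sum>z\<in>E. p (t (Suc i) - t i) (X (t i) \<omega>) z * G (X (t i) \<omega>) z) \<le> 1"
        unfolding G_def using Suc X_in tpos by (intro w) auto
      moreover have "0 \<le> \<Phi>2 (path i t \<omega>)"
        unfolding \<Phi>2_def V_def using less_imp_le[OF stopped_product_pos[of "exp r" w "path i t \<omega>" i]] by auto
      ultimately show "\<Phi>2 (path i t \<omega>) *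
          (\<Sum>z\<in>E. p (t (Suc i) - t i) (X (t i) \<omega>) z * G (X (t i) \<omega>) z) \<le> \<Phi>2 (path i t \<omega>)"
        by (simp add: mult_left_le)
    qed
    also have "expectation (\<lambda>\<omega>. \<Phi>1 (path i t \<omega>)) + expectation (\<lambda>\<omega>. \<Phi>2 (path i t \<omega>)) =
        expectation (\<lambda>\<omega>. \<Phi>1 (path i t \<omega>) + \<Phi>2 (path i t \<omega>))"
      using i1 i4 by simp
    also have "\<dots> = expectation (\<lambda>\<omega>. V (path i t \<omega>) i)"
      by (intro Bochner_Integration.integral_cong) (auto simp: \<Phi>1_def \<Phi>2_def)
    also have "\<dots> \<le> 1" using Suc by simp
    finally show ?case by simp
  qed
  define S where "S x i = (\<Sum>j<i. w j (x j) (x (Suc j)))" for x i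
  have Spath: "S (path n t \<omega>) i = S (\<lambda>i. X (t i) \<omega>) i" if "i \<le> n" for i \<omega>
    unfolding S_def using that by (intro sum.cong) (auto simp: path_def)
  let ?A = "{\<omega>\<in>space M. \<exists>i\<le>n. r \<le> (\<Sum>j<i. w j (X (t j) \<omega>) (X (t (Suc j)) \<omega>))}"
  have "?A = path n t -` {x \<in> {..n} \<rightarrow>\<^sub>E E. \<exists>i\<le>n. r \<le> S x i} \<inter> space M"
    using measurable_space[OF pm[of n]] Spath unfolding S_def by auto
  then show A: "?A \<in> sets M"
    using measurable_sets[OF pm[of n], of "{x \<in> {..n} \<rightarrow>\<^sub>E E. \<exists>i\<le>n. r \<le> S x i}"] by auto
  have intV: "integrable M (\<lambda>\<omega>. V (path n t \<omega>) n)"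
    using integrable_finite_rv[OF pm finite_paths, of n "\<lambda>x. V x n"] by auto
  have "?A \<subseteq> {\<omega>\<in>space M. exp r \<le> V (path n t \<omega>) n}"
  proof safe
    fix \<omega> i assume *: "\<omega> \<in> space M" "i \<le> n" "r \<le> (\<Sum>j<i. w j (X (t j) \<omega>) (X (t (Suc j)) \<omega>))"
    show "exp r \<le> V (path n t \<omega>) n"
    proof (rule ccontr)
      assume "\<not> exp r \<le> V (path n t \<omega>) n"
      then have "V (\<lambda>i. X (t i) \<omega>) n < exp r" by (simp add: Vpath)
      from stopped_product_eq(2)[OF this[unfolded V_def] *(2)] *(3) show False by simp
    qed
  qed
  then have "prob ?A \<le> prob {\<omega>\<in>space M. exp r \<le> V (path n t \<omega>) n}"
    by (intro finite_measure_mono) (use intV in measurable)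
  also have "\<dots> \<le> expectation (\<lambda>\<omega>. V (path n t \<omega>) n) / exp r"
    by (rule integral_Markov_inequality_measure[where A="{}"])
      (use intV in \<open>auto simp: V_def less_imp_le[OF stopped_product_pos]\<close>)
  also have "\<dots> \<le> 1 / exp r"
    using EV[of n] by (intro divide_right_mono) auto
  finally show "prob ?A \<le> exp (- r)"
    by (simp add: exp_minus field_simps)
qed

end

section \<open>Discrete calculus and the exclusion generator\<close>

definition rsite :: "nat \<Rightarrow> nat \<Rightarrow> nat" where "rsite N x = (x + 1) mod N"
text \<open>Adding \<open>N\<close> first keeps the subtraction on natural numbers from truncating
  at site 0.\<close>

definition lsite :: "nat \<Rightarrow> nat \<Rightarrow> nat" where "lsite N x = (x + N - 1) mod N"

definition pairing :: "nat \<Rightarrow> (nat \<Rightarrow> real) \<Rightarrow> (nat \<Rightarrow> real) \<Rightarrow> real" where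
  "pairing N c z = (\<Sum>x<N. c x * z x)"
definition grad :: "nat \<Rightarrow> (nat \<Rightarrow> real) \<Rightarrow> nat \<Rightarrow> real" where
  "grad N c x = c (rsite N x) - c x"
definition lap :: "nat \<Rightarrow> (nat \<Rightarrow> real) \<Rightarrow> nat \<Rightarrow> real" where
  "lap N c x = c (rsite N x) + c (lsite N x) - 2 * c x"
definition energy :: "nat \<Rightarrow> (nat \<Rightarrow> real) \<Rightarrow> real" where
  "energy N c = (\<Sum>x<N. (grad N c x)\<^sup>2)"

lemma rsite_less: "x < N \<Longrightarrow> rsite N x < N"
  by (simp add: rsite_def)

lemma lsite_less: "x < N \<Longrightarrow> lsite N x < N"
  by (simp add: lsite_def)

lemma rsite_lsite: "x < N \<Longrightarrow> rsite N (lsite N x) = x"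
proof -
  assume x: "x < N"
  have "rsite N (lsite N x) = (x + N - 1 + 1) mod N"
    unfolding rsite_def lsite_def by (rule mod_add_left_eq)
  also have "\<dots> = x" using x by simp
  finally show ?thesis .
qed

lemma lsite_rsite: "x < N \<Longrightarrow> lsite N (rsite N x) = x"
proof (cases "Suc x = N")
  case False
  assume "x < N"
  with False show ?thesis by (simp add: rsite_def lsite_def)
qed (auto simp: rsite_def lsite_def)

lemma bij_rsite: "bij_betw (rsite N) {..<N} {..<N}"
  by (rule bij_betwI[where g = "lsite N"]) (auto simp: rsite_less lsite_less rsite_lsite lsite_rsite)

lemma sum_rsite: "(\<Sum>x<N. f (rsite N x)) = (\<Sum>x<N. (f x :: real))"
  by (rule sum.reindex_bij_betw[OF bij_rsite])

lemma sum_grad_diff: "(\<Sum>x<N. grad N c x * (z x - z (rsite N x))) = pairing N (lap N c) z"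
proof -
  have "(\<Sum>x<N. grad N c x * z (rsite N x)) = (\<Sum>x<N. grad N c (lsite N (rsite N x)) * z (rsite N x))"
    by (intro sum.cong) (auto simp: lsite_rsite)
  also have "\<dots> = (\<Sum>x<N. grad N c (lsite N x) * z x)"
    by (rule sum_rsite[of "\<lambda>x. grad N c (lsite N x) * z x"])
  finally have "(\<Sum>x<N. grad N c x * (z x - z (rsite N x))) =
      (\<Sum>x<N. (grad N c x - grad N c (lsite N x)) * z x)"
    by (simp add: algebra_simps sum_subtractf)
  also have "\<dots> = pairing N (lap N c) z"
    unfolding pairing_def by (intro sum.cong) (auto simp: grad_def lap_def rsite_lsite)
  finally show ?thesis .
qed

lemma pairing_lap_self: "pairing N (lap N c) c = - energy N c"
  unfolding sum_grad_diff[symmetric] energy_def sum_negf[symmetric]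
  by (intro sum.cong) (auto simp: grad_def power2_eq_square algebra_simps)

text \<open>The Laplacian is the difference of two neighbouring gradients. The square of a
  difference costs a factor 2, and the two resulting sums both equal the energy.\<close>

lemma sum_lap_squared_le: "(\<Sum>x<N. (lap N c x)\<^sup>2) \<le> 4 * energy N c"
proof -
  have "(\<Sum>x<N. (grad N c (lsite N x))\<^sup>2) = energy N c"
    unfolding energy_def sum_rsite[of "\<lambda>x. (grad N c (lsite N x))\<^sup>2", symmetric]
    by (intro sum.cong) (auto simp: lsite_rsite)
  moreover have "(lap N c x)\<^sup>2 \<le> 2 * (grad N c x)\<^sup>2 + 2 * (grad N c (lsite N x))\<^sup>2" if "x < N" for x
  proof -
    have "lap N c x = grad N c x - grad N c (lsite N x)"
      using that by (simp add: lap_def grad_def rsite_lsite)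
    moreover have "(a - b)\<^sup>2 \<le> 2 * a\<^sup>2 + 2 * b\<^sup>2" for a b :: real
      using zero_le_power2[of "a + b"] by (simp add: power2_eq_square algebra_simps)
    ultimately show ?thesis by simp
  qed
  then have "(\<Sum>x<N. (lap N c x)\<^sup>2) \<le> (\<Sum>x<N. 2 * (grad N c x)\<^sup>2 + 2 * (grad N c (lsite N x))\<^sup>2)"
    by (intro sum_mono) auto
  ultimately show ?thesis
    by (simp add: sum.distrib sum_distrib_left[symmetric] energy_def)
qed

lemma energy_nonneg: "0 \<le> energy N c"
  unfolding energy_def by (intro sum_nonneg) auto

text \<open>Explicit Euler step of the heat equation: the first-order term dissipates
  \<open>2 * k\<close> times the energy, the second-order term gives back at most
  \<open>4 * k\<^sup>2 \<le> k\<close> times it. The remaining \<open>k\<close> times the energy is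
  what later pays for the quadratic error of the generator.\<close>

lemma euler_step_energy:
  assumes "0 \<le> k" "4 * k \<le> 1"
  shows "(\<Sum>x<N. (c x + k * lap N c x)\<^sup>2) + k * energy N c \<le> (\<Sum>x<N. (c x)\<^sup>2)"
proof -
  have "(\<Sum>x<N. (c x + k * lap N c x)\<^sup>2) =
      (\<Sum>x<N. (c x)\<^sup>2) + 2 * k * pairing N (lap N c) c + k\<^sup>2 * (\<Sum>x<N. (lap N c x)\<^sup>2)"
    by (simp add: power2_eq_square algebra_simps sum.distrib sum_distrib_left pairing_def)
  also have "\<dots> \<le> (\<Sum>x<N. (c x)\<^sup>2) + 2 * k * pairing N (lap N c) c + k\<^sup>2 * (4 * energy N c)"
    by (intro add_left_mono mult_left_mono sum_lap_squared_le) auto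
  finally have "(\<Sum>x<N. (c x + k * lap N c x)\<^sup>2) \<le>
      (\<Sum>x<N. (c x)\<^sup>2) + (- 2 * k * energy N c + k * (4 * k) * energy N c)"
    by (simp add: pairing_lap_self power2_eq_square algebra_simps)
  moreover have "k * (4 * k) * energy N c \<le> k * 1 * energy N c"
    using assms energy_nonneg by (intro mult_right_mono mult_left_mono) auto
  ultimately show ?thesis by simp
qed

text \<open>Discrete maximum principle: for \<open>2 * k \<le> 1\<close> the new value is a convex
  combination of three old ones.\<close>

lemma euler_step_bound:
  assumes "0 \<le> k" "2 * k \<le> 1" "\<And>x. x < N \<Longrightarrow> \<bar>c x\<bar> \<le> B" "x < N"
  shows "\<bar>c x + k * lap N c x\<bar> \<le> B"
proof -
  have "c x + k * lap N c x = (1 - 2 * k) * c x + k * c (rsite N x) + k * c (lsite N x)"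
    by (simp add: lap_def algebra_simps)
  also have "\<bar>\<dots>\<bar> \<le> \<bar>(1 - 2 * k) * c x\<bar> + \<bar>k * c (rsite N x)\<bar> + \<bar>k * c (lsite N x)\<bar>"
    by linarith
  also have "\<dots> = (1 - 2 * k) * \<bar>c x\<bar> + k * \<bar>c (rsite N x)\<bar> + k * \<bar>c (lsite N x)\<bar>"
    using assms by (simp add: abs_mult)
  also have "\<dots> \<le> (1 - 2 * k) * B + k * B + k * B"
    using assms by (intro add_mono mult_left_mono) (auto simp: rsite_less lsite_less)
  finally show ?thesis by (simp add: algebra_simps)
qed

lemma exp_le_quadratic: "\<bar>d\<bar> \<le> 1 \<Longrightarrow> exp d \<le> 1 + d + d\<^sup>2" for d :: real
proof (cases "0 \<le> d")
  case False
  assume "\<bar>d\<bar> \<le> 1"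
  define u where "u = - d"
  have u: "0 < u" "u \<le> 1" using False \<open>\<bar>d\<bar> \<le> 1\<close> by (auto simp: u_def)
  have "1 + u \<le> exp u" by (rule exp_ge_add_one_self)
  then have "exp (- u) \<le> 1 / (1 + u)"
    using u by (simp add: exp_minus field_simps)
  also have "\<dots> \<le> 1 - u + u\<^sup>2"
  proof -
    have "1 \<le> (1 - u + u\<^sup>2) * (1 + u)"
      using u by (simp add: power2_eq_square algebra_simps)
    then show ?thesis using u by (simp add: divide_le_eq)
  qed
  finally show ?thesis by (simp add: u_def)
qed (auto intro: exp_bound)

lemma pairing_add: "pairing N (\<lambda>x. c x + d x) z = pairing N c z + pairing N d z"
  by (simp add: pairing_def algebra_simps sum.distrib)

lemma pairing_cmult: "pairing N (\<lambda>x. k * c x) z = k * pairing N c z"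
  by (simp add: pairing_def sum_distrib_left mult_ac)

lemma pairing_diff_right: "pairing N c (\<lambda>x. y x - z x) = pairing N c y - pairing N c z"
  by (simp add: pairing_def algebra_simps sum_subtractf)

lemma pairing_bound:
  assumes "\<And>x. x < N \<Longrightarrow> \<bar>c x\<bar> \<le> B" "\<And>x. x < N \<Longrightarrow> \<bar>z x\<bar> \<le> 1"
  shows "\<bar>pairing N c z\<bar> \<le> real N * B"
proof -
  have "\<bar>pairing N c z\<bar> \<le> (\<Sum>x<N. \<bar>c x * z x\<bar>)"
    unfolding pairing_def by (rule sum_abs)
  also have "\<dots> \<le> (\<Sum>x<N. B * 1)"
    unfolding abs_mult using assms by (intro sum_mono mult_mono) (auto intro: order_trans[OF abs_ge_zero])
  finally show ?thesis by simp
qed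

lemma configuration_values: "\<xi> \<in> configurations N \<Longrightarrow> x < N \<Longrightarrow> \<xi> x = 0 \<or> \<xi> x = 1"
  unfolding configurations_def by auto

lemma finite_configurations: "finite (configurations N)"
  unfolding configurations_def by (intro finite_PiE) auto

lemma exchange_configuration:
  assumes "\<xi> \<in> configurations N" "x < N" "y < N"
  shows "\<xi> \<circ> Transposition.transpose x y \<in> configurations N"
proof -
  have "\<xi> (Transposition.transpose x y z) \<in> {0, 1}" if "z < N" for z
    using assms that configuration_values[OF assms(1)] by (auto simp: Transposition.transpose_def)
  moreover have "\<xi> (Transposition.transpose x y z) = undefined" if "\<not> z < N" for z
    using assms that by (auto simp: Transposition.transpose_def configurations_def PiE_def extensional_def)
  ultimately show ?thesis by (auto simp: configurations_def PiE_def extensional_def)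
qed

lemma pairing_exchange:
  assumes "x < N" "y < N"
  shows "pairing N c (\<lambda>z. real (\<xi> (Transposition.transpose x y z))) =
    pairing N c (\<lambda>z. real (\<xi> z)) + (c y - c x) * (real (\<xi> x) - real (\<xi> y))"
proof (cases "x = y")
  case False
  have "pairing N c (\<lambda>z. real (\<xi> (Transposition.transpose x y z))) - pairing N c (\<lambda>z. real (\<xi> z)) =
      (\<Sum>z<N. c z * (real (\<xi> (Transposition.transpose x y z)) - real (\<xi> z)))"
    by (simp add: pairing_def sum_subtractf algebra_simps)
  also have "\<dots> = (\<Sum>z\<in>{x, y}. c z * (real (\<xi> (Transposition.transpose x y z)) - real (\<xi> z)))"
    using assms by (intro sum.mono_neutral_right) (auto simp: Transposition.transpose_def)
  also have "\<dots> = (c y - c x) * (real (\<xi> x) - real (\<xi> y))"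
    using False by (simp add: algebra_simps)
  finally show ?thesis by simp
qed simp

lemma generator_pairing:
  "exclusion_generator N (\<lambda>\<xi>. pairing N c (\<lambda>x. real (\<xi> x))) \<xi> =
    (real N)\<^sup>2 * pairing N (lap N c) (\<lambda>x. real (\<xi> x))"
  unfolding exclusion_generator_def rsite_def[symmetric] sum_grad_diff[symmetric]
  by (intro arg_cong2[where f = "(*)"] sum.cong) (auto simp: pairing_exchange rsite_less grad_def)

text \<open>An exchange over a bond changes the pairing by the gradient times an occupation
  difference of modulus at most 1. To second order, summation by parts turns the linear terms into
  the Laplacian, and the squares add up to at most the energy.\<close>

lemma generator_exp_pairing:
  assumes \<xi>: "\<xi> \<in> configurations N" and c: "\<And>x. x < N \<Longrightarrow> \<bar>grad N c x\<bar> \<le> 1"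
  shows "exclusion_generator N (\<lambda>\<xi>. exp (pairing N c (\<lambda>x. real (\<xi> x)))) \<xi> \<le>
    exp (pairing N c (\<lambda>x. real (\<xi> x))) *
      ((real N)\<^sup>2 * (pairing N (lap N c) (\<lambda>x. real (\<xi> x)) + energy N c))"
proof -
  let ?P = "pairing N c (\<lambda>x. real (\<xi> x))"
  let ?d = "\<lambda>x. grad N c x * (real (\<xi> x) - real (\<xi> (rsite N x)))"
  have "(\<Sum>x<N. exp (pairing N c (\<lambda>z. real (\<xi> (Transposition.transpose x (rsite N x) z)))) - exp ?P) =
      (\<Sum>x<N. exp ?P * (exp (?d x) - 1))"
    by (intro sum.cong) (auto simp: pairing_exchange rsite_less grad_def exp_add right_diff_distrib)
  also have "\<dots> \<le> (\<Sum>x<N. exp ?P * (?d x + (grad N c x)\<^sup>2))"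
  proof (intro sum_mono mult_left_mono)
    fix x assume x: "x \<in> {..<N}"
    have v: "\<bar>real (\<xi> x) - real (\<xi> (rsite N x))\<bar> \<le> 1"
      using configuration_values[OF \<xi>, of x] configuration_values[OF \<xi>, of "rsite N x"] x rsite_less
      by auto
    have d: "\<bar>?d x\<bar> \<le> \<bar>grad N c x\<bar> * 1"
      unfolding abs_mult using v by (intro mult_left_mono) auto
    then have "(?d x)\<^sup>2 \<le> (grad N c x)\<^sup>2"
      by (simp add: abs_le_square_iff)
    moreover have "exp (?d x) \<le> 1 + ?d x + (?d x)\<^sup>2"
      using d c x by (intro exp_le_quadratic) (auto intro: order_trans)
    ultimately show "exp (?d x) - 1 \<le> ?d x + (grad N c x)\<^sup>2" by simp
  qed simp
  also have "\<dots> = exp ?P * (pairing N (lap N c) (\<lambda>x. real (\<xi> x)) + energy N c)"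
    by (simp add: sum_distrib_left[symmetric] sum.distrib energy_def
        sum_grad_diff[of N c "\<lambda>x. real (\<xi> x)"])
  finally have "(real N)\<^sup>2 * (\<Sum>x<N. exp (pairing N c (\<lambda>z. real (\<xi> (Transposition.transpose x (rsite N x) z)))) - exp ?P)
      \<le> (real N)\<^sup>2 * (exp ?P * (pairing N (lap N c) (\<lambda>x. real (\<xi> x)) + energy N c))"
    by (intro mult_left_mono) auto
  then show ?thesis
    unfolding exclusion_generator_def rsite_def[symmetric] by (simp add: mult.left_commute)
qed

lemma le_exp_epsilon:
  assumes "\<And>e. 0 < e \<Longrightarrow> y \<le> exp (a + e)" shows "y \<le> exp (a :: real)"
proof (cases "0 < y")
  case True
  have "ln y \<le> a + e" if "0 < e" for e
    using ln_mono[OF assms[OF that] True] by simp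
  then have "ln y \<le> a" by (rule field_le_epsilon)
  then show ?thesis using True by (metis exp_le_cancel_iff exp_ln)
qed (use exp_gt_zero[of a] in linarith)

section \<open>The exclusion process and its generator expansion at small times\<close>

locale exclusion_process = finite_markov M "configurations N" p X
  for M :: "'w measure" and N p X +
  assumes N_pos: "1 \<le> N"
    and generator: "has_generator (configurations N) p (exclusion_generator N)"
    and cadlag: "\<And>\<omega>. \<omega> \<in> space M \<Longrightarrow> cadlag_on (discrete_topology (configurations N)) {0..} (\<lambda>t. X t \<omega>)"
    and initial_indep: "indep_vars (\<lambda>_. count_space UNIV) (\<lambda>x \<omega>. X 0 \<omega> x) {..<N}"
begin

abbreviation "E \<equiv> configurations N"

definition m :: "real \<Rightarrow> nat \<Rightarrow> real" where
  "m t x = expectation (\<lambda>\<omega>. real (X t \<omega> x))"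

definition Z :: "real \<Rightarrow> (nat \<Rightarrow> real) \<Rightarrow> 'w \<Rightarrow> real" where
  "Z t c \<omega> = pairing N c (\<lambda>x. real (X t \<omega> x) - m t x)"

text \<open>Expansion in indicators of states: it reduces claims about all functions to the finitely
  many indicators.\<close>

lemma generator_linear:
  assumes "\<xi> \<in> E"
  shows "exclusion_generator N g \<xi> = (\<Sum>z\<in>E. g z * exclusion_generator N (\<lambda>y. if y = z then 1 else 0) \<xi>)"
proof -
  have g: "g \<xi>' = (\<Sum>z\<in>E. g z * (if \<xi>' = z then 1 else 0))" if "\<xi>' \<in> E" for \<xi>'
    using that finite_configurations by (simp add: if_distrib sum.delta' cong: if_cong)
  have "exclusion_generator N g \<xi> = (real N)\<^sup>2 * (\<Sum>x<N. \<Sum>z\<in>E. g z *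
      ((if \<xi> \<circ> Transposition.transpose x ((x + 1) mod N) = z then 1 else 0) - (if \<xi> = z then 1 else 0)))"
    unfolding exclusion_generator_def
  proof (intro arg_cong2[where f = "(*)"] sum.cong refl)
    fix x assume "x \<in> {..<N}"
    then have "\<xi> \<circ> Transposition.transpose x ((x + 1) mod N) \<in> E"
      using assms by (intro exchange_configuration) auto
    then show "g (\<xi> \<circ> Transposition.transpose x ((x + 1) mod N)) - g \<xi> = (\<Sum>z\<in>E. g z *
      ((if \<xi> \<circ> Transposition.transpose x ((x + 1) mod N) = z then 1 else 0) - (if \<xi> = z then 1 else 0)))"
      by (simp add: right_diff_distrib sum_subtractf g[OF assms, symmetric] g[symmetric] del: comp_apply)
  qed
  also have "\<dots> = (\<Sum>z\<in>E. g z * exclusion_generator N (\<lambda>y. if y = z then 1 else 0) \<xi>)"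
    unfolding exclusion_generator_def
    by (subst sum.swap) (simp add: sum_distrib_left mult_ac)
  finally show ?thesis .
qed

text \<open>\<open>has_generator\<close> gives a limit for one function and one state at a time.
  With finitely many states and the indicator expansion it becomes uniform in the function, which
  matters because the test function changes at each Euler step.\<close>

lemma uniform_generator:
  assumes "0 < e"
  shows "\<exists>h0>0. \<forall>h. 0 < h \<and> h < h0 \<longrightarrow> (\<forall>\<xi>\<in>E. \<forall>g.
    \<bar>(\<Sum>z\<in>E. p h \<xi> z * g z) - g \<xi> - h * exclusion_generator N g \<xi>\<bar> \<le> e * h * (\<Sum>z\<in>E. \<bar>g z\<bar>))"
proof -
  define \<delta> :: "(nat \<Rightarrow> nat) \<Rightarrow> (nat \<Rightarrow> nat) \<Rightarrow> real" where "\<delta> z y = (if y = z then 1 else 0)" for z y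
  define L where "L = exclusion_generator N"
  have "\<forall>\<xi>\<in>E. \<forall>z\<in>E. eventually (\<lambda>h. \<bar>(p h \<xi> z - \<delta> z \<xi>) / h - L (\<delta> z) \<xi>\<bar> < e) (at_right 0)"
  proof (intro ballI)
    fix \<xi> z assume "\<xi> \<in> E" "z \<in> E"
    then have "((\<lambda>h. ((\<Sum>y\<in>E. p h \<xi> y * \<delta> z y) - \<delta> z \<xi>) / h) \<longlongrightarrow> L (\<delta> z) \<xi>) (at_right 0)"
      using generator unfolding has_generator_def L_def by blast
    moreover have "(\<Sum>y\<in>E. p h \<xi> y * \<delta> z y) = p h \<xi> z" for h
      using \<open>z \<in> E\<close> finite_configurations by (simp add: \<delta>_def if_distrib cong: if_cong)
    ultimately show "eventually (\<lambda>h. \<bar>(p h \<xi> z - \<delta> z \<xi>) / h - L (\<delta> z) \<xi>\<bar> < e) (at_right 0)"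
      using tendstoD[OF _ assms, of "\<lambda>h. (p h \<xi> z - \<delta> z \<xi>) / h"] by (simp add: dist_real_def)
  qed
  then have "eventually (\<lambda>h. \<forall>\<xi>\<in>E. \<forall>z\<in>E. \<bar>(p h \<xi> z - \<delta> z \<xi>) / h - L (\<delta> z) \<xi>\<bar> < e) (at_right 0)"
    by (simp add: eventually_ball_finite_distrib finite_configurations)
  then obtain h0 where h0: "0 < h0" "\<And>h \<xi> z. 0 < h \<Longrightarrow> h < h0 \<Longrightarrow> \<xi> \<in> E \<Longrightarrow> z \<in> E \<Longrightarrow>
      \<bar>(p h \<xi> z - \<delta> z \<xi>) / h - L (\<delta> z) \<xi>\<bar> < e"
    unfolding eventually_at_right_field by blast
  show ?thesis
  proof (intro exI[of _ h0] conjI allI impI ballI)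
    fix h \<xi> and g :: "(nat \<Rightarrow> nat) \<Rightarrow> real"
    assume h: "0 < h \<and> h < h0" and \<xi>: "\<xi> \<in> E"
    have g: "g \<xi> = (\<Sum>z\<in>E. g z * \<delta> z \<xi>)"
      using \<xi> finite_configurations by (simp add: \<delta>_def if_distrib sum.delta' cong: if_cong)
    have Lg: "exclusion_generator N g \<xi> = (\<Sum>z\<in>E. g z * L (\<delta> z) \<xi>)"
      using generator_linear[OF \<xi>, of g] unfolding \<delta>_def L_def by simp
    have eq: "g z * (h * ((p h \<xi> z - \<delta> z \<xi>) / h - L (\<delta> z) \<xi>)) =
        p h \<xi> z * g z - g z * \<delta> z \<xi> - h * (g z * L (\<delta> z) \<xi>)" for z
      using h by (simp add: field_simps)
    have "\<bar>(\<Sum>z\<in>E. p h \<xi> z * g z) - g \<xi> - h * exclusion_generator N g \<xi>\<bar> =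
        \<bar>\<Sum>z\<in>E. g z * (h * ((p h \<xi> z - \<delta> z \<xi>) / h - L (\<delta> z) \<xi>))\<bar>"
      unfolding Lg eq by (subst g) (simp add: sum_subtractf sum_distrib_left)
    also have "\<dots> \<le> (\<Sum>z\<in>E. \<bar>g z * (h * ((p h \<xi> z - \<delta> z \<xi>) / h - L (\<delta> z) \<xi>))\<bar>)"
      by (rule sum_abs)
    also have "\<dots> \<le> (\<Sum>z\<in>E. \<bar>g z\<bar> * (h * e))"
      unfolding abs_mult using h h0(2) \<xi>
      by (intro sum_mono mult_left_mono mult_mono) (auto intro: less_imp_le)
    finally show "\<bar>(\<Sum>z\<in>E. p h \<xi> z * g z) - g \<xi> - h * exclusion_generator N g \<xi>\<bar> \<le>
        e * h * (\<Sum>z\<in>E. \<bar>g z\<bar>)"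
      by (simp add: sum_distrib_left mult_ac)
  qed (fact h0)
qed

end

section \<open>Sub-Gaussian bounds for the exclusion process\<close>

text \<open>Jensen's inequality for the uniform mean of \<open>n\<close> terms. It bounds the
  exponential moment of a time integral by fixed-time moments, without control of correlations in
  time.\<close>

lemma exp_sum_le_mean:
  fixes u :: "nat \<Rightarrow> real"
  assumes "0 < n"
  shows "exp (\<Sum>j<n. u j) \<le> (\<Sum>j<n. exp (real n * u j)) / real n"
proof -
  have "exp (1 * (\<Sum>j<n. (1 / real n) *\<^sub>R (real n * u j))) \<le>
      (\<Sum>j<n. (1 / real n) * exp (1 * (real n * u j)))"
    using assms by (intro convex_on_sum[OF _ _ convex_on_exp]) auto
  then show ?thesis using assms by (simp add: sum_divide_distrib)
qed

context exclusion_process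
begin

abbreviation conf :: "(nat \<Rightarrow> nat) \<Rightarrow> nat \<Rightarrow> real" where
  "conf \<xi> \<equiv> \<lambda>x. real (\<xi> x)"

lemma conf_bound: "\<xi> \<in> E \<Longrightarrow> x < N \<Longrightarrow> \<bar>conf \<xi> x\<bar> \<le> 1"
  using configuration_values by fastforce

lemma integrable_X: "0 \<le> t \<Longrightarrow> integrable M (\<lambda>\<omega>. (g (X t \<omega>) :: real))"
  by (rule integrable_finite_rv[OF X_measurable finite_states])

lemma m_bound: "0 \<le> t \<Longrightarrow> x < N \<Longrightarrow> \<bar>m t x\<bar> \<le> 1"
proof -
  assume t: "0 \<le> t" and x: "x < N"
  have "\<bar>m t x\<bar> \<le> expectation (\<lambda>\<omega>. \<bar>real (X t \<omega> x)\<bar>)"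
    unfolding m_def by (rule integral_abs_bound)
  also have "\<dots> \<le> expectation (\<lambda>\<omega>. 1)"
    using integrable_X[OF t, of "\<lambda>\<xi>. \<bar>real (\<xi> x)\<bar>"] conf_bound[OF X_in[OF t]] x
    by (intro integral_mono) auto
  finally show ?thesis by (simp add: prob_space)
qed

lemma pairing_mean:
  assumes "0 \<le> t"
  shows "pairing N c (m t) = expectation (\<lambda>\<omega>. pairing N c (conf (X t \<omega>)))"
proof -
  have "integrable M (\<lambda>\<omega>. real (X t \<omega> x))" for x
    using integrable_X[OF assms, of "\<lambda>\<xi>. real (\<xi> x)"] .
  then show ?thesis
    unfolding pairing_def m_def by (subst Bochner_Integration.integral_sum) auto
qed

lemma states_pos: "0 < card E"
  using not_empty X_in[of 0] finite_states by (auto simp: card_gt_0_iff)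

text \<open>The error of \<open>uniform_generator\<close> is additive. It becomes a factor
  \<open>exp (e * h)\<close> because, for coefficients at most 1/2, the exponentials at two
  configurations differ by at most the factor \<open>exp N\<close>.\<close>

lemma exp_step:
  assumes "0 < e"
  shows "\<exists>h0>0. \<forall>h. 0 < h \<and> h < h0 \<longrightarrow> (\<forall>c. (\<forall>x<N. \<bar>c x\<bar> \<le> 1 / 2) \<longrightarrow> (\<forall>\<xi>\<in>E.
    (\<Sum>z\<in>E. p h \<xi> z * exp (pairing N c (conf z))) \<le>
      exp (pairing N c (conf \<xi>) + h * (real N)\<^sup>2 * pairing N (lap N c) (conf \<xi>) +
        h * (real N)\<^sup>2 * energy N c + e * h)))"
proof -
  define C where "C = real (card E) * exp (real N)"
  have C: "0 < C" using states_pos by (simp add: C_def)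
  obtain h0 where h0: "0 < h0" "\<And>h \<xi> g. 0 < h \<Longrightarrow> h < h0 \<Longrightarrow> \<xi> \<in> E \<Longrightarrow>
      \<bar>(\<Sum>z\<in>E. p h \<xi> z * g z) - g \<xi> - h * exclusion_generator N g \<xi>\<bar> \<le> e / C * h * (\<Sum>z\<in>E. \<bar>g z\<bar>)"
    using uniform_generator[of "e / C"] assms C by (auto simp: zero_less_divide_iff)
  show ?thesis
  proof (intro exI[of _ h0] conjI allI impI ballI)
    fix h \<xi> and c :: "nat \<Rightarrow> real"
    assume h: "0 < h \<and> h < h0" and c: "\<forall>x<N. \<bar>c x\<bar> \<le> 1 / 2" and \<xi>: "\<xi> \<in> E"
    define g where "g z = exp (pairing N c (conf z))" for z
    define G where "G = (real N)\<^sup>2 * (pairing N (lap N c) (conf \<xi>) + energy N c)"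
    have "\<bar>grad N c x\<bar> \<le> 1" if "x < N" for x
      using c[rule_format, OF that] c[rule_format, OF rsite_less[OF that]] by (simp add: grad_def)
    then have gen: "exclusion_generator N g \<xi> \<le> g \<xi> * G"
      unfolding g_def G_def by (rule generator_exp_pairing[OF \<xi>])
    have pb: "\<bar>pairing N c (conf z)\<bar> \<le> real N * (1 / 2)" if "z \<in> E" for z
      using c conf_bound[OF that] by (intro pairing_bound) auto
    have "g z \<le> exp (real N) * g \<xi>" if "z \<in> E" for z
      using pb[OF that] pb[OF \<xi>] unfolding g_def mult_exp_exp by simp
    then have "(\<Sum>z\<in>E. \<bar>g z\<bar>) \<le> (\<Sum>z\<in>E. exp (real N) * g \<xi>)"
      by (intro sum_mono) (simp add: g_def)
    then have sum: "(\<Sum>z\<in>E. \<bar>g z\<bar>) \<le> C * g \<xi>"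
      by (simp add: C_def)
    have "(\<Sum>z\<in>E. p h \<xi> z * g z) \<le> g \<xi> + h * exclusion_generator N g \<xi> + e / C * h * (\<Sum>z\<in>E. \<bar>g z\<bar>)"
      using h0(2)[of h \<xi> g] h \<xi> by linarith
    also have "\<dots> \<le> g \<xi> + h * (g \<xi> * G) + e / C * h * (C * g \<xi>)"
      using h assms C gen sum by (intro add_mono mult_left_mono) auto
    also have "\<dots> = g \<xi> * (1 + (h * G + e * h))"
      using C by (simp add: algebra_simps)
    also have "\<dots> \<le> g \<xi> * exp (h * G + e * h)"
      by (intro mult_left_mono exp_ge_add_one_self) (simp add: g_def)
    finally show "(\<Sum>z\<in>E. p h \<xi> z * exp (pairing N c (conf z))) \<le>
      exp (pairing N c (conf \<xi>) + h * (real N)\<^sup>2 * pairing N (lap N c) (conf \<xi>) +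
        h * (real N)\<^sup>2 * energy N c + e * h)"
      by (simp add: g_def G_def mult_exp_exp algebra_simps)
  qed (fact h0)
qed

text \<open>The generator maps a linear function of the configuration to a linear one, so the mean
  has no quadratic term: it obeys the discrete heat equation up to \<open>e * h\<close>.\<close>

lemma mean_step:
  assumes "0 < e"
  shows "\<exists>h0>0. \<forall>h. 0 < h \<and> h < h0 \<longrightarrow> (\<forall>c. (\<forall>x<N. \<bar>c x\<bar> \<le> 1 / 2) \<longrightarrow> (\<forall>t\<ge>0.
    \<bar>pairing N c (m (t + h)) - pairing N c (m t) - h * (real N)\<^sup>2 * pairing N (lap N c) (m t)\<bar> \<le> e * h))"
proof -
  define C where "C = real (card E) * real N"
  have C: "0 < C" using states_pos N_pos by (simp add: C_def)
  obtain h0 where h0: "0 < h0" "\<And>h \<xi> g. 0 < h \<Longrightarrow> h < h0 \<Longrightarrow> \<xi> \<in> E \<Longrightarrow>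
      \<bar>(\<Sum>z\<in>E. p h \<xi> z * g z) - g \<xi> - h * exclusion_generator N g \<xi>\<bar> \<le> e / C * h * (\<Sum>z\<in>E. \<bar>g z\<bar>)"
    using uniform_generator[of "e / C"] assms C by (auto simp: zero_less_divide_iff)
  show ?thesis
  proof (intro exI[of _ h0] conjI allI impI)
    fix h t :: real and c :: "nat \<Rightarrow> real"
    assume h: "0 < h \<and> h < h0" and c: "\<forall>x<N. \<bar>c x\<bar> \<le> 1 / 2" and t: "0 \<le> t"
    define g where "g z = pairing N c (conf z)" for z
    have "\<bar>g z\<bar> \<le> real N * 1" if "z \<in> E" for z
      unfolding g_def using c conf_bound[OF that] by (intro pairing_bound) fastforce+
    then have "(\<Sum>z\<in>E. \<bar>g z\<bar>) \<le> C"
      using sum_bounded_above[of E "\<lambda>z. \<bar>g z\<bar>" "real N"] by (simp add: C_def)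
    then have "e / C * h * (\<Sum>z\<in>E. \<bar>g z\<bar>) \<le> e / C * h * C"
      using h assms C by (intro mult_left_mono) auto
    then have bd: "\<bar>(\<Sum>z\<in>E. p h \<xi> z * g z) - g \<xi> - h * exclusion_generator N g \<xi>\<bar> \<le> e * h"
      if "\<xi> \<in> E" for \<xi>
      using h0(2)[of h \<xi> g] that h C by (auto simp: mult.commute)
    have gen: "exclusion_generator N g \<xi> = (real N)\<^sup>2 * pairing N (lap N c) (conf \<xi>)" for \<xi>
      unfolding g_def by (rule generator_pairing)
    define D where "D \<xi> = (\<Sum>z\<in>E. p h \<xi> z * g z) - g \<xi> - h * exclusion_generator N g \<xi>" for \<xi>
    have "pairing N c (m (t + h)) = expectation (\<lambda>\<omega>. g (X (t + h) \<omega>))"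
      using t h by (simp add: pairing_mean g_def)
    also have "\<dots> = expectation (\<lambda>\<omega>. \<Sum>z\<in>E. p h (X t \<omega>) z * g z)"
      using t h by (intro expectation_step) auto
    also have "\<dots> = expectation (\<lambda>\<omega>. D (X t \<omega>) + (g (X t \<omega>) +
        h * (real N)\<^sup>2 * pairing N (lap N c) (conf (X t \<omega>))))"
      by (simp add: D_def gen algebra_simps)
    also have "\<dots> = expectation (\<lambda>\<omega>. D (X t \<omega>)) + (expectation (\<lambda>\<omega>. g (X t \<omega>)) +
        h * (real N)\<^sup>2 * expectation (\<lambda>\<omega>. pairing N (lap N c) (conf (X t \<omega>))))"
      using integrable_X[OF t, of D] integrable_X[OF t, of g]
        integrable_X[OF t, of "\<lambda>\<xi>. pairing N (lap N c) (conf \<xi>)"] by simp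
    finally have "pairing N c (m (t + h)) - pairing N c (m t) - h * (real N)\<^sup>2 * pairing N (lap N c) (m t)
        = expectation (\<lambda>\<omega>. D (X t \<omega>))"
      using t by (simp add: pairing_mean g_def)
    also have "\<bar>\<dots>\<bar> \<le> expectation (\<lambda>\<omega>. \<bar>D (X t \<omega>)\<bar>)"
      by (rule integral_abs_bound)
    also have "\<dots> \<le> expectation (\<lambda>\<omega>. e * h)"
      using integrable_X[OF t, of "\<lambda>\<xi>. \<bar>D \<xi>\<bar>"] bd X_in[OF t] unfolding D_def
      by (intro integral_mono) auto
    finally show "\<bar>pairing N c (m (t + h)) - pairing N c (m t) -
        h * (real N)\<^sup>2 * pairing N (lap N c) (m t)\<bar> \<le> e * h"
      by (simp add: prob_space)
  qed (fact h0)
qed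

text \<open>One explicit Euler step of length \<open>h\<close> for the discrete heat flow at speed
  \<open>N\<^sup>2\<close>.\<close>

definition estep :: "real \<Rightarrow> (nat \<Rightarrow> real) \<Rightarrow> nat \<Rightarrow> real" where
  "estep h c = (\<lambda>x. c x + h * (real N)\<^sup>2 * lap N c x)"

lemma pairing_estep:
  "pairing N (estep h c) z = pairing N c z + h * (real N)\<^sup>2 * pairing N (lap N c) z"
  by (simp add: estep_def pairing_add pairing_cmult)

text \<open>Centring is compatible with the expansion: mean and configuration are driven by the same
  Laplacian, so both first-order terms combine into the pairing of \<open>estep h c\<close> with the
  centred configuration at the earlier time.\<close>

lemma centred_step:
  assumes "0 < e"
  shows "\<exists>h0>0. \<forall>h. 0 < h \<and> h < h0 \<longrightarrow> (\<forall>c. (\<forall>x<N. \<bar>c x\<bar> \<le> 1 / 2) \<longrightarrow> (\<forall>t\<ge>0. \<forall>\<xi>\<in>E.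
    (\<Sum>z\<in>E. p h \<xi> z * exp (pairing N c (\<lambda>x. conf z x - m (t + h) x))) \<le>
      exp (pairing N (estep h c) (\<lambda>x. conf \<xi> x - m t x) + h * (real N)\<^sup>2 * energy N c + e * h)))"
proof -
  obtain h1 where h1: "0 < h1" "\<forall>h. 0 < h \<and> h < h1 \<longrightarrow> (\<forall>c. (\<forall>x<N. \<bar>c x\<bar> \<le> 1 / 2) \<longrightarrow> (\<forall>\<xi>\<in>E.
    (\<Sum>z\<in>E. p h \<xi> z * exp (pairing N c (conf z))) \<le>
      exp (pairing N c (conf \<xi>) + h * (real N)\<^sup>2 * pairing N (lap N c) (conf \<xi>) +
        h * (real N)\<^sup>2 * energy N c + (e / 2) * h)))"
    using exp_step[of "e / 2"] assms by auto
  obtain h2 where h2: "0 < h2" "\<forall>h. 0 < h \<and> h < h2 \<longrightarrow> (\<forall>c. (\<forall>x<N. \<bar>c x\<bar> \<le> 1 / 2) \<longrightarrow> (\<forall>t\<ge>0.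
    \<bar>pairing N c (m (t + h)) - pairing N c (m t) - h * (real N)\<^sup>2 * pairing N (lap N c) (m t)\<bar> \<le> (e / 2) * h))"
    using mean_step[of "e / 2"] assms by auto
  show ?thesis
  proof (intro exI[of _ "min h1 h2"] conjI allI impI ballI)
    fix h t :: real and \<xi> and c :: "nat \<Rightarrow> real"
    assume h: "0 < h \<and> h < min h1 h2" and c: "\<forall>x<N. \<bar>c x\<bar> \<le> 1 / 2" and t: "0 \<le> t" and \<xi>: "\<xi> \<in> E"
    have ex: "exp (pairing N c (\<lambda>x. conf z x - m (t + h) x)) =
        exp (- pairing N c (m (t + h))) * exp (pairing N c (conf z))" for z
      unfolding pairing_diff_right mult_exp_exp by (rule arg_cong[where f = exp]) linarith
    have "(\<Sum>z\<in>E. p h \<xi> z * exp (pairing N c (\<lambda>x. conf z x - m (t + h) x))) =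
        exp (- pairing N c (m (t + h))) * (\<Sum>z\<in>E. p h \<xi> z * exp (pairing N c (conf z)))"
      unfolding ex sum_distrib_left by (intro sum.cong refl mult.left_commute)
    also have "\<dots> \<le> exp (- pairing N c (m (t + h))) *
        exp (pairing N c (conf \<xi>) + h * (real N)\<^sup>2 * pairing N (lap N c) (conf \<xi>) +
          h * (real N)\<^sup>2 * energy N c + (e / 2) * h)"
      using h1(2)[rule_format, of h c \<xi>] h c \<xi> by (intro mult_left_mono) auto
    also have "\<dots> \<le> exp (pairing N (estep h c) (\<lambda>x. conf \<xi> x - m t x) + h * (real N)\<^sup>2 * energy N c + e * h)"
    proof -
      have "\<bar>pairing N c (m (t + h)) - pairing N c (m t) - h * (real N)\<^sup>2 * pairing N (lap N c) (m t)\<bar> \<le> (e / 2) * h"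
        using h2(2)[rule_format, of h c t] h c t by simp
      then have "- pairing N c (m (t + h)) + (pairing N c (conf \<xi>) +
          h * (real N)\<^sup>2 * pairing N (lap N c) (conf \<xi>) + h * (real N)\<^sup>2 * energy N c + (e / 2) * h) \<le>
        (pairing N c (conf \<xi>) - pairing N c (m t)) + (h * (real N)\<^sup>2 * pairing N (lap N c) (conf \<xi>) -
          h * (real N)\<^sup>2 * pairing N (lap N c) (m t)) + h * (real N)\<^sup>2 * energy N c + e * h"
        by linarith
      then show ?thesis
        unfolding mult_exp_exp pairing_diff_right pairing_estep exp_le_cancel_iff by linarith
    qed
    finally show "(\<Sum>z\<in>E. p h \<xi> z * exp (pairing N c (\<lambda>x. conf z x - m (t + h) x))) \<le>
      exp (pairing N (estep h c) (\<lambda>x. conf \<xi> x - m t x) + h * (real N)\<^sup>2 * energy N c + e * h)" .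
  qed (use h1 h2 in auto)
qed

text \<open>\<open>mean_step\<close> makes \<open>m\<close> Lipschitz for small time lags, with a
  constant uniform in the time. The fields therefore inherit jumps from the configuration
  only.\<close>

lemma m_continuous:
  assumes x: "x < N"
  shows "continuous_on {0..} (\<lambda>t. m t x)"
proof -
  define c where "c y = (if y = x then 1 / 2 else 0 :: real)" for y
  have c: "\<bar>c y\<bar> \<le> 1 / 2" for y by (simp add: c_def)
  have pc: "pairing N c z = z x / 2" for z
    using x by (simp add: pairing_def c_def if_distrib[of "\<lambda>u. u * _"] sum.delta cong: if_cong)
  obtain h0 where h0: "0 < h0" "\<And>h t. 0 < h \<Longrightarrow> h < h0 \<Longrightarrow> 0 \<le> t \<Longrightarrow>
    \<bar>pairing N c (m (t + h)) - pairing N c (m t) - h * (real N)\<^sup>2 * pairing N (lap N c) (m t)\<bar> \<le> 1 * h"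
    using mean_step[of 1] c by (metis zero_less_one)
  \<comment> \<open>The outer 2 undoes the coefficient 1/2 of \<open>c\<close>; inside stand the
    bound on the drift and the one-step error taken with \<open>e = 1\<close>.\<close>
  define C where "C = 2 * ((real N)\<^sup>2 * (real N * 2) + 1)"
  have C: "0 < C" by (simp add: C_def add_nonneg_pos)
  have step: "\<bar>m (t + h) x - m t x\<bar> \<le> C * h" if h: "0 < h" "h < h0" and t: "0 \<le> t" for h t
  proof -
    have "\<bar>lap N c y\<bar> \<le> 2" for y
      by (simp add: lap_def c_def)
    then have "\<bar>pairing N (lap N c) (m t)\<bar> \<le> real N * 2"
      using m_bound[OF t] by (intro pairing_bound) auto
    then have "h * (real N)\<^sup>2 * \<bar>pairing N (lap N c) (m t)\<bar> \<le> h * (real N)\<^sup>2 * (real N * 2)"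
      using h by (intro mult_left_mono) auto
    then have "\<bar>h * (real N)\<^sup>2 * pairing N (lap N c) (m t)\<bar> \<le> h * (real N)\<^sup>2 * (real N * 2)"
      using h by (simp add: abs_mult)
    with h0(2)[OF that] have "\<bar>pairing N c (m (t + h)) - pairing N c (m t)\<bar> \<le> h * (real N)\<^sup>2 * (real N * 2) + h"
      by linarith
    then show ?thesis by (simp add: pc C_def algebra_simps)
  qed
  show ?thesis
    unfolding continuous_on_iff
  proof (intro ballI allI impI)
    fix t e :: real assume t: "t \<in> {0..}" and e: "0 < e"
    show "\<exists>d>0. \<forall>s\<in>{0..}. dist s t < d \<longrightarrow> dist (m s x) (m t x) < e"
    proof (intro exI[of _ "min h0 (e / C)"] conjI ballI impI)
      fix s assume s: "s \<in> {0..}" "dist s t < min h0 (e / C)"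
      then have d: "\<bar>s - t\<bar> < h0" "C * \<bar>s - t\<bar> < e"
        using C by (auto simp: dist_real_def field_simps)
      consider "s < t" | "s = t" | "t < s" by linarith
      then have "\<bar>m s x - m t x\<bar> \<le> C * \<bar>s - t\<bar>"
      proof cases
        case 1 then show ?thesis using step[of "t - s" s] d s by (auto simp: abs_minus_commute)
      next
        case 3 then show ?thesis using step[of "s - t" t] d t by auto
      qed auto
      with d show "dist (m s x) (m t x) < e" by (simp add: dist_real_def)
    qed (use h0 e C in auto)
  qed
qed

text \<open>By independence the moment factorizes. In each factor the linear term has mean 0 and the
  quadratic one is at most \<open>(c x)\<^sup>2\<close>, since an occupation variable is within 1 of
  its mean.\<close>

lemma initial_moment:
  assumes c: "\<And>x. x < N \<Longrightarrow> \<bar>c x\<bar> \<le> 1 / 2"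
  shows "expectation (\<lambda>\<omega>. exp (Z 0 c \<omega>)) \<le> exp (\<Sum>x<N. (c x)\<^sup>2)"
proof -
  define Y where "Y x \<omega> = exp (c x * (real (X 0 \<omega> x) - m 0 x))" for x \<omega>
  have "indep_vars (\<lambda>_. borel) (\<lambda>x \<omega>. (\<lambda>k. exp (c x * (real k - m 0 x))) (X 0 \<omega> x)) {..<N}"
    by (rule indep_vars_compose2[OF initial_indep]) auto
  then have ind: "indep_vars (\<lambda>_. borel) Y {..<N}"
    by (simp add: Y_def[abs_def])
  have int: "integrable M (Y x)" for x
    using integrable_X[of 0 "\<lambda>\<xi>. exp (c x * (real (\<xi> x) - m 0 x))"] by (simp add: Y_def[abs_def])
  have le: "expectation (Y x) \<le> exp ((c x)\<^sup>2)" if x: "x < N" for x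
  proof -
    define D where "D \<omega> = c x * (real (X 0 \<omega> x) - m 0 x)" for \<omega>
    have Dint: "integrable M D" "integrable M (\<lambda>\<omega>. 1 + D \<omega> + (c x)\<^sup>2)"
      using integrable_X[of 0 "\<lambda>\<xi>. c x * (real (\<xi> x) - m 0 x)"]
        integrable_X[of 0 "\<lambda>\<xi>. 1 + c x * (real (\<xi> x) - m 0 x) + (c x)\<^sup>2"] by (simp_all add: D_def[abs_def])
    have "0 \<le> m 0 x" unfolding m_def by (intro Bochner_Integration.integral_nonneg) auto
    then have m01: "0 \<le> m 0 x" "m 0 x \<le> 1" using m_bound[of 0 x] x by auto
    have pt: "Y x \<omega> \<le> 1 + D \<omega> + (c x)\<^sup>2" if "\<omega> \<in> space M" for \<omega>
    proof -
      have "\<bar>real (X 0 \<omega> x) - m 0 x\<bar> \<le> 1"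
        using configuration_values[OF X_in[of 0 \<omega>] x] that m01 by auto
      then have "\<bar>D \<omega>\<bar> \<le> \<bar>c x\<bar> * 1"
        unfolding D_def abs_mult by (intro mult_left_mono) auto
      then have "\<bar>D \<omega>\<bar> \<le> \<bar>c x\<bar>" "\<bar>D \<omega>\<bar> \<le> 1"
        using c[OF x] by linarith+
      then have "(D \<omega>)\<^sup>2 \<le> (c x)\<^sup>2" "\<bar>D \<omega>\<bar> \<le> 1"
        by (simp_all add: abs_le_square_iff)
      then show ?thesis
        using exp_le_quadratic[of "D \<omega>"] by (simp add: Y_def D_def)
    qed
    have "expectation (Y x) \<le> expectation (\<lambda>\<omega>. 1 + D \<omega> + (c x)\<^sup>2)"
      using pt by (intro integral_mono int Dint)
    also have "\<dots> = 1 + expectation D + (c x)\<^sup>2"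
      using Dint by (simp add: prob_space)
    also have "expectation D = 0"
      using integrable_X[of 0 "\<lambda>\<xi>. real (\<xi> x)"] unfolding D_def
      by (simp add: prob_space m_def)
    finally show ?thesis
      using exp_ge_add_one_self[of "(c x)\<^sup>2"] by linarith
  qed
  have "expectation (\<lambda>\<omega>. exp (Z 0 c \<omega>)) = expectation (\<lambda>\<omega>. \<Prod>x<N. Y x \<omega>)"
    by (simp add: Z_def pairing_def exp_sum Y_def)
  also have "\<dots> = (\<Prod>x<N. expectation (Y x))"
    using ind int by (intro indep_vars_lebesgue_integral) auto
  also have "\<dots> \<le> (\<Prod>x<N. exp ((c x)\<^sup>2))"
    using le by (intro prod_mono) (auto simp: Y_def)
  finally show ?thesis by (simp add: exp_sum)
qed

text \<open>The discrete heat flow transports the test function back to time 0, and the energy dissipated by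
  the flow pays for the quadratic error terms.\<close>

lemma exp_moment:
  assumes t: "0 \<le> t" and c: "\<And>x. x < N \<Longrightarrow> \<bar>c x\<bar> \<le> 1 / 2"
  shows "expectation (\<lambda>\<omega>. exp (Z t c \<omega>)) \<le> exp (\<Sum>x<N. (c x)\<^sup>2)"
proof (cases "t = 0")
  case False
  with t have tpos: "0 < t" by simp
  show ?thesis
  proof (rule le_exp_epsilon)
    fix e :: real assume e: "0 < e"
    \<comment> \<open>The errors \<open>e' * h\<close> of all steps add up to
      \<open>e' * t = e\<close>.\<close>
    define e' where "e' = e / t"
    have e': "0 < e'" using e tpos by (simp add: e'_def)
    obtain h0 where h0: "0 < h0" "\<forall>h. 0 < h \<and> h < h0 \<longrightarrow> (\<forall>c. (\<forall>x<N. \<bar>c x\<bar> \<le> 1 / 2) \<longrightarrow> (\<forall>t\<ge>0. \<forall>\<xi>\<in>E.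
      (\<Sum>z\<in>E. p h \<xi> z * exp (pairing N c (\<lambda>x. conf z x - m (t + h) x))) \<le>
      exp (pairing N (estep h c) (\<lambda>x. conf \<xi> x - m t x) + h * (real N)\<^sup>2 * energy N c + e' * h)))"
      using centred_step[OF e'] by blast
    \<comment> \<open>Small enough for the one-step bound and for the stability condition
      \<open>4 * (h * N\<^sup>2) \<le> 1\<close> of the Euler scheme.\<close>
    define \<kappa> where "\<kappa> = min h0 (1 / (4 * (real N)\<^sup>2))"
    have "0 < \<kappa>" using h0 N_pos by (simp add: \<kappa>_def)
    then obtain n :: nat where n: "t / \<kappa> < real n" using reals_Archimedean2 by blast
    define h where "h = t / real n"
    have "0 < t / \<kappa>" using tpos \<open>0 < \<kappa>\<close> by simp
    then have npos: "0 < n" using n by (metis of_nat_0_less_iff order.strict_trans)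
    then have h: "0 < h" "h < \<kappa>" using tpos n \<open>0 < \<kappa>\<close> by (simp_all add: h_def field_simps)
    have k: "0 \<le> h * (real N)\<^sup>2" "4 * (h * (real N)\<^sup>2) \<le> 1"
      using h N_pos by (auto simp: \<kappa>_def field_simps)
    have "expectation (\<lambda>\<omega>. exp (Z (real j * h) c \<omega>)) \<le> exp ((\<Sum>x<N. (c x)\<^sup>2) + e' * (real j * h))"
      if "\<And>x. x < N \<Longrightarrow> \<bar>c x\<bar> \<le> 1 / 2" for j c
      using that
    \<comment> \<open>Peeling off the last time step replaces \<open>c\<close> by
      \<open>estep h c\<close>, hence the induction over all admissible \<open>c\<close>;
      \<open>euler_step_bound\<close> keeps the new function admissible.\<close>
    proof (induction j arbitrary: c)
      case 0
      then show ?case using initial_moment by simp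
    next
      case (Suc j)
      define s where "s = real j * h"
      have s: "0 \<le> s" using h by (simp add: s_def)
      have sh: "real (Suc j) * h = s + h" by (simp add: s_def algebra_simps)
      have cs: "\<bar>estep h c x\<bar> \<le> 1 / 2" if "x < N" for x
        unfolding estep_def using k Suc.prems that by (intro euler_step_bound) auto
      have "expectation (\<lambda>\<omega>. exp (Z (s + h) c \<omega>)) =
          expectation (\<lambda>\<omega>. \<Sum>z\<in>E. p h (X s \<omega>) z * exp (pairing N c (\<lambda>x. conf z x - m (s + h) x)))"
        unfolding Z_def using s h by (intro expectation_step) auto
      also have "\<dots> \<le> expectation (\<lambda>\<omega>. exp (Z s (estep h c) \<omega>) * exp (h * (real N)\<^sup>2 * energy N c + e' * h))"
      proof (intro integral_mono)
        show "integrable M (\<lambda>\<omega>. \<Sum>z\<in>E. p h (X s \<omega>) z * exp (pairing N c (\<lambda>x. conf z x - m (s + h) x)))"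
          by (rule integrable_X[OF s])
        show "integrable M (\<lambda>\<omega>. exp (Z s (estep h c) \<omega>) * exp (h * (real N)\<^sup>2 * energy N c + e' * h))"
          unfolding Z_def by (rule integrable_X[OF s])
        fix \<omega> assume "\<omega> \<in> space M"
        then show "(\<Sum>z\<in>E. p h (X s \<omega>) z * exp (pairing N c (\<lambda>x. conf z x - m (s + h) x))) \<le>
          exp (Z s (estep h c) \<omega>) * exp (h * (real N)\<^sup>2 * energy N c + e' * h)"
          using h0(2)[rule_format, of h c s "X s \<omega>"] Suc.prems s h X_in[OF s]
          by (simp add: Z_def mult_exp_exp \<kappa>_def add.assoc)
      qed
      also have "\<dots> = expectation (\<lambda>\<omega>. exp (Z s (estep h c) \<omega>)) * exp (h * (real N)\<^sup>2 * energy N c + e' * h)"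
        by simp
      also have "\<dots> \<le> exp ((\<Sum>x<N. (estep h c x)\<^sup>2) + e' * s) * exp (h * (real N)\<^sup>2 * energy N c + e' * h)"
        using Suc.IH[OF cs] by (intro mult_right_mono) (auto simp: s_def)
      also have "\<dots> \<le> exp ((\<Sum>x<N. (c x)\<^sup>2) + e' * (s + h))"
        using euler_step_energy[OF k, where N = N and c = c] unfolding mult_exp_exp estep_def
        by (simp add: algebra_simps)
      finally show ?case unfolding sh .
    qed
    from this[of c n, OF c] show "expectation (\<lambda>\<omega>. exp (Z t c \<omega>)) \<le> exp ((\<Sum>x<N. (c x)\<^sup>2) + e)"
      using npos tpos by (simp add: h_def e'_def)
  qed
qed (use initial_moment c in simp)

end

section \<open>Tails and increments of the centred pairing\<close>

lemma lap_cmult: "lap N (\<lambda>x. k * c x) x = k * lap N c x"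
  by (simp add: lap_def algebra_simps)

lemma energy_cmult: "energy N (\<lambda>x. k * c x) = k\<^sup>2 * energy N c"
  by (simp add: energy_def grad_def sum_distrib_left power_mult_distrib flip: right_diff_distrib)

context exclusion_process
begin

lemma Z_cmult: "Z t (\<lambda>x. k * c x) \<omega> = k * Z t c \<omega>"
  by (simp add: Z_def pairing_cmult)

lemma Z_measurable: "0 \<le> t \<Longrightarrow> Z t c \<in> borel_measurable M"
  using X_function_measurable[of t "\<lambda>\<xi>. pairing N c (\<lambda>x. conf \<xi> x - m t x)"]
  by (simp add: Z_def[abs_def])

lemma integrable_exp_Z: "0 \<le> t \<Longrightarrow> integrable M (\<lambda>\<omega>. exp (Z t c \<omega>))"
  unfolding Z_def by (rule integrable_X)

lemma exp_moment_abs: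
  assumes t: "0 \<le> t" and c: "\<And>x. x < N \<Longrightarrow> \<bar>c x\<bar> \<le> 1 / 2"
  shows "integrable M (\<lambda>\<omega>. exp \<bar>Z t c \<omega>\<bar>)"
    and "expectation (\<lambda>\<omega>. exp \<bar>Z t c \<omega>\<bar>) \<le> 2 * exp (\<Sum>x<N. (c x)\<^sup>2)"
proof -
  show int: "integrable M (\<lambda>\<omega>. exp \<bar>Z t c \<omega>\<bar>)"
    unfolding Z_def using integrable_X[OF t, of "\<lambda>\<xi>. exp \<bar>pairing N c (\<lambda>x. conf \<xi> x - m t x)\<bar>"] .
  have "expectation (\<lambda>\<omega>. exp \<bar>Z t c \<omega>\<bar>) \<le>
      expectation (\<lambda>\<omega>. exp (Z t c \<omega>) + exp (Z t (\<lambda>x. - 1 * c x) \<omega>))"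
  proof (intro integral_mono int Bochner_Integration.integrable_add integrable_exp_Z t)
    show "exp \<bar>Z t c \<omega>\<bar> \<le> exp (Z t c \<omega>) + exp (Z t (\<lambda>x. - 1 * c x) \<omega>)" for \<omega>
      unfolding Z_cmult by (cases "0 \<le> Z t c \<omega>") auto
  qed
  also have "\<dots> = expectation (\<lambda>\<omega>. exp (Z t c \<omega>)) + expectation (\<lambda>\<omega>. exp (Z t (\<lambda>x. - 1 * c x) \<omega>))"
    by (intro Bochner_Integration.integral_add integrable_exp_Z t)
  also have "\<dots> \<le> exp (\<Sum>x<N. (c x)\<^sup>2) + exp (\<Sum>x<N. (- 1 * c x)\<^sup>2)"
    using t c by (intro add_mono exp_moment) auto
  finally show "expectation (\<lambda>\<omega>. exp \<bar>Z t c \<omega>\<bar>) \<le> 2 * exp (\<Sum>x<N. (c x)\<^sup>2)"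
    by simp
qed

lemma tail_bound:
  assumes t: "0 \<le> t" and c: "\<And>x. x < N \<Longrightarrow> \<bar>c x\<bar> \<le> 1 / 2"
  shows "{\<omega>\<in>space M. r \<le> \<bar>Z t c \<omega>\<bar>} \<in> sets M"
    and "prob {\<omega>\<in>space M. r \<le> \<bar>Z t c \<omega>\<bar>} \<le> 2 * exp (- r) * exp (\<Sum>x<N. (c x)\<^sup>2)"
proof -
  note Z_measurable[OF t, measurable]
  show "{\<omega>\<in>space M. r \<le> \<bar>Z t c \<omega>\<bar>} \<in> sets M" by measurable
  have "prob {\<omega>\<in>space M. exp r \<le> exp \<bar>Z t c \<omega>\<bar>} \<le> expectation (\<lambda>\<omega>. exp \<bar>Z t c \<omega>\<bar>) / exp r"
    using exp_moment_abs(1)[OF t c] by (intro integral_Markov_inequality_measure[where A = "{}"]) auto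
  also have "\<dots> \<le> (2 * exp (\<Sum>x<N. (c x)\<^sup>2)) / exp r"
    using exp_moment_abs(2)[OF t c] by (intro divide_right_mono) auto
  finally show "prob {\<omega>\<in>space M. r \<le> \<bar>Z t c \<omega>\<bar>} \<le> 2 * exp (- r) * exp (\<Sum>x<N. (c x)\<^sup>2)"
    by (simp add: exp_minus field_simps)
qed

text \<open>The sum is a Riemann sum of the drift when \<open>d\<close> carries the time step.
  Jensen's inequality then involves \<open>real n * d\<close>, which stays bounded as the mesh is
  refined.\<close>

lemma drift_bound:
  assumes s: "0 \<le> s" and h: "0 < h" and n: "0 < n"
    and d: "\<And>x. x < N \<Longrightarrow> \<bar>real n * d x\<bar> \<le> 1 / 2"
  shows "{\<omega>\<in>space M. r \<le> (\<Sum>j<n. \<bar>Z (s + real j * h) d \<omega>\<bar>)} \<in> sets M"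
    and "prob {\<omega>\<in>space M. r \<le> (\<Sum>j<n. \<bar>Z (s + real j * h) d \<omega>\<bar>)} \<le>
      2 * exp (- r) * exp (\<Sum>x<N. (real n * d x)\<^sup>2)"
proof -
  have sj: "0 \<le> s + real j * h" for j using s h by simp
  note Z_measurable[OF sj, measurable]
  let ?S = "\<lambda>\<omega>. \<Sum>j<n. \<bar>Z (s + real j * h) d \<omega>\<bar>"
  let ?U = "\<lambda>\<omega>. (\<Sum>j<n. exp \<bar>Z (s + real j * h) (\<lambda>x. real n * d x) \<omega>\<bar>) / real n"
  show "{\<omega>\<in>space M. r \<le> ?S \<omega>} \<in> sets M" by measurable
  have le: "exp (?S \<omega>) \<le> ?U \<omega>" for \<omega>
    using exp_sum_le_mean[OF n, of "\<lambda>j. \<bar>Z (s + real j * h) d \<omega>\<bar>"] by (simp add: Z_cmult abs_mult)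
  have Uint: "integrable M ?U"
    using exp_moment_abs(1)[OF sj, where c = "\<lambda>x. real n * d x", OF d] by auto
  have "{\<omega>\<in>space M. r \<le> ?S \<omega>} \<subseteq> {\<omega>\<in>space M. exp r \<le> ?U \<omega>}"
    using le by (auto intro: order_trans[rotated])
  moreover have "{\<omega>\<in>space M. exp r \<le> ?U \<omega>} \<in> sets M" by measurable
  ultimately have "prob {\<omega>\<in>space M. r \<le> ?S \<omega>} \<le> prob {\<omega>\<in>space M. exp r \<le> ?U \<omega>}"
    by (rule finite_measure_mono)
  also have "\<dots> \<le> expectation ?U / exp r"
    using Uint by (intro integral_Markov_inequality_measure[where A = "{}"]) (auto intro!: divide_nonneg_nonneg sum_nonneg)
  also have "expectation ?U = (\<Sum>j<n. expectation (\<lambda>\<omega>. exp \<bar>Z (s + real j * h) (\<lambda>x. real n * d x) \<omega>\<bar>)) / real n"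
    using exp_moment_abs(1)[OF sj, where c = "\<lambda>x. real n * d x", OF d] by simp
  also have "\<dots> \<le> (\<Sum>j<n. 2 * exp (\<Sum>x<N. (real n * d x)\<^sup>2)) / real n"
    using exp_moment_abs(2)[OF sj, where c = "\<lambda>x. real n * d x", OF d]
    by (intro divide_right_mono sum_mono) auto
  also have "\<dots> = 2 * exp (\<Sum>x<N. (real n * d x)\<^sup>2)"
    using n by simp
  finally show "prob {\<omega>\<in>space M. r \<le> ?S \<omega>} \<le> 2 * exp (- r) * exp (\<Sum>x<N. (real n * d x)\<^sup>2)"
    by (simp add: divide_right_mono exp_minus field_simps)
qed

text \<open>The increment is a supermartingale part, plus the drift, plus a deterministic
  compensator. A threshold \<open>r\<close> goes to the drift and a threshold \<open>r\<close> to
  the rest, whence \<open>2 * r\<close>. The bound is the same for every sufficiently fine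
  mesh.\<close>

lemma grid_increment_bound:
  assumes s: "0 \<le> s" and \<delta>: "0 < \<delta>" and e: "0 < e"
    and c: "\<And>x. x < N \<Longrightarrow> \<bar>c x\<bar> \<le> 1 / 2"
    and d: "\<And>x. x < N \<Longrightarrow> \<bar>\<delta> * (real N)\<^sup>2 * lap N c x\<bar> \<le> 1 / 2"
  shows "\<exists>n0. \<forall>n\<ge>n0. 0 < n \<longrightarrow>
    prob {\<omega>\<in>space M. \<exists>i\<le>n. 2 * r \<le> Z (s + real i * (\<delta> / real n)) c \<omega> - Z s c \<omega>} \<le>
    exp (- r) * (exp (\<delta> * (real N)\<^sup>2 * energy N c + e) + 2 * exp (\<Sum>x<N. (\<delta> * (real N)\<^sup>2 * lap N c x)\<^sup>2))"
proof -
  define e' where "e' = e / \<delta>"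
  have e': "0 < e'" using e \<delta> by (simp add: e'_def)
  obtain h0 where h0: "0 < h0" "\<forall>h. 0 < h \<and> h < h0 \<longrightarrow> (\<forall>c. (\<forall>x<N. \<bar>c x\<bar> \<le> 1 / 2) \<longrightarrow> (\<forall>t\<ge>0. \<forall>\<xi>\<in>E.
      (\<Sum>z\<in>E. p h \<xi> z * exp (pairing N c (\<lambda>x. conf z x - m (t + h) x))) \<le>
      exp (pairing N (estep h c) (\<lambda>x. conf \<xi> x - m t x) + h * (real N)\<^sup>2 * energy N c + e' * h)))"
    using centred_step[OF e'] by blast
  obtain n0 :: nat where n0: "\<delta> / h0 < real n0" using reals_Archimedean2 by blast
  show ?thesis
  proof (intro exI[of _ n0] allI impI)
    fix n assume n: "n0 \<le> n" "0 < n"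
    define h where "h = \<delta> / real n"
    have nh: "real n * h = \<delta>" using n by (simp add: h_def)
    have "\<delta> / h0 < real n" using n0 n by linarith
    then have h: "0 < h" "h < h0" using h0 \<delta> n by (simp_all add: h_def field_simps)
    define t where "t i = s + real i * h" for i
    have t0: "0 \<le> t i" for i using s h by (simp add: t_def)
    have tS: "t (Suc i) = t i + h" for i by (simp add: t_def algebra_simps)
    define dd where "dd x = h * (real N)\<^sup>2 * lap N c x" for x
    have ndd: "real n * dd x = \<delta> * (real N)\<^sup>2 * lap N c x" for x
      unfolding dd_def nh[symmetric] by simp
    define q where "q = h * (real N)\<^sup>2 * energy N c + e' * h"
    have q: "0 \<le> q" using h e' energy_nonneg by (simp add: q_def)
    have nq: "real n * q = \<delta> * (real N)\<^sup>2 * energy N c + e"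
    proof -
      have "real n * q = (real n * h) * (real N)\<^sup>2 * energy N c + e' * (real n * h)"
        by (simp add: q_def algebra_simps)
      then show ?thesis using \<delta> by (simp add: nh e'_def)
    qed
    \<comment> \<open>Logarithm of the one-step exponential divided by its bound from
      \<open>centred_step\<close>. Summed over the grid it telescopes, leaving the drift
      \<open>dd\<close> and one \<open>q\<close> per step, as \<open>W_eq\<close> records.\<close>
    define w where "w i \<xi> z = pairing N c (\<lambda>x. conf z x - m (t (Suc i)) x)
        - pairing N (estep h c) (\<lambda>x. conf \<xi> x - m (t i) x) - q" for i \<xi> z
    define W where "W i \<omega> = (\<Sum>j<i. w j (X (t j) \<omega>) (X (t (Suc j)) \<omega>))" for i \<omega>
    have W_eq: "W i \<omega> = Z (t i) c \<omega> - Z (t 0) c \<omega> - (\<Sum>j<i. Z (t j) dd \<omega>) - real i * q" for i \<omega>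
    proof (induction i)
      case (Suc i)
      have "w i (X (t i) \<omega>) (X (t (Suc i)) \<omega>) = Z (t (Suc i)) c \<omega> - Z (t i) c \<omega> - Z (t i) dd \<omega> - q"
        unfolding w_def Z_def pairing_estep dd_def pairing_cmult by simp
      with Suc show ?case by (simp add: W_def algebra_simps)
    qed (simp add: W_def)
    have wle: "(\<Sum>z\<in>E. p (t (Suc i) - t i) \<xi> z * exp (w i \<xi> z)) \<le> 1" if "\<xi> \<in> E" for i \<xi>
    proof -
      let ?a = "pairing N (estep h c) (\<lambda>x. conf \<xi> x - m (t i) x) + q"
      have ew: "exp (w i \<xi> z) = exp (- ?a) * exp (pairing N c (\<lambda>x. conf z x - m (t i + h) x))" for z
        unfolding mult_exp_exp w_def tS by (rule arg_cong[where f = exp]) linarith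
      have "(\<Sum>z\<in>E. p (t (Suc i) - t i) \<xi> z * exp (w i \<xi> z)) =
          exp (- ?a) * (\<Sum>z\<in>E. p h \<xi> z * exp (pairing N c (\<lambda>x. conf z x - m (t i + h) x)))"
        unfolding ew sum_distrib_left by (intro sum.cong) (auto simp: tS mult_ac)
      also have "\<dots> \<le> exp (- ?a) * exp ?a"
        using h0(2)[rule_format, of h c "t i" \<xi>] h c t0 that
        by (intro mult_left_mono) (auto simp: q_def add.assoc)
      finally show ?thesis by (simp only: mult_exp_exp) simp
    qed
    \<comment> \<open>The level is lowered by the whole compensator \<open>n * q\<close>, which
      reappears as an exponential factor in the final bound.\<close>
    let ?A = "{\<omega>\<in>space M. \<exists>i\<le>n. r - \<delta> * (real N)\<^sup>2 * energy N c - e \<le> W i \<omega>}"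
    let ?B = "{\<omega>\<in>space M. r \<le> (\<Sum>j<n. \<bar>Z (s + real j * h) dd \<omega>\<bar>)}"
    have A: "?A \<in> sets M" "prob ?A \<le> exp (- (r - \<delta> * (real N)\<^sup>2 * energy N c - e))"
      unfolding W_def using t0 h wle by (intro maximal_inequality; simp add: tS)+
    have B: "?B \<in> sets M" "prob ?B \<le> 2 * exp (- r) * exp (\<Sum>x<N. (real n * dd x)\<^sup>2)"
      using s h n d by (intro drift_bound; simp add: ndd)+
    have "{\<omega>\<in>space M. \<exists>i\<le>n. 2 * r \<le> Z (s + real i * h) c \<omega> - Z s c \<omega>} \<subseteq> ?A \<union> ?B"
    proof (rule subsetI, rule ccontr)
      fix \<omega> assume *: "\<omega> \<in> {\<omega>\<in>space M. \<exists>i\<le>n. 2 * r \<le> Z (s + real i * h) c \<omega> - Z s c \<omega>}"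
        and nA: "\<omega> \<notin> ?A \<union> ?B"
      then obtain i where i: "i \<le> n" "2 * r \<le> Z (t i) c \<omega> - Z (t 0) c \<omega>"
        by (auto simp: t_def)
      have "(\<Sum>j<i. Z (t j) dd \<omega>) \<le> (\<Sum>j<i. \<bar>Z (t j) dd \<omega>\<bar>)"
        by (intro sum_mono) auto
      also have "\<dots> \<le> (\<Sum>j<n. \<bar>Z (t j) dd \<omega>\<bar>)"
        using i by (intro sum_mono2) auto
      also have "\<dots> < r" using nA * by (auto simp: t_def)
      finally have 1: "(\<Sum>j<i. Z (t j) dd \<omega>) < r" .
      have 2: "real i * q \<le> real n * q" using i q by (intro mult_right_mono) auto
      have "W i \<omega> < r - \<delta> * (real N)\<^sup>2 * energy N c - e"
        using nA * i(1) by force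
      with W_eq[of i \<omega>] i(2) 1 2 nq show False by linarith
    qed
    then have "prob {\<omega>\<in>space M. \<exists>i\<le>n. 2 * r \<le> Z (s + real i * h) c \<omega> - Z s c \<omega>} \<le> prob (?A \<union> ?B)"
      by (rule finite_measure_mono) (rule sets.Un[OF A(1) B(1)])
    also have "\<dots> \<le> prob ?A + prob ?B"
      by (rule measure_Un_le[OF A(1) B(1)])
    also have "\<dots> \<le> exp (- (r - \<delta> * (real N)\<^sup>2 * energy N c - e)) +
        2 * exp (- r) * exp (\<Sum>x<N. (\<delta> * (real N)\<^sup>2 * lap N c x)\<^sup>2)"
      using A(2) B(2) unfolding ndd by (rule add_mono)
    also have "exp (- (r - \<delta> * (real N)\<^sup>2 * energy N c - e)) =
        exp (- r) * exp (\<delta> * (real N)\<^sup>2 * energy N c + e)"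
      unfolding mult_exp_exp by (rule arg_cong[where f = exp]) linarith
    finally show "prob {\<omega>\<in>space M. \<exists>i\<le>n. 2 * r \<le> Z (s + real i * (\<delta> / real n)) c \<omega> - Z s c \<omega>} \<le>
      exp (- r) * (exp (\<delta> * (real N)\<^sup>2 * energy N c + e) + 2 * exp (\<Sum>x<N. (\<delta> * (real N)\<^sup>2 * lap N c x)\<^sup>2))"
      by (simp add: h_def distrib_left mult_ac)
  qed
qed

text \<open>Dyadic grids are nested, so these events increase with \<open>n\<close>. Their countable
  union is measurable and stands for a supremum over the whole window.\<close>

definition excursion :: "real \<Rightarrow> real \<Rightarrow> (nat \<Rightarrow> real) \<Rightarrow> real \<Rightarrow> 'w set" where
  "excursion s \<delta> c r = (\<Union>n. {\<omega>\<in>space M. \<exists>i\<le>(2::nat) ^ n. r \<le> \<bar>Z (s + real i * (\<delta> / 2 ^ n)) c \<omega> - Z s c \<omega>\<bar>})"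

lemma excursion_sets:
  assumes "0 \<le> s" "0 \<le> \<delta>"
  shows "{\<omega>\<in>space M. \<exists>i\<le>(2::nat) ^ n. r \<le> \<bar>Z (s + real i * (\<delta> / 2 ^ n)) c \<omega> - Z s c \<omega>\<bar>} \<in> sets M"
    and "excursion s \<delta> c r \<in> sets M"
proof -
  have pos: "0 \<le> s + real i * (\<delta> / 2 ^ n)" for i n using assms by simp
  note Z_measurable[OF pos, measurable] Z_measurable[OF assms(1), measurable]
  have *: "{\<omega>\<in>space M. \<exists>i\<le>(2::nat) ^ n. r \<le> \<bar>Z (s + real i * (\<delta> / 2 ^ n)) c \<omega> - Z s c \<omega>\<bar>} \<in> sets M" for n
  proof -
    have "{\<omega>\<in>space M. \<exists>i\<le>(2::nat) ^ n. r \<le> \<bar>Z (s + real i * (\<delta> / 2 ^ n)) c \<omega> - Z s c \<omega>\<bar>} =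
        (\<Union>i\<in>{..2 ^ n}. {\<omega>\<in>space M. r \<le> \<bar>Z (s + real i * (\<delta> / 2 ^ n)) c \<omega> - Z s c \<omega>\<bar>})"
      by auto
    also have "\<dots> \<in> sets M"
      by (rule sets.finite_UN, simp, measurable)
    finally show ?thesis .
  qed
  from *[of n] show "{\<omega>\<in>space M. \<exists>i\<le>(2::nat) ^ n. r \<le> \<bar>Z (s + real i * (\<delta> / 2 ^ n)) c \<omega> - Z s c \<omega>\<bar>} \<in> sets M" .
  show "excursion s \<delta> c r \<in> sets M"
    unfolding excursion_def by (intro sets.countable_UN) (use * in blast)
qed

text \<open>The grid bound is independent of the mesh and so survives the increasing limit. Applying
  it to \<open>c\<close> and to its negative gives the absolute value and the factor 2; finally
  \<open>e\<close> tends to 0.\<close>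

lemma excursion_bound:
  assumes s: "0 \<le> s" and \<delta>: "0 < \<delta>"
    and c: "\<And>x. x < N \<Longrightarrow> \<bar>c x\<bar> \<le> 1 / 2"
    and d: "\<And>x. x < N \<Longrightarrow> \<bar>\<delta> * (real N)\<^sup>2 * lap N c x\<bar> \<le> 1 / 2"
  shows "prob (excursion s \<delta> c (2 * r)) \<le>
    2 * exp (- r) * (exp (\<delta> * (real N)\<^sup>2 * energy N c) + 2 * exp (\<Sum>x<N. (\<delta> * (real N)\<^sup>2 * lap N c x)\<^sup>2))"
proof -
  let ?b = "exp (\<Sum>x<N. (\<delta> * (real N)\<^sup>2 * lap N c x)\<^sup>2)"
  let ?a = "\<delta> * (real N)\<^sup>2 * energy N c"
  define A where "A n = {\<omega>\<in>space M. \<exists>i\<le>(2::nat) ^ n. 2 * r \<le> \<bar>Z (s + real i * (\<delta> / 2 ^ n)) c \<omega> - Z s c \<omega>\<bar>}" for n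
  have A: "A n \<in> sets M" for n
    unfolding A_def using excursion_sets(1)[OF s less_imp_le[OF \<delta>]] .
  have "incseq A"
  proof (intro incseq_SucI subsetI)
    fix n \<omega> assume "\<omega> \<in> A n"
    then obtain i where i: "\<omega> \<in> space M" "i \<le> 2 ^ n" "2 * r \<le> \<bar>Z (s + real i * (\<delta> / 2 ^ n)) c \<omega> - Z s c \<omega>\<bar>"
      by (auto simp: A_def)
    have "real (2 * i) * (\<delta> / 2 ^ Suc n) = real i * (\<delta> / 2 ^ n)" by (simp add: field_simps)
    with i show "\<omega> \<in> A (Suc n)"
      unfolding A_def by (auto intro!: exI[of _ "2 * i"] simp del: of_nat_mult)
  qed
  then have lim: "(\<lambda>n. prob (A n)) \<longlonglongrightarrow> prob (\<Union>n. A n)"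
    using A by (intro finite_Lim_measure_incseq) auto
  have bound: "prob (\<Union>n. A n) \<le> 2 * exp (- r) * (exp (?a + e) + 2 * ?b)" if e: "0 < e" for e
  proof -
    define cm where "cm = (\<lambda>x. - 1 * c x)"
    have cm: "\<And>x. x < N \<Longrightarrow> \<bar>cm x\<bar> \<le> 1 / 2" "\<And>x. lap N cm x = - lap N c x" "energy N cm = energy N c"
      "\<And>t \<omega>. Z t cm \<omega> = - Z t c \<omega>"
      using c unfolding cm_def lap_cmult energy_cmult Z_cmult by auto
    obtain n1 where n1: "\<And>n. n1 \<le> n \<Longrightarrow> 0 < n \<Longrightarrow>
      prob {\<omega>\<in>space M. \<exists>i\<le>n. 2 * r \<le> Z (s + real i * (\<delta> / real n)) c \<omega> - Z s c \<omega>} \<le>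
      exp (- r) * (exp (?a + e) + 2 * ?b)"
      using grid_increment_bound[OF s \<delta> e c d] by blast
    have dm: "\<And>x. x < N \<Longrightarrow> \<bar>\<delta> * (real N)\<^sup>2 * lap N cm x\<bar> \<le> 1 / 2"
      using d by (simp add: cm)
    obtain n2 where n2: "\<And>n. n2 \<le> n \<Longrightarrow> 0 < n \<Longrightarrow>
      prob {\<omega>\<in>space M. \<exists>i\<le>n. 2 * r \<le> Z (s + real i * (\<delta> / real n)) cm \<omega> - Z s cm \<omega>} \<le>
      exp (- r) * (exp (?a + e) + 2 * ?b)"
      using grid_increment_bound[OF s \<delta> e cm(1) dm] by (auto simp: cm(2,3))
    have "prob (A n) \<le> 2 * exp (- r) * (exp (?a + e) + 2 * ?b)" if n: "n1 + n2 \<le> n" for n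
    proof -
      let ?n = "2 ^ n :: nat"
      have nn: "n1 \<le> ?n" "n2 \<le> ?n" using n less_exp[of n] by linarith+
      define A1 where "A1 c = {\<omega>\<in>space M. \<exists>i\<le>?n. 2 * r \<le> Z (s + real i * (\<delta> / real ?n)) c \<omega> - Z s c \<omega>}" for c
      have pos: "0 \<le> s + real i * (\<delta> / real ?n)" for i using s \<delta> by simp
      note Z_measurable[OF pos, measurable] Z_measurable[OF s, measurable]
      have A1: "A1 c \<in> sets M" for c
      proof -
        have "A1 c = (\<Union>i\<in>{..?n}. {\<omega>\<in>space M. 2 * r \<le> Z (s + real i * (\<delta> / real ?n)) c \<omega> - Z s c \<omega>})"
          by (auto simp: A1_def)
        also have "\<dots> \<in> sets M" by (rule sets.finite_UN, simp, measurable)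
        finally show ?thesis .
      qed
      have "A n \<subseteq> A1 c \<union> A1 cm"
        by (auto simp: A_def A1_def cm abs_if split: if_splits)
      then have "prob (A n) \<le> prob (A1 c \<union> A1 cm)"
        using A1 by (intro finite_measure_mono) auto
      also have "\<dots> \<le> prob (A1 c) + prob (A1 cm)"
        by (rule measure_Un_le[OF A1 A1])
      finally show ?thesis
        using n1[OF nn(1)] n2[OF nn(2)] by (simp add: A1_def)
    qed
    then show ?thesis
      by (intro LIMSEQ_le_const2[OF lim]) auto
  qed
  have "((\<lambda>e. 2 * exp (- r) * (exp (?a + e) + 2 * ?b)) \<longlongrightarrow> 2 * exp (- r) * (exp (?a + 0) + 2 * ?b)) (at_right 0)"
    by (intro tendsto_intros)
  then have "prob (\<Union>n. A n) \<le> 2 * exp (- r) * (exp (?a + 0) + 2 * ?b)"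
    by (rule tendsto_lowerbound) (use bound in \<open>auto simp: eventually_at_right_less intro: eventually_at_rightI[of 0 1]\<close>)
  then show ?thesis by (simp add: excursion_def A_def)
qed

lemma X_right_continuous:
  assumes "\<omega> \<in> space M" "0 \<le> t"
  shows "eventually (\<lambda>u. X u \<omega> = X t \<omega>) (at_right t)"
proof -
  have "limitin (discrete_topology E) (\<lambda>t. X t \<omega>) (X t \<omega>) (at t within {0..} \<inter> {t<..})"
    using cadlag[OF assms(1)] assms(2) unfolding cadlag_on_def by auto
  moreover have "{0..} \<inter> {t<..} = {t<..}" using assms by auto
  ultimately have "eventually (\<lambda>u. X u \<omega> \<in> {X t \<omega>}) (at_right t)"
    unfolding limitin_def using X_in[OF assms(2,1)] by (metis insertI1 openin_discrete_topology empty_subsetI insert_subset)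
  then show ?thesis by simp
qed

lemma Z_right_continuous:
  assumes "\<omega> \<in> space M" "0 \<le> t"
  shows "((\<lambda>u. Z u c \<omega>) \<longlongrightarrow> Z t c \<omega>) (at_right t)"
  unfolding Z_def pairing_def
proof (intro tendsto_sum tendsto_intros)
  fix x assume x: "x \<in> {..<N}"
  show "((\<lambda>u. real (X u \<omega> x)) \<longlongrightarrow> real (X t \<omega> x)) (at_right t)"
    by (rule tendsto_eventually, rule eventually_mono[OF X_right_continuous[OF assms]]) simp
  have "((\<lambda>u. m u x) \<longlongrightarrow> m t x) (at t within {0..})"
    using m_continuous x assms by (auto simp: continuous_on_def)
  then show "((\<lambda>u. m u x) \<longlongrightarrow> m t x) (at_right t)"
    by (rule tendsto_within_subset) (use assms in auto)
qed

text \<open>By right continuity a violation at \<open>t\<close> persists on an interval to the right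
  of \<open>t\<close>, and such an interval contains a dyadic point of the window.\<close>

lemma excursion_complement:
  assumes \<omega>: "\<omega> \<in> space M" "\<omega> \<notin> excursion s \<delta> c r" and s: "0 \<le> s" "0 < \<delta>" and t: "s \<le> t" "t \<le> s + \<delta>"
  shows "\<bar>Z t c \<omega> - Z s c \<omega>\<bar> \<le> r"
proof (rule ccontr)
  assume neg: "\<not> \<bar>Z t c \<omega> - Z s c \<omega>\<bar> \<le> r"
  have no: "\<bar>Z (s + real i * (\<delta> / 2 ^ n)) c \<omega> - Z s c \<omega>\<bar> < r" if "i \<le> 2 ^ n" for i n
  proof (rule ccontr)
    assume "\<not> \<bar>Z (s + real i * (\<delta> / 2 ^ n)) c \<omega> - Z s c \<omega>\<bar> < r"
    then have "\<omega> \<in> excursion s \<delta> c r"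
      unfolding excursion_def using \<omega>(1) that by (intro UN_I[of n] CollectI conjI exI[of _ i]) auto
    with \<omega>(2) show False by simp
  qed
  \<comment> \<open>The right end point leaves no room to its right, but it belongs to the coarsest
    grid: level 0, index 1.\<close>
  have "t \<noteq> s + \<delta>" using no[of 1 0] neg by auto
  with t have t': "t < s + \<delta>" by simp
  have "((\<lambda>u. \<bar>Z u c \<omega> - Z s c \<omega>\<bar>) \<longlongrightarrow> \<bar>Z t c \<omega> - Z s c \<omega>\<bar>) (at_right t)"
    using s t by (intro tendsto_intros Z_right_continuous \<omega>) auto
  then have "eventually (\<lambda>u. r < \<bar>Z u c \<omega> - Z s c \<omega>\<bar>) (at_right t)"
    using neg by (intro order_tendstoD) auto
  then obtain b where b: "t < b" "\<And>u. t < u \<Longrightarrow> u < b \<Longrightarrow> r < \<bar>Z u c \<omega> - Z s c \<omega>\<bar>"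
    unfolding eventually_at_right_field by blast
  define g where "g = min b (s + \<delta>) - t"
  have g: "0 < g" using b t' by (simp add: g_def)
  obtain n where n: "\<delta> / g < 2 ^ n"
    using real_arch_pow[of 2 "\<delta> / g"] by auto
  define q where "q = \<delta> / 2 ^ n"
  have q: "0 < q" "q < g" using n g s by (simp_all add: q_def field_simps)
  \<comment> \<open>The first grid point strictly to the right of \<open>t\<close>, hence the floor
    plus one.\<close>
  define i where "i = nat (\<lfloor>(t - s) / q\<rfloor> + 1)"
  have fl: "0 \<le> (t - s) / q" using q t by simp
  have i: "real i = of_int \<lfloor>(t - s) / q\<rfloor> + 1" using fl by (simp add: i_def)
  have "(t - s) / q < real i" "real i \<le> (t - s) / q + 1" unfolding i by linarith+
  then have u: "t < s + real i * q" "s + real i * q \<le> t + q" using q by (simp_all add: field_simps)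
  then have u': "s + real i * q < b" "s + real i * q < s + \<delta>" using q by (auto simp: g_def)
  then have "real i * q < 2 ^ n * q" by (simp add: q_def)
  then have "real i < 2 ^ n" using q by simp
  then have "i \<le> 2 ^ n" by (metis less_imp_le of_nat_le_iff of_nat_numeral of_nat_power)
  from no[OF this] b(2)[OF u(1) u'(1)] show False by (simp add: q_def)
qed

end

section \<open>Compactness in the Skorokhod topology\<close>

lemma time_change_range: "\<gamma> \<in> time_changes T \<Longrightarrow> t \<in> {0..T} \<Longrightarrow> \<gamma> t \<in> {0..T}"
  unfolding time_changes_def by blast

lemma time_change_id: "(\<lambda>t. t) \<in> time_changes T"
  by (auto simp: time_changes_def strict_mono_on_def)

lemma time_change_comp:
  assumes "\<gamma> \<in> time_changes T" "\<gamma>' \<in> time_changes T"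
  shows "(\<lambda>t. \<gamma> (\<gamma>' t)) \<in> time_changes T"
proof -
  have "(\<lambda>t. \<gamma> (\<gamma>' t)) ` {0..T} = \<gamma> ` \<gamma>' ` {0..T}" by (simp add: image_image)
  also have "\<dots> = {0..T}" using assms by (simp add: time_changes_def)
  finally show ?thesis
    using assms time_change_range[OF assms(2)] by (auto simp: time_changes_def strict_mono_on_def)
qed

lemma time_change_inverse:
  assumes "\<gamma> \<in> time_changes T"
  obtains \<gamma>' where "\<gamma>' \<in> time_changes T" "\<And>t. t \<in> {0..T} \<Longrightarrow> \<gamma> (\<gamma>' t) = t"
    "\<And>t. t \<in> {0..T} \<Longrightarrow> \<gamma>' (\<gamma> t) = t"
proof
  have sm: "strict_mono_on {0..T} \<gamma>" and im: "\<gamma> ` {0..T} = {0..T}"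
    using assms by (auto simp: time_changes_def)
  have inj: "inj_on \<gamma> {0..T}" using sm by (rule strict_mono_on_imp_inj_on)
  let ?g = "inv_into {0..T} \<gamma>"
  show 1: "\<gamma> (?g t) = t" if "t \<in> {0..T}" for t
    using that im by (simp add: f_inv_into_f)
  show 2: "?g (\<gamma> t) = t" if "t \<in> {0..T}" for t
    using that inj by simp
  have rng: "?g t \<in> {0..T}" if "t \<in> {0..T}" for t
    using that im by (metis inv_into_into)
  have "?g ` {0..T} = {0..T}"
  proof
    show "?g ` {0..T} \<subseteq> {0..T}" using rng by blast
    show "{0..T} \<subseteq> ?g ` {0..T}" using 2 im by (metis imageI subsetI)
  qed
  moreover have "?g s < ?g t" if st: "s \<in> {0..T}" "t \<in> {0..T}" "s < t" for s t
  proof (rule ccontr)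
    assume "\<not> ?g s < ?g t"
    then have "\<gamma> (?g t) \<le> \<gamma> (?g s)"
      using strict_mono_on_leD[OF sm] rng st by (meson not_less)
    then show False using 1 st by simp
  qed
  ultimately show "?g \<in> time_changes T"
    by (auto simp: time_changes_def strict_mono_on_def)
qed

lemma skorokhod_near_cadlag: "y \<in> skorokhod_near T F e x \<Longrightarrow> y \<in> cadlag_paths T"
  by (simp add: skorokhod_near_def)

text \<open>Composing the time changes gives the triangle inequality. With symmetry from the inverse
  time change, the neighbourhoods for a fixed \<open>F\<close> behave like pseudometric
  balls.\<close>

lemma skorokhod_near_trans:
  assumes y: "y \<in> skorokhod_near T F d x" and z: "z \<in> skorokhod_near T F e y"
  shows "z \<in> skorokhod_near T F (d + e) x"
proof -
  obtain \<gamma> where g: "\<gamma> \<in> time_changes T"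
    "\<And>t. t \<in> {0..T} \<Longrightarrow> \<bar>\<gamma> t - t\<bar> < d \<and> (\<forall>f\<in>F. \<bar>x (\<gamma> t) f - y t f\<bar> < d)"
    using y unfolding skorokhod_near_def by blast
  obtain \<gamma>' where g': "\<gamma>' \<in> time_changes T"
    "\<And>t. t \<in> {0..T} \<Longrightarrow> \<bar>\<gamma>' t - t\<bar> < e \<and> (\<forall>f\<in>F. \<bar>y (\<gamma>' t) f - z t f\<bar> < e)"
    using z unfolding skorokhod_near_def by blast
  have "\<bar>\<gamma> (\<gamma>' t) - t\<bar> < d + e \<and> (\<forall>f\<in>F. \<bar>x (\<gamma> (\<gamma>' t)) f - z t f\<bar> < d + e)" if t: "t \<in> {0..T}" for t
  proof -
    note a = g(2)[OF time_change_range[OF g'(1) t]] and b = g'(2)[OF t]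
    have "\<bar>x (\<gamma> (\<gamma>' t)) f - z t f\<bar> < d + e" if "f \<in> F" for f
      using a b that by (smt (verit))
    with a b show ?thesis by (smt (verit))
  qed
  then show ?thesis
    using time_change_comp[OF g(1) g'(1)] skorokhod_near_cadlag[OF z]
    unfolding skorokhod_near_def by (intro CollectI conjI bexI[of _ "\<lambda>t. \<gamma> (\<gamma>' t)"]) auto
qed

lemma skorokhod_near_sym:
  assumes x: "x \<in> cadlag_paths T" and y: "y \<in> skorokhod_near T F e x"
  shows "x \<in> skorokhod_near T F e y"
proof -
  obtain \<gamma> where g: "\<gamma> \<in> time_changes T"
    "\<And>t. t \<in> {0..T} \<Longrightarrow> \<bar>\<gamma> t - t\<bar> < e \<and> (\<forall>f\<in>F. \<bar>x (\<gamma> t) f - y t f\<bar> < e)"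
    using y unfolding skorokhod_near_def by blast
  obtain \<gamma>' where g': "\<gamma>' \<in> time_changes T" "\<And>t. t \<in> {0..T} \<Longrightarrow> \<gamma> (\<gamma>' t) = t"
    using time_change_inverse[OF g(1)] by metis
  have "\<bar>\<gamma>' t - t\<bar> < e \<and> (\<forall>f\<in>F. \<bar>y (\<gamma>' t) f - x t f\<bar> < e)" if t: "t \<in> {0..T}" for t
    using g(2)[OF time_change_range[OF g'(1) t]] g'(2)[OF t] by (simp add: abs_minus_commute)
  then show ?thesis
    using g'(1) x unfolding skorokhod_near_def by blast
qed

abbreviation skorokhod_converges ::
  "real \<Rightarrow> (nat \<Rightarrow> real \<Rightarrow> (real \<Rightarrow> real) \<Rightarrow> real) \<Rightarrow> (real \<Rightarrow> (real \<Rightarrow> real) \<Rightarrow> real) \<Rightarrow> bool" where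
  "skorokhod_converges T s x \<equiv> \<forall>G d. finite G \<longrightarrow> G \<subseteq> torus_smooth \<longrightarrow> 0 < d \<longrightarrow>
    eventually (\<lambda>j. s j \<in> skorokhod_near T G d x) sequentially"

text \<open>The topology need not be metrizable; the sequence \<open>F n, e n\<close> of neighbourhoods, uniform on \<open>K\<close>,
  replaces the metric in the extraction of a Lebesgue number and of a finite net.\<close>

lemma compactin_skorokhodI:
  fixes F :: "nat \<Rightarrow> (real \<Rightarrow> real) set" and e :: "nat \<Rightarrow> real"
  assumes K: "K \<subseteq> cadlag_paths T"
    and F: "\<And>n. finite (F n)" "\<And>n. F n \<subseteq> torus_smooth" "\<And>n. 0 < e n"
    and base: "\<And>G d. finite G \<Longrightarrow> G \<subseteq> torus_smooth \<Longrightarrow> 0 < d \<Longrightarrow>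
      \<exists>n. \<forall>m\<ge>n. \<forall>x\<in>K. \<forall>y\<in>K. y \<in> skorokhod_near T (F m) (e m) x \<longrightarrow> y \<in> skorokhod_near T G d x"
    and seq: "\<And>s. (\<And>j::nat. s j \<in> K) \<Longrightarrow> \<exists>r x. strict_mono r \<and> x \<in> K \<and>
      skorokhod_converges T (\<lambda>j. s (r j)) x"
  shows "compactin (skorokhod_topology T) K"
proof -
  let ?near = "\<lambda>n. skorokhod_near T (F n) (e n)"
  have "openin (skorokhod_topology T) (cadlag_paths T)"
    unfolding openin_skorokhod_topology skorokhod_open_def
    using skorokhod_near_cadlag by (intro conjI ballI subset_refl exI[of _ "{}"] exI[of _ 1]) auto
  then have top: "K \<subseteq> topspace (skorokhod_topology T)"
    using K openin_subset by blast
  have cover: "\<exists>\<F>. finite \<F> \<and> \<F> \<subseteq> \<U> \<and> K \<subseteq> \<Union>\<F>"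
    if U: "\<forall>U\<in>\<U>. openin (skorokhod_topology T) U" "K \<subseteq> \<Union>\<U>" for \<U>
  proof -
    \<comment> \<open>If every \<open>n\<close> had a bad point \<open>s n\<close>, a subsequence
      would converge to some \<open>x\<close> in a member \<open>U\<close> of the cover; half a
      radius for the distance to \<open>x\<close> and half for the small neighbourhood would put the
      latter inside \<open>U\<close>.\<close>
    have "\<exists>n. \<forall>x\<in>K. \<exists>U\<in>\<U>. ?near n x \<inter> K \<subseteq> U"
    proof (rule ccontr)
      assume "\<not> ?thesis"
      then have "\<forall>n. \<exists>x. x \<in> K \<and> (\<forall>U\<in>\<U>. \<not> ?near n x \<inter> K \<subseteq> U)" by meson
      then obtain s where s: "\<And>n. s n \<in> K" "\<And>n U. U \<in> \<U> \<Longrightarrow> \<not> ?near n (s n) \<inter> K \<subseteq> U" by metis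
      obtain r x where r: "strict_mono r" "x \<in> K" and lim0: "skorokhod_converges T (\<lambda>j. s (r j)) x"
        using seq[of s, OF s(1)] by auto
      note lim = lim0[rule_format]
      obtain U where U': "U \<in> \<U>" "x \<in> U" using r U by blast
      then have "skorokhod_open T U" using U by (simp add: openin_skorokhod_topology)
      then obtain G d where G: "finite G" "G \<subseteq> torus_smooth" "0 < d" "skorokhod_near T G d x \<subseteq> U"
        using U'(2) unfolding skorokhod_open_def by meson
      obtain n where n: "\<And>m x y. n \<le> m \<Longrightarrow> x \<in> K \<Longrightarrow> y \<in> K \<Longrightarrow> y \<in> ?near m x \<Longrightarrow> y \<in> skorokhod_near T G (d / 2) x"
        using base[OF G(1,2), of "d / 2"] G(3) by auto
      have "eventually (\<lambda>j. s (r j) \<in> skorokhod_near T G (d / 2) x \<and> n \<le> j) sequentially"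
        using lim[OF G(1,2), of "d / 2"] G(3) eventually_ge_at_top by (auto intro: eventually_conj)
      then obtain j where j: "s (r j) \<in> skorokhod_near T G (d / 2) x" "n \<le> j"
        using eventually_happens trivial_limit_sequentially by blast
      have "n \<le> r j" using j seq_suble[OF r(1), of j] by linarith
      have "?near (r j) (s (r j)) \<inter> K \<subseteq> U"
      proof
        fix y assume y: "y \<in> ?near (r j) (s (r j)) \<inter> K"
        then have "y \<in> skorokhod_near T G (d / 2) (s (r j))"
          using n[OF \<open>n \<le> r j\<close> s(1)] by blast
        from skorokhod_near_trans[OF j(1) this] show "y \<in> U" using G(4) by auto
      qed
      with s(2)[OF U'(1)] show False by blast
    qed
    then obtain n where n: "\<And>x. x \<in> K \<Longrightarrow> \<exists>U\<in>\<U>. ?near n x \<inter> K \<subseteq> U" by blast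
    \<comment> \<open>Without a finite net, a greedy choice gives points of which none lies in the
      \<open>n\<close>-th neighbourhood of an earlier one, against convergence of a subsequence. The
      recursion carries the finite set of earlier points because each choice depends on all of
      them.\<close>
    have "\<exists>A. finite A \<and> A \<subseteq> K \<and> (\<forall>y\<in>K. \<exists>x\<in>A. y \<in> ?near n x)"
    proof (rule ccontr)
      assume neg: "\<not> ?thesis"
      define f where "f A = (SOME y. y \<in> K \<and> (\<forall>x\<in>A. y \<notin> ?near n x))" for A
      have f: "f A \<in> K" "\<And>x. x \<in> A \<Longrightarrow> f A \<notin> ?near n x" if "finite A" "A \<subseteq> K" for A
      proof -
        have "\<not> (\<forall>y\<in>K. \<exists>x\<in>A. y \<in> ?near n x)" using neg that by simp
        then have "\<exists>y. y \<in> K \<and> (\<forall>x\<in>A. y \<notin> ?near n x)" by auto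
        from someI_ex[OF this] show "f A \<in> K" "\<And>x. x \<in> A \<Longrightarrow> f A \<notin> ?near n x"
          unfolding f_def by auto
      qed
      define A where "A = rec_nat {} (\<lambda>_ A. insert (f A) A)"
      have A_Suc: "A (Suc j) = insert (f (A j)) (A j)" and A0: "A 0 = {}" for j
        by (simp_all add: A_def)
      have A: "finite (A j) \<and> A j \<subseteq> K" for j
        by (induction j) (use f(1) in \<open>auto simp: A_Suc A0\<close>)
      define s where "s j = f (A j)" for j
      have sA: "s i \<in> A j" if "i < j" for i j
        using that by (induction j) (auto simp: A_Suc s_def less_Suc_eq)
      have sK: "s j \<in> K" for j unfolding s_def using f(1) A by blast
      have sn: "s j \<notin> ?near n (s i)" if "i < j" for i j
        using f(2)[of "A j"] A sA[OF that] unfolding s_def by blast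
      obtain r x where r: "strict_mono r" "x \<in> K" and lim0: "skorokhod_converges T (\<lambda>j. s (r j)) x"
        using seq[of s, OF sK] by auto
      note lim = lim0[rule_format]
      obtain j where j: "\<And>i. j \<le> i \<Longrightarrow> s (r i) \<in> skorokhod_near T (F n) (e n / 2) x"
        using lim[OF F(1,2)] F(3) by (metis eventually_sequentially half_gt_zero)
      have "x \<in> skorokhod_near T (F n) (e n / 2) (s (r j))"
        using skorokhod_near_sym j r K by blast
      from skorokhod_near_trans[OF this j[of "Suc j"]] have "s (r (Suc j)) \<in> ?near n (s (r j))" by simp
      with sn[of "r j" "r (Suc j)"] r(1) show False by (simp add: strict_mono_def)
    qed
    then obtain A where A: "finite A" "A \<subseteq> K" "\<And>y. y \<in> K \<Longrightarrow> \<exists>x\<in>A. y \<in> ?near n x" by blast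
    obtain V where V: "\<And>x. x \<in> K \<Longrightarrow> V x \<in> \<U> \<and> ?near n x \<inter> K \<subseteq> V x" using n by metis
    show ?thesis
    proof (intro exI[of _ "V ` A"] conjI)
      show "K \<subseteq> \<Union>(V ` A)"
      proof
        fix y assume y: "y \<in> K"
        then obtain x where "x \<in> A" "y \<in> ?near n x" using A by blast
        with V A y show "y \<in> \<Union>(V ` A)" by blast
      qed
    qed (use A V in auto)
  qed
  show ?thesis
    unfolding compactin_def using top cover by auto
qed

section \<open>Smooth periodic functions and functionals bounded by the function and its second
  derivative\<close>

definition c2_bounded :: "real \<Rightarrow> (real \<Rightarrow> real) \<Rightarrow> bool" where
  "c2_bounded B f \<longleftrightarrow> (\<forall>x. \<bar>f x\<bar> \<le> B \<and> \<bar>(deriv ^^ 2) f x\<bar> \<le> B)"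

lemma smooth_DERIV:
  "f \<in> torus_smooth \<Longrightarrow> ((deriv ^^ k) f has_field_derivative (deriv ^^ Suc k) f x) (at x)"
  by (simp add: torus_smooth_def DERIV_deriv_iff_real_differentiable)

lemma smooth_continuous: "f \<in> torus_smooth \<Longrightarrow> continuous_on UNIV ((deriv ^^ k) f)"
  using smooth_DERIV DERIV_isCont by (metis continuous_at_imp_continuous_on)

lemma smooth_periodic:
  assumes "f \<in> torus_smooth"
  shows "(deriv ^^ k) f (x + 1) = (deriv ^^ k) f x"
proof (induction k arbitrary: x)
  case 0
  then show ?case using assms by (simp add: torus_smooth_def)
next
  case (Suc k)
  have "((deriv ^^ k) f has_field_derivative (deriv ^^ Suc k) f (x + 1)) (at (x + 1))"
    by (rule smooth_DERIV[OF assms])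
  then have "((deriv ^^ k) f has_field_derivative (deriv ^^ Suc k) f (x + 1)) (at x)"
    by (simp add: DERIV_shift Suc.IH)
  then show ?case using DERIV_unique smooth_DERIV[OF assms] by blast
qed

lemma periodic_eq_frac:
  fixes g :: "real \<Rightarrow> real"
  assumes "\<And>x. g (x + 1) = g x"
  shows "g x = g (frac x)"
proof -
  interpret periodic_fun_simple' g by standard (rule assms)
  have "g (frac x + of_int \<lfloor>x\<rfloor>) = g (frac x)" by (rule plus_of_int)
  then show ?thesis by (simp add: frac_def)
qed

lemma smooth_bounded:
  assumes "f \<in> torus_smooth"
  shows "\<exists>B\<ge>0. \<forall>x. \<bar>(deriv ^^ k) f x\<bar> \<le> B"
proof -
  have "compact ((deriv ^^ k) f ` {0..1})"
    using smooth_continuous[OF assms] by (intro compact_continuous_image) (auto intro: continuous_on_subset)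
  then have "bounded ((deriv ^^ k) f ` {0..1})" by (rule compact_imp_bounded)
  then obtain B where B: "\<forall>y\<in>(deriv ^^ k) f ` {0..1}. norm y \<le> B"
    unfolding bounded_iff by blast
  have "\<bar>(deriv ^^ k) f x\<bar> \<le> B" for x
    using B periodic_eq_frac[of "(deriv ^^ k) f", OF smooth_periodic[OF assms], of x] frac_lt_1[of x]
    by (auto intro: less_imp_le)
  moreover from this[of 0] have "0 \<le> B" by linarith
  ultimately show ?thesis by blast
qed

lemma smooth_c2_bounded:
  assumes "f \<in> torus_smooth"
  shows "\<exists>B\<ge>0. c2_bounded B f"
proof -
  obtain B0 where B0: "0 \<le> B0" "\<forall>x. \<bar>(deriv ^^ 0) f x\<bar> \<le> B0" using smooth_bounded[OF assms] by blast
  obtain B2 where B2: "0 \<le> B2" "\<forall>x. \<bar>(deriv ^^ 2) f x\<bar> \<le> B2" using smooth_bounded[OF assms] by blast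
  have "c2_bounded (max B0 B2) f" unfolding c2_bounded_def using B0(2) B2(2) by (auto simp: le_max_iff_disj)
  with B0(1) show ?thesis by (intro exI[of _ "max B0 B2"]) auto
qed

lemma smooth_add_cmult:
  assumes f: "f \<in> torus_smooth" and g: "g \<in> torus_smooth"
  shows "(deriv ^^ k) (\<lambda>x. f x + c * g x) = (\<lambda>x. (deriv ^^ k) f x + c * (deriv ^^ k) g x)"
    and "(\<lambda>x. f x + c * g x) \<in> torus_smooth"
proof -
  have D: "((\<lambda>x. (deriv ^^ k) f x + c * (deriv ^^ k) g x) has_field_derivative
      (deriv ^^ Suc k) f x + c * (deriv ^^ Suc k) g x) (at x)" for k x
    by (intro derivative_intros smooth_DERIV f g DERIV_cmult)
  have eq: "(deriv ^^ k) (\<lambda>x. f x + c * g x) = (\<lambda>x. (deriv ^^ k) f x + c * (deriv ^^ k) g x)" for k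
  proof (induction k)
    case (Suc k)
    have "(deriv ^^ Suc k) (\<lambda>x. f x + c * g x) = deriv (\<lambda>x. (deriv ^^ k) f x + c * (deriv ^^ k) g x)"
      by (simp add: Suc)
    also have "\<dots> = (\<lambda>x. (deriv ^^ Suc k) f x + c * (deriv ^^ Suc k) g x)"
      using DERIV_imp_deriv[OF D] by (intro ext)
    finally show ?case .
  qed simp
  show "(deriv ^^ k) (\<lambda>x. f x + c * g x) = (\<lambda>x. (deriv ^^ k) f x + c * (deriv ^^ k) g x)"
    by (rule eq)
  have "(deriv ^^ k) (\<lambda>x. f x + c * g x) differentiable (at x)" for k x
    unfolding eq real_differentiable_def using D by blast
  moreover have "f (x + 1) = f x" "g (x + 1) = g x" for x
    using f g by (auto simp: torus_smooth_def)
  ultimately show "(\<lambda>x. f x + c * g x) \<in> torus_smooth" by (simp add: torus_smooth_def)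
qed

lemma smooth_cmult: "g \<in> torus_smooth \<Longrightarrow> (\<lambda>x. c * g x) \<in> torus_smooth"
proof -
  assume g: "g \<in> torus_smooth"
  show ?thesis using smooth_add_cmult(2)[OF g g, of "c - 1"] by (simp add: algebra_simps)
qed

lemma smooth_diff:
  assumes f: "f \<in> torus_smooth" and g: "g \<in> torus_smooth"
  shows "(\<lambda>x. f x - g x) \<in> torus_smooth"
    "(deriv ^^ k) (\<lambda>x. f x - g x) = (\<lambda>x. (deriv ^^ k) f x - (deriv ^^ k) g x)"
  using smooth_add_cmult[OF f g, where c = "-1"] by simp_all

lemma first_difference_bound:
  assumes D: "\<And>x. (f has_field_derivative f' x) (at x)" and B: "\<And>x. \<bar>f' x\<bar> \<le> (B::real)"
  shows "\<bar>f y - f x\<bar> \<le> B * \<bar>y - x\<bar>"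
  using field_differentiable_bound[of UNIV f f' B y x] D B by auto

lemma second_difference_bound:
  assumes D: "\<And>x. (f has_field_derivative f' x) (at x)" "\<And>x. (f' has_field_derivative f'' x) (at x)"
    and B: "\<And>x. \<bar>f'' x\<bar> \<le> (B::real)" and h: "0 \<le> h"
  shows "\<bar>f (x + h) + f (x - h) - 2 * f x\<bar> \<le> B * h\<^sup>2"
proof -
  have "((\<lambda>v. f (v + h) - f v) has_field_derivative f' (v + h) - f' v) (at v)" for v
    using D(1)[of "v + h"] by (intro derivative_intros D(1)) (simp add: DERIV_shift)
  moreover have "\<bar>f' (v + h) - f' v\<bar> \<le> B * h" for v
    using first_difference_bound[OF D(2) B, of "v + h" v] h by simp
  ultimately have "\<bar>(f (x + h) - f x) - (f ((x - h) + h) - f (x - h))\<bar> \<le> (B * h) * \<bar>x - (x - h)\<bar>"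
    by (rule first_difference_bound)
  then show ?thesis using h by (simp add: power2_eq_square algebra_simps)
qed

text \<open>Continuity follows because the basic open sets of orders 0 and 2 around \<open>f\<close>
  together bound the increment of a linear \<open>\<nu>\<close> that is controlled by these two
  derivatives.\<close>

lemma torus_distributionsI:
  assumes ext: "\<nu> \<in> extensional torus_smooth"
    and add: "\<And>f g. f \<in> torus_smooth \<Longrightarrow> g \<in> torus_smooth \<Longrightarrow> \<nu> (\<lambda>x. f x + g x) = \<nu> f + \<nu> g"
    and mult: "\<And>c f. f \<in> torus_smooth \<Longrightarrow> \<nu> (\<lambda>x. c * f x) = c * \<nu> f"
    and bound: "\<And>f B. f \<in> torus_smooth \<Longrightarrow> c2_bounded B f \<Longrightarrow> \<bar>\<nu> f\<bar> \<le> A * B"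
  shows "\<nu> \<in> torus_distributions"
proof -
  have top: "topspace smooth_topology = torus_smooth"
  proof
    show "torus_smooth \<subseteq> topspace smooth_topology"
    proof
      fix f :: "real \<Rightarrow> real" assume f: "f \<in> torus_smooth"
      let ?V = "{g \<in> torus_smooth. \<forall>x. \<bar>(deriv ^^ 0) g x - (deriv ^^ 0) f x\<bar> < 1}"
      have "openin smooth_topology ?V"
        unfolding smooth_topology_def by (rule topology_generated_by_Basis) (use f zero_less_one in blast)
      moreover have "f \<in> ?V" using f by simp
      ultimately show "f \<in> topspace smooth_topology" using openin_subset by blast
    qed
  qed (auto simp: smooth_topology_def topology_generated_by_topspace)
  \<comment> \<open>The sign of \<open>A\<close> is not fixed, so a positive constant above it is
    used for dividing.\<close>
  define C where "C = \<bar>A\<bar> + 1"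
  have C: "0 < C" by (simp add: C_def)
  have "openin smooth_topology {f \<in> torus_smooth. \<nu> f \<in> U}" if U: "open U" for U
  proof (subst openin_subopen, intro ballI)
    fix f assume "f \<in> {f \<in> torus_smooth. \<nu> f \<in> U}"
    then have f: "f \<in> torus_smooth" "\<nu> f \<in> U" by auto
    then obtain e where e: "0 < e" "\<And>y. \<bar>y - \<nu> f\<bar> < e \<Longrightarrow> y \<in> U"
      using U unfolding open_dist dist_real_def by blast
    define d where "d = e / (2 * C)"
    have d: "0 < d" "C * d < e" using e C by (simp_all add: d_def)
    define V where "V k = {g \<in> torus_smooth. \<forall>x. \<bar>(deriv ^^ k) g x - (deriv ^^ k) f x\<bar> < d}" for k
    have "openin smooth_topology (V k)" for k
      unfolding smooth_topology_def
      by (rule topology_generated_by_Basis) (use f d in \<open>auto simp: V_def\<close>)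
    then have "openin smooth_topology (V 0 \<inter> V 2)" by blast
    moreover have "f \<in> V 0 \<inter> V 2" using f d by (simp add: V_def)
    moreover have "V 0 \<inter> V 2 \<subseteq> {f \<in> torus_smooth. \<nu> f \<in> U}"
    proof
      fix g assume g: "g \<in> V 0 \<inter> V 2"
      then have gs: "g \<in> torus_smooth" by (simp add: V_def)
      have "\<nu> (\<lambda>x. g x - f x) = \<nu> g - \<nu> f"
        using add[OF gs smooth_cmult[OF f(1), of "-1"]] mult[OF f(1), of "-1"] by simp
      moreover have "c2_bounded d (\<lambda>x. g x - f x)"
        unfolding c2_bounded_def smooth_diff(2)[OF gs f(1)]
        using g by (auto simp: V_def intro: less_imp_le)
      ultimately have "\<bar>\<nu> g - \<nu> f\<bar> \<le> A * d"
        using bound smooth_diff(1)[OF gs f(1)] by metis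
      also have "\<dots> \<le> C * d" using d by (intro mult_right_mono) (auto simp: C_def)
      finally show "g \<in> {f \<in> torus_smooth. \<nu> f \<in> U}" using gs d e by auto
    qed
    ultimately show "\<exists>T. openin smooth_topology T \<and> f \<in> T \<and> T \<subseteq> {f \<in> torus_smooth. \<nu> f \<in> U}" by blast
  qed
  then have "continuous_map smooth_topology euclideanreal \<nu>"
    by (auto simp: continuous_map_def top)
  then show ?thesis using ext add mult by (simp add: torus_distributions_def)
qed

lemma topspace_distribution_topology: "topspace distribution_topology = torus_distributions"
  by (auto simp: distribution_topology_def torus_distributions_def PiE_def)

lemma limitin_distribution_topology:
  assumes l: "l \<in> torus_distributions" and x: "eventually (\<lambda>a. x a \<in> torus_distributions) F"
    and lim: "\<And>f. f \<in> torus_smooth \<Longrightarrow> ((\<lambda>a. x a f) \<longlongrightarrow> l f) F"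
  shows "limitin distribution_topology x l F"
proof -
  have "eventually (\<lambda>a. x a \<in> topspace (product_topology (\<lambda>_. euclideanreal) torus_smooth)) F"
    using x by eventually_elim (auto simp: torus_distributions_def PiE_def)
  then show ?thesis
    unfolding distribution_topology_def limitin_subtopology limitin_componentwise
    using assms by (auto simp: torus_distributions_def)
qed

lemma cadlag_pathsI:
  assumes ext: "x \<in> extensional {0..T}"
    and dist: "\<And>t. t \<in> {0..T} \<Longrightarrow> x t \<in> torus_distributions"
    and right: "\<And>t f. t \<in> {0..T} \<Longrightarrow> f \<in> torus_smooth \<Longrightarrow>
      ((\<lambda>s. x s f) \<longlongrightarrow> x t f) (at t within {0..T} \<inter> {t<..})"
    and left: "\<And>t. t \<in> {0..T} \<Longrightarrow> \<exists>l\<in>torus_distributions. \<forall>f\<in>torus_smooth.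
      ((\<lambda>s. x s f) \<longlongrightarrow> l f) (at t within {0..T} \<inter> {..<t})"
  shows "x \<in> cadlag_paths T"
proof -
  have ev: "eventually (\<lambda>s. x s \<in> torus_distributions) (at t within {0..T} \<inter> S)" for t S
    using dist by (auto simp: eventually_at_filter)
  have "limitin distribution_topology x (x t) (at t within {0..T} \<inter> {t<..})" if "t \<in> {0..T}" for t
    using that by (intro limitin_distribution_topology dist ev right)
  moreover have "\<exists>l. limitin distribution_topology x l (at t within {0..T} \<inter> {..<t})" if t: "t \<in> {0..T}" for t
  proof -
    obtain l where "l \<in> torus_distributions" "\<And>f. f \<in> torus_smooth \<Longrightarrow>
        ((\<lambda>s. x s f) \<longlongrightarrow> l f) (at t within {0..T} \<inter> {..<t})"
      using left[OF t] by blast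
    with limitin_distribution_topology[OF _ ev] show ?thesis by blast
  qed
  ultimately show ?thesis
    unfolding cadlag_paths_def cadlag_on_def topspace_distribution_topology using ext dist by auto
qed

text \<open>A test function is approximated by any other one with the same derivative bound whose values,
  together with those of the second derivative, agree at the points \<open>j/n\<close> after rounding.\<close>

lemma countable_dense_smooth:
  "\<exists>g :: nat \<Rightarrow> real \<Rightarrow> real. (\<forall>i. g i \<in> torus_smooth) \<and>
    (\<forall>f\<in>torus_smooth. \<forall>e>0. \<exists>i. c2_bounded e (\<lambda>x. f x - g i x))"
proof -
  \<comment> \<open>The code below samples \<open>f\<close> and its second derivative; derivatives
    of orders 1 and 3 are the Lipschitz bounds that carry the samples to all points.\<close>
  define lip where "lip K f \<longleftrightarrow> (\<forall>x. \<bar>(deriv ^^ 1) f x\<bar> \<le> real K \<and> \<bar>(deriv ^^ 3) f x\<bar> \<le> real K)" for K :: nat and f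
  define code where "code n f = (map (\<lambda>j. \<lfloor>real n * f (real j / real n)\<rfloor>) [0..<n],
      map (\<lambda>j. \<lfloor>real n * (deriv ^^ 2) f (real j / real n)\<rfloor>) [0..<n])" for n :: nat and f
  define pick where "pick c = (case c of (K, n, d) \<Rightarrow>
      (if \<exists>f\<in>torus_smooth. lip K f \<and> code n f = d then SOME f. f \<in> torus_smooth \<and> lip K f \<and> code n f = d
       else (\<lambda>_. 0)))" for c :: "nat \<times> nat \<times> int list \<times> int list"
  have zero: "(\<lambda>_. 0) \<in> torus_smooth"
  proof -
    have "(deriv ^^ k) (\<lambda>_. 0 :: real) = (\<lambda>_. 0)" for k by (induction k) auto
    then show ?thesis by (simp add: torus_smooth_def)
  qed
  have pick: "pick (K, n, code n f) \<in> torus_smooth \<and> lip K (pick (K, n, code n f)) \<and>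
      code n (pick (K, n, code n f)) = code n f"
    if "f \<in> torus_smooth" "lip K f" for K n f
  proof -
    have ex: "\<exists>g. g \<in> torus_smooth \<and> lip K g \<and> code n g = code n f" using that by blast
    have "pick (K, n, code n f) = (SOME g. g \<in> torus_smooth \<and> lip K g \<and> code n g = code n f)"
      using ex by (auto simp: pick_def)
    then show ?thesis using someI_ex[OF ex] by simp
  qed
  have pick_smooth: "pick c \<in> torus_smooth" for c
  proof -
    obtain K n d where c: "c = (K, n, d)" by (metis prod_cases3 surj_pair)
    show ?thesis
    proof (cases "\<exists>f\<in>torus_smooth. lip K f \<and> code n f = d")
      case True
      then show ?thesis using pick c by blast
    next
      case False
      then have "pick c = (\<lambda>_. 0)" by (simp only: pick_def c prod.case if_not_P if_False)
      then show ?thesis using zero by simp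
    qed
  qed
  \<comment> \<open>From \<open>x\<close> to the grid point below it costs \<open>K / n\<close> for
    each function, and equal rounded values differ by at most \<open>1 / n\<close>; this is the
    origin of \<open>2 * K + 1\<close>.\<close>
  have near: "\<bar>u x - v x\<bar> \<le> e"
    if u: "\<And>x. (u has_field_derivative u' x) (at x)" "\<And>x. \<bar>u' x\<bar> \<le> real K" "\<And>x. u (x + 1) = u x"
      and v: "\<And>x. (v has_field_derivative v' x) (at x)" "\<And>x. \<bar>v' x\<bar> \<le> real K" "\<And>x. v (x + 1) = v x"
      and n: "0 < n" "2 * real K + 1 \<le> e * real n"
      and eq: "map (\<lambda>j. \<lfloor>real n * u (real j / real n)\<rfloor>) [0..<n] = map (\<lambda>j. \<lfloor>real n * v (real j / real n)\<rfloor>) [0..<n]"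
    for u u' v v' :: "real \<Rightarrow> real" and K n e x
  proof -
    define y where "y = frac x"
    have y: "0 \<le> y" "y < 1" by (auto simp: y_def frac_lt_1)
    define j where "j = nat \<lfloor>real n * y\<rfloor>"
    have jr: "real j = of_int \<lfloor>real n * y\<rfloor>" using y by (simp add: j_def)
    have jn: "j < n"
    proof -
      have "real n * y < real n * 1" using y n by (intro mult_strict_left_mono) auto
      then have "real j < real n" unfolding jr by linarith
      then show ?thesis by simp
    qed
    define q where "q = real j / real n"
    have "\<bar>real n * y - real j\<bar> \<le> 1" unfolding jr by linarith
    then have "\<bar>real n * (y - q)\<bar> \<le> 1" using n by (simp add: q_def right_diff_distrib)
    then have yq: "real n * \<bar>y - q\<bar> \<le> 1" by (simp add: abs_mult)
    have "\<lfloor>real n * u q\<rfloor> = \<lfloor>real n * v q\<rfloor>"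
      using arg_cong[OF eq, of "\<lambda>l. l ! j"] jn by (simp add: q_def)
    then have "\<bar>real n * u q - real n * v q\<bar> \<le> 1" by linarith
    then have uv: "real n * \<bar>u q - v q\<bar> \<le> 1" by (simp add: abs_mult flip: right_diff_distrib)
    have "real n * \<bar>u y - u q\<bar> \<le> real n * (real K * \<bar>y - q\<bar>)"
      by (intro mult_left_mono first_difference_bound[OF u(1,2)]) auto
    also have "\<dots> = real K * (real n * \<bar>y - q\<bar>)" by simp
    also have "\<dots> \<le> real K * 1" using yq by (intro mult_left_mono) auto
    finally have uq: "real n * \<bar>u y - u q\<bar> \<le> real K" by simp
    have "real n * \<bar>v y - v q\<bar> \<le> real n * (real K * \<bar>y - q\<bar>)"
      by (intro mult_left_mono first_difference_bound[OF v(1,2)]) auto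
    also have "\<dots> = real K * (real n * \<bar>y - q\<bar>)" by simp
    also have "\<dots> \<le> real K * 1" using yq by (intro mult_left_mono) auto
    finally have vq: "real n * \<bar>v y - v q\<bar> \<le> real K" by simp
    have "real n * \<bar>u y - v y\<bar> \<le> real n * (\<bar>u y - u q\<bar> + \<bar>u q - v q\<bar> + \<bar>v y - v q\<bar>)"
      by (intro mult_left_mono) auto
    also have "\<dots> \<le> real K + 1 + real K"
      unfolding distrib_left by (intro add_mono uq uv vq)
    also have "\<dots> \<le> real n * e" using n by (simp add: mult.commute)
    finally have "\<bar>u y - v y\<bar> \<le> e" using n by simp
    then show ?thesis
      using periodic_eq_frac[of u x, OF u(3)] periodic_eq_frac[of v x, OF v(3)] by (simp add: y_def)
  qed
  define g where "g = (\<lambda>i. pick (from_nat i))"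
  have "\<exists>i. c2_bounded e (\<lambda>x. f x - g i x)" if f: "f \<in> torus_smooth" and e: "0 < e" for f e
  proof -
    obtain B1 where B1: "\<forall>x. \<bar>(deriv ^^ 1) f x\<bar> \<le> B1" using smooth_bounded[OF f] by blast
    obtain B3 where B3: "\<forall>x. \<bar>(deriv ^^ 3) f x\<bar> \<le> B3" using smooth_bounded[OF f] by blast
    obtain K where K: "max B1 B3 \<le> real K" using real_arch_simple by blast
    have lf: "lip K f" unfolding lip_def using B1 B3 K by (meson max.boundedE order_trans)
    obtain n0 where n0: "(2 * real K + 1) / e \<le> real n0" using real_arch_simple by blast
    define n where "n = Suc n0"
    have n: "0 < n" "2 * real K + 1 \<le> e * real n"
      using n0 e by (auto simp: n_def field_simps)
    define h where "h = pick (K, n, code n f)"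
    have h: "h \<in> torus_smooth" "lip K h" "code n h = code n f"
      using pick[OF f lf, of n] by (simp_all add: h_def)
    have "\<bar>(deriv ^^ 0) f x - (deriv ^^ 0) h x\<bar> \<le> e" for x
      by (rule near[OF smooth_DERIV[OF f] _ smooth_periodic[OF f] smooth_DERIV[OF h(1)] _ smooth_periodic[OF h(1)] n])
        (use lf h in \<open>auto simp: lip_def code_def\<close>)
    moreover have "\<bar>(deriv ^^ 2) f x - (deriv ^^ 2) h x\<bar> \<le> e" for x
      by (rule near[OF smooth_DERIV[OF f] _ smooth_periodic[OF f] smooth_DERIV[OF h(1)] _ smooth_periodic[OF h(1)] n])
        (use lf h in \<open>auto simp: lip_def code_def numeral_3_eq_3 numeral_2_eq_2\<close>)
    ultimately have "c2_bounded e (\<lambda>x. f x - h x)"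
      unfolding c2_bounded_def smooth_diff(2)[OF f h(1)] by simp
    moreover have "h = g (to_nat (K, n, code n f))" by (simp add: g_def h_def)
    ultimately show ?thesis by blast
  qed
  moreover have "g i \<in> torus_smooth" for i using pick_smooth by (auto simp: g_def)
  ultimately show ?thesis by (intro exI[of _ g] conjI allI ballI impI)
qed

lemma diagonal_bounded:
  fixes \<Phi> :: "nat \<Rightarrow> nat \<Rightarrow> real"
  assumes "\<And>l. \<exists>C. \<forall>j. \<bar>\<Phi> j l\<bar> \<le> C"
  shows "\<exists>r. strict_mono r \<and> (\<forall>l. convergent (\<lambda>j. \<Phi> (r j) l))"
proof -
  interpret subseqs "\<lambda>l r. convergent (\<lambda>j. \<Phi> (r j) l)"
  proof
    fix l and s :: "nat \<Rightarrow> nat" assume "strict_mono s"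
    obtain C where C: "\<And>j. \<bar>\<Phi> j l\<bar> \<le> C" using assms[of l] by blast
    have "bounded (range (\<lambda>j. \<Phi> (s j) l))" unfolding bounded_iff using C by auto
    then obtain L r where "strict_mono r" "((\<lambda>j. \<Phi> (s j) l) \<circ> r) \<longlonglongrightarrow> L"
      using bounded_imp_convergent_subsequence by blast
    then show "\<exists>r'. strict_mono r' \<and> convergent (\<lambda>j. \<Phi> ((s \<circ> r') j) l)"
      by (intro exI[of _ r]) (auto simp: convergent_def comp_def)
  qed
  have "convergent (\<lambda>j. \<Phi> ((diagseq \<circ> (+) (Suc l)) j) l)" for l
  proof (rule diagseq_holds)
    fix n and s r :: "nat \<Rightarrow> nat"
    assume "strict_mono r" "convergent (\<lambda>j. \<Phi> (s j) n)"
    then show "convergent (\<lambda>j. \<Phi> ((s \<circ> r) j) n)"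
      using convergent_subseq_convergent[of "\<lambda>j. \<Phi> (s j) n" r] by (simp add: comp_def)
  qed
  then have "convergent (\<lambda>j. \<Phi> (diagseq j) l)" for l
    using convergent_ignore_initial_segment[of "\<lambda>j. \<Phi> (diagseq j) l" "Suc l"]
    by (simp add: comp_def add.commute[of _ l])
  then show ?thesis using subseq_diagseq by blast
qed

lemma torus_distributions_linear:
  assumes "\<nu> \<in> torus_distributions"
  shows "f \<in> torus_smooth \<Longrightarrow> g \<in> torus_smooth \<Longrightarrow> \<nu> (\<lambda>x. f x + g x) = \<nu> f + \<nu> g"
    and "f \<in> torus_smooth \<Longrightarrow> \<nu> (\<lambda>x. c * f x) = c * \<nu> f"
  using assms by (simp_all add: torus_distributions_def)

lemma torus_distributions_diff:
  assumes "\<nu> \<in> torus_distributions" "f \<in> torus_smooth" "g \<in> torus_smooth"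
  shows "\<nu> (\<lambda>x. f x - g x) = \<nu> f - \<nu> g"
proof -
  have "\<nu> (\<lambda>x. f x + (-1) * g x) = \<nu> f + \<nu> (\<lambda>x. (-1) * g x)"
    by (rule torus_distributions_linear(1)[OF assms(1,2) smooth_cmult[OF assms(3)]])
  also have "\<nu> (\<lambda>x. (-1) * g x) = (-1) * \<nu> g"
    by (rule torus_distributions_linear(2)[OF assms(1,3)])
  finally show ?thesis by simp
qed

section \<open>Bounded fields, moduli of continuity and their stability under limits\<close>

definition field_bounded :: "real \<Rightarrow> real \<Rightarrow> (real \<Rightarrow> (real \<Rightarrow> real) \<Rightarrow> real) \<Rightarrow> bool" where
  "field_bounded T A x \<longleftrightarrow> (\<forall>t\<in>{0..T}. x t \<in> torus_distributions \<and>
    (\<forall>f\<in>torus_smooth. \<forall>B. c2_bounded B f \<longrightarrow> \<bar>x t f\<bar> \<le> A * B))"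

definition osc_le :: "real \<Rightarrow> (real \<Rightarrow> (real \<Rightarrow> real) \<Rightarrow> real) \<Rightarrow> (real \<Rightarrow> real) \<Rightarrow> real \<Rightarrow> real \<Rightarrow> bool" where
  "osc_le T x f d e \<longleftrightarrow> (\<forall>s\<in>{0..T}. \<forall>t\<in>{0..T}. \<bar>s - t\<bar> < d \<longrightarrow> \<bar>x s f - x t f\<bar> \<le> e)"

lemma field_bounded_diff:
  assumes "field_bounded T A x" "t \<in> {0..T}" "f \<in> torus_smooth" "g \<in> torus_smooth"
    "c2_bounded B (\<lambda>u. f u - g u)"
  shows "\<bar>x t f - x t g\<bar> \<le> A * B"
  using assms smooth_diff(1)[OF assms(3,4)] torus_distributions_diff[of "x t" f g]
  unfolding field_bounded_def by metis

text \<open>Time changes are onto, so every value of the limit is within \<open>d\<close> of a value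
  of some bounded field.\<close>

lemma near_limit_field_bounded:
  assumes y: "y \<in> cadlag_paths T"
    and near: "\<And>f d. f \<in> torus_smooth \<Longrightarrow> 0 < d \<Longrightarrow> \<exists>x. field_bounded T A x \<and> x \<in> skorokhod_near T {f} d y"
  shows "field_bounded T A y"
  unfolding field_bounded_def
proof (intro ballI conjI allI impI)
  fix t assume t: "t \<in> {0..T}"
  then show "y t \<in> torus_distributions"
    using y by (auto simp: cadlag_paths_def cadlag_on_def topspace_distribution_topology)
  fix f B assume f: "f \<in> torus_smooth" "c2_bounded B f"
  show "\<bar>y t f\<bar> \<le> A * B"
  proof (rule field_le_epsilon)
    fix d :: real assume "0 < d"
    then obtain x where x: "field_bounded T A x" "x \<in> skorokhod_near T {f} d y"
      using near f by blast
    then obtain \<gamma> where g: "\<gamma> \<in> time_changes T" "\<And>u. u \<in> {0..T} \<Longrightarrow> \<bar>y (\<gamma> u) f - x u f\<bar> < d"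
      unfolding skorokhod_near_def by auto
    obtain u where u: "u \<in> {0..T}" "\<gamma> u = t"
      using g(1) t unfolding time_changes_def by (metis (mono_tags, lifting) imageE mem_Collect_eq)
    have "\<bar>x u f\<bar> \<le> A * B" using x(1) u f unfolding field_bounded_def by blast
    with g(2)[OF u(1)] u(2) show "\<bar>y t f\<bar> \<le> A * B + d" by auto
  qed
qed

text \<open>The strict inequality \<open>\<bar>s - t\<bar> < \<delta>\<close> leaves room for a
  small time change to move both times, while the bound on the values is not strict. Thus the
  condition is closed.\<close>

lemma near_limit_osc_le:
  assumes near: "\<And>d. 0 < d \<Longrightarrow> \<exists>x. osc_le T x f \<delta> e \<and> x \<in> skorokhod_near T {f} d y"
  shows "osc_le T y f \<delta> e"
  unfolding osc_le_def
proof (intro ballI impI)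
  fix s t assume st: "s \<in> {0..T}" "t \<in> {0..T}" "\<bar>s - t\<bar> < \<delta>"
  show "\<bar>y s f - y t f\<bar> \<le> e"
  proof (rule field_le_epsilon)
    fix \<kappa> :: real assume k: "0 < \<kappa>"
    define d where "d = min (\<kappa> / 2) ((\<delta> - \<bar>s - t\<bar>) / 2)"
    have d: "0 < d" "2 * d \<le> \<kappa>" "2 * d \<le> \<delta> - \<bar>s - t\<bar>" using k st by (auto simp: d_def min_def)
    obtain x where x: "osc_le T x f \<delta> e" "x \<in> skorokhod_near T {f} d y"
      using near[OF d(1)] by blast
    then obtain \<gamma> where g: "\<gamma> \<in> time_changes T"
      "\<And>u. u \<in> {0..T} \<Longrightarrow> \<bar>\<gamma> u - u\<bar> < d \<and> \<bar>y (\<gamma> u) f - x u f\<bar> < d"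
      unfolding skorokhod_near_def by auto
    obtain u v where u: "u \<in> {0..T}" "\<gamma> u = s" and v: "v \<in> {0..T}" "\<gamma> v = t"
      using g(1) st unfolding time_changes_def by (metis (mono_tags, lifting) imageE mem_Collect_eq)
    have uv: "\<bar>s - u\<bar> < d" "\<bar>y s f - x u f\<bar> < d" "\<bar>t - v\<bar> < d" "\<bar>y t f - x v f\<bar> < d"
      using g(2)[OF u(1)] g(2)[OF v(1)] u(2) v(2) by auto
    then have "\<bar>u - v\<bar> < \<delta>" using d by linarith
    then have "\<bar>x u f - x v f\<bar> \<le> e" using x(1) u v unfolding osc_le_def by blast
    then show "\<bar>y s f - y t f\<bar> \<le> e + \<kappa>" using uv d by linarith
  qed
qed

text \<open>Setting for an Arzela-Ascoli argument. An approximant must also come with a small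
  tolerance, so in the application every function of a dense sequence is repeated with all
  tolerances.\<close>

locale test_family =
  fixes w :: "nat \<Rightarrow> real \<Rightarrow> real" and tol \<delta> :: "nat \<Rightarrow> real" and T A :: real
  assumes T: "0 < T" and A: "0 \<le> A"
    and w_smooth: "\<And>i. w i \<in> torus_smooth"
    and w_dense: "\<And>f e. f \<in> torus_smooth \<Longrightarrow> 0 < e \<Longrightarrow> \<exists>i. c2_bounded e (\<lambda>x. f x - w i x) \<and> tol i \<le> e"
    and \<delta>_pos: "\<And>i. 0 < \<delta> i"
begin

lemma osc_test:
  assumes x: "field_bounded T A x" and f: "f \<in> torus_smooth" and i: "c2_bounded e (\<lambda>x. f x - w i x)"
    and osc: "osc_le T x (w i) (\<delta> i) (tol i)"
    and st: "s \<in> {0..T}" "t \<in> {0..T}" "\<bar>s - t\<bar> < \<delta> i"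
  shows "\<bar>x s f - x t f\<bar> \<le> 2 * A * e + tol i"
proof -
  have "\<bar>x s f - x s (w i)\<bar> \<le> A * e" "\<bar>x t f - x t (w i)\<bar> \<le> A * e"
    using field_bounded_diff[OF x _ f w_smooth i] st by auto
  moreover have "\<bar>x s (w i) - x t (w i)\<bar> \<le> tol i"
    using osc st unfolding osc_le_def by blast
  ultimately show ?thesis by linarith
qed

text \<open>Arzela-Ascoli: diagonal convergence at countably many times and test functions, made
  uniform in time by the moduli and extended to all test functions by the common bound
  \<open>A\<close>. Each modulus has to hold only eventually along the sequence.\<close>

lemma equicontinuous_limit:
  fixes s :: "nat \<Rightarrow> real \<Rightarrow> (real \<Rightarrow> real) \<Rightarrow> real"
  assumes bd: "\<And>j. field_bounded T A (s j)"
    and osc: "\<And>i. eventually (\<lambda>j. osc_le T (s j) (w i) (\<delta> i) (tol i)) sequentially"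
  obtains r y where "strict_mono r" "y \<in> cadlag_paths T" "field_bounded T A y"
    "\<And>i. osc_le T y (w i) (\<delta> i) (tol i)"
    "\<And>f e. f \<in> torus_smooth \<Longrightarrow> 0 < e \<Longrightarrow>
      eventually (\<lambda>j. \<forall>t\<in>{0..T}. \<bar>s (r j) t f - y t f\<bar> < e) sequentially"
proof -
  \<comment> \<open>Truncation by \<open>min 1\<close> keeps every grid time in the interval, so the
    diagonal argument can run over all triples.\<close>
  define q where "q n a = T * min 1 (real a / real (Suc n))" for n a :: nat
  have q: "q n a \<in> {0..T}" for n a
    using T by (auto simp: q_def mult_left_le)
  define \<Phi> where "\<Phi> j l = (case from_nat l of (k, n, a) \<Rightarrow> s j (q n a) (w k))" for j l :: nat
  have "\<exists>C. \<forall>j. \<bar>\<Phi> j l\<bar> \<le> C" for l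
  proof -
    obtain k n a where l: "(from_nat l :: nat \<times> nat \<times> nat) = (k, n, a)" by (metis prod_cases3)
    obtain B where "c2_bounded B (w k)" using smooth_c2_bounded[OF w_smooth] by blast
    then show ?thesis
      using bd q w_smooth unfolding field_bounded_def \<Phi>_def l by (intro exI[of _ "A * B"]) auto
  qed
  then obtain r where r: "strict_mono r" and conv: "\<And>l. convergent (\<lambda>j. \<Phi> (r j) l)"
    using diagonal_bounded[of \<Phi>] by auto
  have convq: "convergent (\<lambda>j. s (r j) (q n a) (w k))" for k n a
    using conv[of "to_nat (k, n, a)"] by (simp add: \<Phi>_def)
  have cauchy: "\<exists>J. \<forall>j\<ge>J. \<forall>j'\<ge>J. \<forall>t\<in>{0..T}. \<bar>s (r j) t f - s (r j') t f\<bar> < e"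
    if f: "f \<in> torus_smooth" and e: "0 < e" for f e
  proof -
    \<comment> \<open>Two replacements of \<open>f\<close> by \<open>w i\<close> cost
      \<open>2 * A * e'\<close>; two oscillations and two distances to the limit at a grid time cost
      \<open>4 * e'\<close>. The fifth unit leaves slack.\<close>
    define e' where "e' = e / (2 * A + 5)"
    have e': "0 < e'" "(2 * A + 5) * e' = e" using e A by (simp_all add: e'_def)
    obtain i where i: "c2_bounded e' (\<lambda>x. f x - w i x)" "tol i \<le> e'" using w_dense[OF f e'(1)] by blast
    obtain n :: nat where n: "T / \<delta> i < real n" using reals_Archimedean2 by blast
    have "T / \<delta> i < real (Suc n)" using n by simp
    then have mesh: "T / real (Suc n) < \<delta> i"
      using \<delta>_pos[of i] by (simp add: field_simps)
    have "\<exists>L. (\<lambda>j. s (r j) (q n a) (w i)) \<longlonglongrightarrow> L" for a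
      using convq unfolding convergent_def by blast
    then obtain L where L: "\<And>a. (\<lambda>j. s (r j) (q n a) (w i)) \<longlonglongrightarrow> L a" by metis
    have "eventually (\<lambda>j. \<bar>s (r j) (q n a) (w i) - L a\<bar> < e') sequentially" for a
      using tendstoD[OF L e'(1)] by (simp add: dist_real_def)
    then have "eventually (\<lambda>j. \<forall>a\<in>{..Suc n}. \<bar>s (r j) (q n a) (w i) - L a\<bar> < e') sequentially"
      by (intro eventually_ball_finite) auto
    moreover have "eventually (\<lambda>j. osc_le T (s (r j)) (w i) (\<delta> i) (tol i)) sequentially"
      using osc[of i] r by (rule eventually_subseq[rotated])
    ultimately have "eventually (\<lambda>j. (\<forall>a\<in>{..Suc n}. \<bar>s (r j) (q n a) (w i) - L a\<bar> < e') \<and>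
        osc_le T (s (r j)) (w i) (\<delta> i) (tol i)) sequentially"
      by (rule eventually_conj)
    then obtain J where J: "\<And>j. J \<le> j \<Longrightarrow> (\<forall>a\<in>{..Suc n}. \<bar>s (r j) (q n a) (w i) - L a\<bar> < e') \<and>
        osc_le T (s (r j)) (w i) (\<delta> i) (tol i)"
      unfolding eventually_sequentially by blast
    have close: "\<bar>s (r j) t f - s (r j') t f\<bar> < e" if j: "J \<le> j" "J \<le> j'" and t: "t \<in> {0..T}" for j j' t
    proof -
      define a where "a = nat \<lfloor>t * real (Suc n) / T\<rfloor>"
      have ar: "real a = of_int \<lfloor>t * real (Suc n) / T\<rfloor>" using t T by (simp add: a_def)
      have a1: "real a \<le> t * real (Suc n) / T" "t * real (Suc n) / T < real a + 1" unfolding ar by linarith+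
      have "t * real (Suc n) / T \<le> T * real (Suc n) / T"
        using t T by (intro divide_right_mono mult_right_mono) auto
      then have "t * real (Suc n) / T \<le> real (Suc n)" using T by simp
      then have an: "a \<le> Suc n" using a1 by (metis of_nat_le_iff order_trans)
      define S where "S = real (Suc n)"
      have S: "0 < S" by (simp add: S_def)
      have "real a / S \<le> 1" using an by (simp add: S_def)
      then have qa: "q n a = T * real a / S" by (simp add: q_def S_def min_absorb2)
      have "T * real a \<le> t * S" "t * S \<le> T * real a + T"
        using a1[folded S_def] T by (simp_all add: field_simps)
      then have "T * real a / S \<le> t" "t \<le> T * real a / S + T / S"
        using S by (simp_all add: field_simps)
      then have "\<bar>t - q n a\<bar> \<le> T / real (Suc n)"
        unfolding qa S_def by linarith
      then have ta: "\<bar>t - q n a\<bar> < \<delta> i" using mesh by linarith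
      have b: "\<bar>s (r j) t f - s (r j) t (w i)\<bar> \<le> A * e'" for j
        using field_bounded_diff[OF bd t f w_smooth i(1)] .
      have o: "\<bar>s (r j) t (w i) - s (r j) (q n a) (w i)\<bar> \<le> e'" if "J \<le> j" for j
        using J[OF that] t q ta i(2) unfolding osc_le_def by (meson order_trans)
      have l: "\<bar>s (r j) (q n a) (w i) - L a\<bar> < e'" if "J \<le> j" for j
        using J[OF that] an by simp
      have "\<bar>s (r j) t f - s (r j') t f\<bar> < (2 * A + 5) * e'"
        using b[of j] b[of j'] o[OF j(1)] o[OF j(2)] l[OF j(1)] l[OF j(2)] e'(1)
        unfolding distrib_right mult.assoc by linarith
      then show ?thesis using e' by simp
    qed
    then show ?thesis by blast
  qed
  have conv_t: "convergent (\<lambda>j. s (r j) t f)" if t: "t \<in> {0..T}" and f: "f \<in> torus_smooth" for t f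
  proof (rule Cauchy_convergent, rule metric_CauchyI)
    fix e :: real assume "0 < e"
    then show "\<exists>M. \<forall>m\<ge>M. \<forall>n\<ge>M. dist (s (r m) t f) (s (r n) t f) < e"
      using cauchy[OF f, of e] t unfolding dist_real_def by blast
  qed
  define y where "y = (\<lambda>t\<in>{0..T}. \<lambda>f\<in>torus_smooth. lim (\<lambda>j. s (r j) t f))"
  have lim: "(\<lambda>j. s (r j) t f) \<longlonglongrightarrow> y t f" if "t \<in> {0..T}" "f \<in> torus_smooth" for t f
    using conv_t[OF that] that by (simp add: y_def convergent_LIMSEQ_iff)
  have bound: "\<bar>y t f\<bar> \<le> A * B" if t: "t \<in> {0..T}" and f: "f \<in> torus_smooth" "c2_bounded B f" for t f B
  proof (rule tendsto_upperbound[OF tendsto_rabs[OF lim[OF t f(1)]]])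
    show "eventually (\<lambda>j. \<bar>s (r j) t f\<bar> \<le> A * B) sequentially"
      using bd t f unfolding field_bounded_def by (intro always_eventually) blast
  qed simp
  have dist: "y t \<in> torus_distributions" if t: "t \<in> {0..T}" for t
  proof (rule torus_distributionsI[where A = A])
    have sd: "s (r j) t \<in> torus_distributions" for j using bd t unfolding field_bounded_def by blast
    show "y t \<in> extensional torus_smooth" using t by (simp add: y_def)
    fix f g assume f: "f \<in> torus_smooth" and g: "g \<in> torus_smooth"
    have fg: "(\<lambda>x. f x + g x) \<in> torus_smooth" using smooth_add_cmult(2)[OF f g, of 1] by simp
    have "(\<lambda>j. s (r j) t (\<lambda>x. f x + g x)) = (\<lambda>j. s (r j) t f + s (r j) t g)"
      using torus_distributions_linear(1)[OF sd f g] by simp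
    then show "y t (\<lambda>x. f x + g x) = y t f + y t g"
      using LIMSEQ_unique[OF lim[OF t fg]] tendsto_add[OF lim[OF t f] lim[OF t g]] by simp
  next
    have sd: "s (r j) t \<in> torus_distributions" for j using bd t unfolding field_bounded_def by blast
    fix c f assume f: "f \<in> torus_smooth"
    have "(\<lambda>j. s (r j) t (\<lambda>x. c * f x)) = (\<lambda>j. c * s (r j) t f)"
      using torus_distributions_linear(2)[OF sd f] by simp
    then show "y t (\<lambda>x. c * f x) = c * y t f"
      using LIMSEQ_unique[OF lim[OF t smooth_cmult[OF f]]] tendsto_mult_left[OF lim[OF t f]] by simp
  qed (use bound t in auto)
  have fb: "field_bounded T A y" unfolding field_bounded_def using dist bound by blast
  have yosc: "osc_le T y (w i) (\<delta> i) (tol i)" for i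
    unfolding osc_le_def
  proof (intro ballI impI)
    fix u t assume ut: "u \<in> {0..T}" "t \<in> {0..T}" "\<bar>u - t\<bar> < \<delta> i"
    have "eventually (\<lambda>j. osc_le T (s (r j)) (w i) (\<delta> i) (tol i)) sequentially"
      using osc[of i] r by (rule eventually_subseq[rotated])
    then have "eventually (\<lambda>j. \<bar>s (r j) u (w i) - s (r j) t (w i)\<bar> \<le> tol i) sequentially"
      by eventually_elim (use ut in \<open>auto simp: osc_le_def\<close>)
    then show "\<bar>y u (w i) - y t (w i)\<bar> \<le> tol i"
      by (intro tendsto_upperbound[OF tendsto_rabs[OF tendsto_diff[OF lim lim]]]) (use ut w_smooth in auto)
  qed
  \<comment> \<open>The set \<open>S\<close> is arbitrary, so this single statement yields both
    one-sided limits: the limit path is continuous against every test function.\<close>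
  have ycont: "((\<lambda>u. y u f) \<longlongrightarrow> y t f) (at t within {0..T} \<inter> S)"
    if t: "t \<in> {0..T}" and f: "f \<in> torus_smooth" for t f S
  proof (rule tendstoI)
    fix e :: real assume e: "0 < e"
    define e' where "e' = e / (2 * A + 2)"
    have e': "0 < e'" "(2 * A + 2) * e' = e" using e A by (simp_all add: e'_def)
    obtain i where i: "c2_bounded e' (\<lambda>x. f x - w i x)" "tol i \<le> e'" using w_dense[OF f e'(1)] by blast
    have "dist (y u f) (y t f) < e" if u: "u \<in> {0..T}" "dist u t < \<delta> i" for u
    proof -
      have "\<bar>y u f - y t f\<bar> \<le> 2 * A * e' + tol i"
        using osc_test[OF fb f i(1) yosc u(1) t] u by (simp add: dist_real_def)
      also have "\<dots> < (2 * A + 2) * e'" using i(2) e'(1) by (simp add: algebra_simps)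
      finally show ?thesis using e' by (simp add: dist_real_def)
    qed
    then show "eventually (\<lambda>u. dist (y u f) (y t f) < e) (at t within {0..T} \<inter> S)"
      unfolding eventually_at using \<delta>_pos[of i] by blast
  qed
  have ycad: "y \<in> cadlag_paths T"
  proof (rule cadlag_pathsI)
    show "y \<in> extensional {0..T}" by (simp add: y_def)
    fix t assume t: "t \<in> {0..T}"
    show "\<exists>l\<in>torus_distributions. \<forall>f\<in>torus_smooth. ((\<lambda>u. y u f) \<longlongrightarrow> l f) (at t within {0..T} \<inter> {..<t})"
      using dist[OF t] ycont[OF t] by blast
  qed (use dist ycont in blast)+
  have unif: "eventually (\<lambda>j. \<forall>t\<in>{0..T}. \<bar>s (r j) t f - y t f\<bar> < e) sequentially"
    if f: "f \<in> torus_smooth" and e: "0 < e" for f e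
  proof -
    obtain J where J: "\<And>j j' t. J \<le> j \<Longrightarrow> J \<le> j' \<Longrightarrow> t \<in> {0..T} \<Longrightarrow> \<bar>s (r j) t f - s (r j') t f\<bar> < e / 2"
      using cauchy[OF f half_gt_zero[OF e]] by blast
    have "\<bar>s (r j) t f - y t f\<bar> < e" if j: "J \<le> j" and t: "t \<in> {0..T}" for j t
    proof -
      have "eventually (\<lambda>j'. \<bar>s (r j) t f - s (r j') t f\<bar> \<le> e / 2) sequentially"
        using J[OF j _ t] less_imp_le unfolding eventually_sequentially by blast
      then have "\<bar>s (r j) t f - y t f\<bar> \<le> e / 2"
        by (intro tendsto_upperbound[OF tendsto_rabs[OF tendsto_diff[OF tendsto_const lim[OF t f]]]]) auto
      then show ?thesis using e by linarith
    qed
    then show ?thesis unfolding eventually_sequentially by blast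
  qed
  show ?thesis by (rule that[OF r ycad fb yosc unif])
qed

text \<open>On fields with the common bound, closeness on finitely many \<open>w i\<close> implies
  closeness on any finite \<open>G\<close>, uniformly over \<open>K\<close>. This is the countable
  base required by \<open>compactin_skorokhodI\<close>.\<close>

lemma near_base:
  assumes bd: "\<And>x. x \<in> K \<Longrightarrow> field_bounded T A x"
    and G: "finite G" "G \<subseteq> torus_smooth" "0 < d"
  shows "\<exists>n. \<forall>m\<ge>n. \<forall>x\<in>K. \<forall>y\<in>K.
    y \<in> skorokhod_near T (w ` {..m}) (1 / real (Suc m)) x \<longrightarrow> y \<in> skorokhod_near T G d x"
proof -
  define d' where "d' = d / (2 * A + 2)"
  have d': "0 < d'" "(2 * A + 2) * d' = d" using G A by (simp_all add: d'_def)
  obtain i where i: "\<And>f. f \<in> G \<Longrightarrow> c2_bounded d' (\<lambda>x. f x - w (i f) x)"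
    using w_dense[OF _ d'(1)] G(2) by (metis subsetD)
  obtain n0 :: nat where n0: "1 / d' < real n0" using reals_Archimedean2 by blast
  define n where "n = Max (insert n0 (i ` G))"
  have n: "n0 \<le> n" "\<And>f. f \<in> G \<Longrightarrow> i f \<le> n" using G by (auto simp: n_def)
  have "y \<in> skorokhod_near T G d x"
    if m: "n \<le> m" and x: "x \<in> K" and y: "y \<in> K" and near: "y \<in> skorokhod_near T (w ` {..m}) (1 / real (Suc m)) x"
    for m x y
  proof -
    have "1 / d' < real (Suc m)" using n0 n(1) m by linarith
    then have em: "1 / real (Suc m) < d'" using d' by (simp add: field_simps)
    have "d' \<le> d" using d' A by (simp add: algebra_simps flip: d'(2))
    obtain \<gamma> where g: "\<gamma> \<in> time_changes T" "\<And>t. t \<in> {0..T} \<Longrightarrow> \<bar>\<gamma> t - t\<bar> < 1 / real (Suc m) \<and>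
        (\<forall>f\<in>w ` {..m}. \<bar>x (\<gamma> t) f - y t f\<bar> < 1 / real (Suc m))"
      using near unfolding skorokhod_near_def by blast
    have "\<bar>\<gamma> t - t\<bar> < d \<and> (\<forall>f\<in>G. \<bar>x (\<gamma> t) f - y t f\<bar> < d)" if t: "t \<in> {0..T}" for t
    proof (intro conjI ballI)
      show "\<bar>\<gamma> t - t\<bar> < d" using g(2)[OF t] em \<open>d' \<le> d\<close> by linarith
      fix f assume f: "f \<in> G"
      then have fs: "f \<in> torus_smooth" using G by blast
      have "\<bar>x (\<gamma> t) f - x (\<gamma> t) (w (i f))\<bar> \<le> A * d'" "\<bar>y t f - y t (w (i f))\<bar> \<le> A * d'"
        using field_bounded_diff[OF bd _ fs w_smooth i[OF f]] x y t time_change_range[OF g(1) t] by blast+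
      moreover have "\<bar>x (\<gamma> t) (w (i f)) - y t (w (i f))\<bar> < 1 / real (Suc m)"
        using g(2)[OF t] n(2)[OF f] m by auto
      ultimately have "\<bar>x (\<gamma> t) f - y t f\<bar> < 2 * (A * d') + d'" using em by linarith
      also have "\<dots> \<le> (2 * A + 2) * d'" using d' by (simp add: algebra_simps)
      finally show "\<bar>x (\<gamma> t) f - y t f\<bar> < d" using d' by simp
    qed
    then show ?thesis
      using g(1) skorokhod_near_cadlag[OF near] unfolding skorokhod_near_def by blast
  qed
  then show ?thesis by blast
qed

text \<open>Sequences with bounded index stay in one of the compact sets \<open>P n\<close>; along sequences with
  unbounded index every modulus condition is eventually active, so the limit is continuous.\<close>

lemma compactin_Union:
  fixes P :: "nat \<Rightarrow> (real \<Rightarrow> (real \<Rightarrow> real) \<Rightarrow> real) set" and n0 :: "nat \<Rightarrow> nat"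
  assumes cad: "\<And>n. P n \<subseteq> cadlag_paths T"
    and bd: "\<And>n x. x \<in> P n \<Longrightarrow> field_bounded T A x"
    and osc: "\<And>n i x. n0 i \<le> n \<Longrightarrow> x \<in> P n \<Longrightarrow> osc_le T x (w i) (\<delta> i) (tol i)"
    and seq: "\<And>n s. (\<And>j::nat. s j \<in> P n) \<Longrightarrow> \<exists>r x. strict_mono r \<and> x \<in> P n \<and>
      skorokhod_converges T (\<lambda>j. s (r j)) x"
  obtains K where "compactin (skorokhod_topology T) K" "\<And>n. P n \<subseteq> K"
proof -
  \<comment> \<open>Limits along unbounded indices satisfy all modulus conditions but need not lie
    in any \<open>P n\<close>; \<open>C\<close> provides for them.\<close>
  define C where "C = {x \<in> cadlag_paths T. field_bounded T A x \<and> (\<forall>i. osc_le T x (w i) (\<delta> i) (tol i))}"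
  define K where "K = C \<union> (\<Union>n. P n)"
  have Kbd: "field_bounded T A x" if "x \<in> K" for x using that bd by (auto simp: K_def C_def)
  have Kcad: "K \<subseteq> cadlag_paths T" using cad by (auto simp: K_def C_def)
  have "\<exists>r x. strict_mono r \<and> x \<in> K \<and> skorokhod_converges T (\<lambda>j. s (r j)) x"
    if s: "\<And>j::nat. s j \<in> K" for s
  proof (cases "\<exists>n. infinite {j. s j \<in> P n}")
    case True
    then obtain n where inf: "infinite {j. s j \<in> P n}" by blast
    define r1 where "r1 = enumerate {j. s j \<in> P n}"
    have r1: "strict_mono r1" unfolding r1_def using inf by (rule strict_mono_enumerate)
    have sP: "s (r1 j) \<in> P n" for j unfolding r1_def using enumerate_in_set[OF inf] by blast
    obtain r x where r: "strict_mono r" "x \<in> P n" "skorokhod_converges T (\<lambda>j. s (r1 (r j))) x"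
      using seq[of "\<lambda>j. s (r1 j)" n, OF sP] by auto
    have "strict_mono (\<lambda>j. r1 (r j))" using r1 r(1) by (simp add: strict_mono_def)
    moreover have "x \<in> K" using r(2) by (auto simp: K_def)
    ultimately show ?thesis using r(3) by (intro exI[of _ "\<lambda>j. r1 (r j)"] exI[of _ x]) simp
  next
    case False
    have ev: "eventually (\<lambda>j. osc_le T (s j) (w i) (\<delta> i) (tol i)) sequentially" for i
    proof -
      \<comment> \<open>Each \<open>P n\<close> is visited only finitely often in this case, so the
        finitely many levels below \<open>n0 i\<close> are eventually avoided.\<close>
      have "eventually (\<lambda>j. \<forall>n\<in>{..<n0 i}. s j \<notin> P n) sequentially"
        using False by (intro eventually_ball_finite) (auto simp: cofinite_eq_sequentially[symmetric] eventually_cofinite)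
      then show ?thesis
      proof eventually_elim
        fix j assume "\<forall>n\<in>{..<n0 i}. s j \<notin> P n"
        moreover have "s j \<in> C \<or> (\<exists>n. s j \<in> P n)" using s by (auto simp: K_def)
        ultimately consider "s j \<in> C" | n where "s j \<in> P n" "n0 i \<le> n"
          by (metis lessThan_iff not_less)
        then show "osc_le T (s j) (w i) (\<delta> i) (tol i)"
          by cases (use osc in \<open>auto simp: C_def\<close>)
      qed
    qed
    obtain r y where r: "strict_mono r" "y \<in> cadlag_paths T" "field_bounded T A y"
      "\<And>i. osc_le T y (w i) (\<delta> i) (tol i)"
      and unif: "\<And>f e. f \<in> torus_smooth \<Longrightarrow> 0 < e \<Longrightarrow>
        eventually (\<lambda>j. \<forall>t\<in>{0..T}. \<bar>s (r j) t f - y t f\<bar> < e) sequentially"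
      using equicontinuous_limit[of s, OF Kbd[OF s] ev] by blast
    have "y \<in> K" using r by (simp add: K_def C_def)
    moreover have "eventually (\<lambda>j. s (r j) \<in> skorokhod_near T G d y) sequentially"
      if G: "finite G" "G \<subseteq> torus_smooth" "0 < d" for G d
    proof -
      have "eventually (\<lambda>j. \<forall>f\<in>G. \<forall>t\<in>{0..T}. \<bar>s (r j) t f - y t f\<bar> < d) sequentially"
        using G unif by (intro eventually_ball_finite) auto
      then show ?thesis
      proof eventually_elim
        fix j assume "\<forall>f\<in>G. \<forall>t\<in>{0..T}. \<bar>s (r j) t f - y t f\<bar> < d"
        then show "s (r j) \<in> skorokhod_near T G d y"
          unfolding skorokhod_near_def using s Kcad G(3) time_change_id
          by (intro CollectI conjI bexI[of _ "\<lambda>t. t"]) (auto simp: abs_minus_commute)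
      qed
    qed
    ultimately show ?thesis using r(1) by (intro exI[of _ r] exI[of _ y]) simp
  qed
  then have "compactin (skorokhod_topology T) K"
    by (intro compactin_skorokhodI[where F = "\<lambda>m. w ` {..m}" and e = "\<lambda>m. 1 / real (Suc m)"] Kcad near_base Kbd)
      (use w_smooth in auto)
  then show ?thesis by (rule that) (auto simp: K_def)
qed

end

section \<open>Tightness of a single field\<close>

text \<open>One parameter \<open>n\<close> bounds both the number of intervals from above and their
  lengths from below. The length bound prevents break points from merging in a limit.\<close>

definition partition :: "real \<Rightarrow> nat \<Rightarrow> nat \<Rightarrow> (nat \<Rightarrow> real) \<Rightarrow> bool" where
  "partition T n k \<tau> \<longleftrightarrow> k \<le> n \<and> \<tau> 0 = 0 \<and> \<tau> k = T \<and> (\<forall>i<k. \<tau> i + 1 / real (Suc n) \<le> \<tau> (Suc i))"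

text \<open>The intervals are half-open, so a jump at the final time is permitted; the value at
  \<open>T\<close> is tracked separately in limits.\<close>

definition step_path :: "real \<Rightarrow> nat \<Rightarrow> (real \<Rightarrow> 's) \<Rightarrow> bool" where
  "step_path T n \<xi> \<longleftrightarrow> (\<exists>k \<tau>. partition T n k \<tau> \<and>
    (\<forall>i<k. \<forall>t. \<tau> i \<le> t \<and> t < \<tau> (Suc i) \<longrightarrow> \<xi> t = \<xi> (\<tau> i)))"

lemma partition_less: "partition T n k \<tau> \<Longrightarrow> i < k \<Longrightarrow> \<tau> i < \<tau> (Suc i)"
proof -
  assume "partition T n k \<tau>" "i < k"
  then have "\<tau> i + 1 / real (Suc n) \<le> \<tau> (Suc i)" by (simp add: partition_def)
  moreover have "0 < 1 / real (Suc n)" by simp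
  ultimately show ?thesis by linarith
qed

lemma partition_mono:
  assumes "partition T n k \<tau>" "i \<le> j" "j \<le> k"
  shows "\<tau> i \<le> \<tau> j"
  using assms(2,3)
proof (induction j rule: dec_induct)
  case (step j)
  then show ?case using partition_less[OF assms(1), of j] by simp
qed simp

lemma partition_range:
  assumes "partition T n k \<tau>" "i \<le> k"
  shows "\<tau> i \<in> {0..T}"
  using partition_mono[OF assms(1), of 0 i] partition_mono[OF assms(1), of i k] assms
  by (auto simp: partition_def)

lemma find_right_interval:
  fixes \<tau> :: "nat \<Rightarrow> real"
  shows "\<tau> 0 \<le> t \<Longrightarrow> t < \<tau> k \<Longrightarrow> \<exists>i<k. \<tau> i \<le> t \<and> t < \<tau> (Suc i)"
proof (induction k)
  case (Suc k)
  then show ?case by (cases "t < \<tau> k") (use less_Suc_eq in \<open>auto simp: not_less\<close>)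
qed simp

lemma find_left_interval:
  fixes \<tau> :: "nat \<Rightarrow> real"
  shows "\<tau> 0 < t \<Longrightarrow> t \<le> \<tau> k \<Longrightarrow> \<exists>i<k. \<tau> i < t \<and> t \<le> \<tau> (Suc i)"
proof (induction k)
  case (Suc k)
  then show ?case by (cases "t \<le> \<tau> k") (use less_Suc_eq in \<open>auto simp: not_le\<close>)
qed simp

lemma step_path_mono:
  assumes "step_path T n \<xi>" "n \<le> n'"
  shows "step_path T n' \<xi>"
proof -
  obtain k \<tau> where k: "partition T n k \<tau>"
    "\<forall>i<k. \<forall>t. \<tau> i \<le> t \<and> t < \<tau> (Suc i) \<longrightarrow> \<xi> t = \<xi> (\<tau> i)"
    using assms(1) unfolding step_path_def by blast
  have "1 / real (Suc n') \<le> 1 / real (Suc n)" using assms(2) by (simp add: frac_le)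
  then have "partition T n' k \<tau>" using k(1) assms(2) unfolding partition_def by fastforce
  then show ?thesis using k(2) unfolding step_path_def by blast
qed

text \<open>Near each point the path is constant on either side, and partitions of adjacent
  intervals can be glued; Bolzano's bisection principle makes this global.\<close>

lemma step_path_exists:
  fixes \<xi> :: "real \<Rightarrow> 's"
  assumes T: "0 \<le> T"
    and right: "\<And>t. t \<in> {0..T} \<Longrightarrow> \<exists>d>0. \<forall>u. t < u \<and> u < t + d \<longrightarrow> \<xi> u = \<xi> t"
    and left: "\<And>t. t \<in> {0..T} \<Longrightarrow> \<exists>d>0. \<exists>l. \<forall>u. 0 \<le> u \<and> t - d < u \<and> u < t \<longrightarrow> \<xi> u = l"
  shows "\<exists>n. step_path T n \<xi>"
proof -
  define R where "R a b k \<tau> \<longleftrightarrow> \<tau> 0 = a \<and> \<tau> k = b \<and> (\<forall>i<k. \<tau> i < \<tau> (Suc i)) \<and>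
    (\<forall>i<k. \<forall>t. \<tau> i \<le> t \<longrightarrow> t < \<tau> (Suc i) \<longrightarrow> \<xi> t = \<xi> (\<tau> i))" for a b :: real and k :: nat and \<tau>
  define P where "P a b \<longleftrightarrow> (0 \<le> a \<and> a \<le> b \<and> b \<le> T \<longrightarrow> (\<exists>k \<tau>. R a b k \<tau>))" for a b
  have RD: "\<tau> 0 = a" "\<tau> k = b" "\<And>i. i < k \<Longrightarrow> \<tau> i < \<tau> (Suc i)"
      "\<And>i t. i < k \<Longrightarrow> \<tau> i \<le> t \<Longrightarrow> t < \<tau> (Suc i) \<Longrightarrow> \<xi> t = \<xi> (\<tau> i)" if "R a b k \<tau>" for a b k \<tau>
    using that unfolding R_def by blast+
  have glue: "P a c" if ab: "P a b" and bc: "P b c" and le: "a \<le> b" "b \<le> c" for a b c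
    unfolding P_def
  proof
    assume ac: "0 \<le> a \<and> a \<le> c \<and> c \<le> T"
    obtain k \<tau> where "R a b k \<tau>" using ab le ac unfolding P_def by auto
    note 1 = RD[OF this]
    obtain k' \<tau>' where "R b c k' \<tau>'" using bc le ac unfolding P_def by auto
    note 2 = RD[OF this]
    define \<sigma> where "\<sigma> i = (if i \<le> k then \<tau> i else \<tau>' (i - k))" for i
    have lo: "\<sigma> i = \<tau> i" "\<sigma> (Suc i) = \<tau> (Suc i)" if "i < k" for i using that by (auto simp: \<sigma>_def)
    have hi: "\<sigma> i = \<tau>' (i - k)" "\<sigma> (Suc i) = \<tau>' (Suc (i - k))" "i - k < k'" if "k \<le> i" "i < k + k'" for i
      using that 1(2) 2(1) by (auto simp: \<sigma>_def Suc_diff_le)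
    have "\<sigma> 0 = a" "\<sigma> (k + k') = c" using 1 2 by (auto simp: \<sigma>_def)
    moreover have "\<sigma> i < \<sigma> (Suc i)" if "i < k + k'" for i
      using that lo[of i] hi[of i] 1(3)[of i] 2(3)[of "i - k"] by (cases "i < k") auto
    moreover have "\<xi> t = \<xi> (\<sigma> i)" if "i < k + k'" "\<sigma> i \<le> t" "t < \<sigma> (Suc i)" for i t
      using that lo[of i] hi[of i] 1(4)[of i t] 2(4)[of "i - k" t] by (cases "i < k") auto
    ultimately have "R a c (k + k') \<sigma>" unfolding R_def by blast
    then show "\<exists>k \<tau>. R a c k \<tau>" by blast
  qed
  have single: "P a b" if "\<And>t. a \<le> t \<Longrightarrow> t < b \<Longrightarrow> 0 \<le> a \<Longrightarrow> \<xi> t = \<xi> a" for a b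
    unfolding P_def
  proof
    assume ab: "0 \<le> a \<and> a \<le> b \<and> b \<le> T"
    show "\<exists>k \<tau>. R a b k \<tau>"
    proof (cases "a = b")
      case True
      then have "R a b 0 (\<lambda>_. a)" by (simp add: R_def)
      then show ?thesis by blast
    next
      case False
      define \<tau> where "\<tau> i = (if i = 0 then a else b)" for i :: nat
      have "\<xi> t = \<xi> (\<tau> i)" if i: "i < 1" and t: "\<tau> i \<le> t" "t < \<tau> (Suc i)" for i t
      proof -
        have "\<tau> i = a" "\<tau> (Suc i) = b" using i by (auto simp: \<tau>_def)
        with t ab \<open>\<And>t. a \<le> t \<Longrightarrow> t < b \<Longrightarrow> 0 \<le> a \<Longrightarrow> \<xi> t = \<xi> a\<close>[of t] show ?thesis by metis
      qed
      moreover have "\<tau> 0 = a" "\<tau> 1 = b" "\<forall>i<1. \<tau> i < \<tau> (Suc i)" using ab False by (auto simp: \<tau>_def)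
      ultimately have "R a b 1 \<tau>" unfolding R_def by blast
      then show ?thesis by blast
    qed
  qed
  have "P 0 T"
    using T
  proof (induction rule: Bolzano)
    case (trans a b c)
    then show ?case by (rule glue)
  next
    case (local x)
    then have x: "x \<in> {0..T}" by simp
    obtain d1 where d1: "0 < d1" "\<And>u. x < u \<Longrightarrow> u < x + d1 \<Longrightarrow> \<xi> u = \<xi> x" using right[OF x] by blast
    obtain d2 l where d2: "0 < d2" "\<And>u. 0 \<le> u \<Longrightarrow> x - d2 < u \<Longrightarrow> u < x \<Longrightarrow> \<xi> u = l" using left[OF x] by blast
    show ?case
    proof (intro exI[of _ "min d1 d2"] conjI allI impI)
      fix a b assume ab: "a \<le> x \<and> x \<le> b \<and> b - a < min d1 d2"
      have "P a x"
      proof (rule single)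
        fix t assume t: "a \<le> t" "t < x" "0 \<le> a"
        then show "\<xi> t = \<xi> a" using d2(2)[of t] d2(2)[of a] ab by auto
      qed
      moreover have "P x b"
      proof (rule single)
        fix t assume t: "x \<le> t" "t < b"
        then show "\<xi> t = \<xi> x" using d1(2)[of t] ab by (cases "t = x") auto
      qed
      ultimately show "P a b" using glue ab by blast
    qed (use d1 d2 in auto)
  qed
  then obtain k \<tau> where "R 0 T k \<tau>" unfolding P_def using T by auto
  note k = RD[OF this]
  \<comment> \<open>The smallest gap; the extra element 1 covers the case of no interval.\<close>
  define g where "g = Min (insert 1 ((\<lambda>i. \<tau> (Suc i) - \<tau> i) ` {..<k}))"
  have g: "0 < g" "\<And>i. i < k \<Longrightarrow> g \<le> \<tau> (Suc i) - \<tau> i"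
    unfolding g_def using k(3) by (auto simp: Min_gr_iff)
  obtain n0 :: nat where n0: "1 / g < real n0" using reals_Archimedean2 by blast
  define n where "n = max k n0"
  have "1 / g < real (Suc n)" using n0 by (simp add: n_def max_def)
  then have "1 / real (Suc n) \<le> g" using g(1) by (simp add: field_simps)
  then have "partition T n k \<tau>"
    unfolding partition_def using k(1,2) g(2) by (force simp: n_def)
  then show ?thesis using k(4) unfolding step_path_def by blast
qed

lemma constant_subsequence:
  fixes f :: "nat \<Rightarrow> 'a"
  assumes "finite A" "\<And>j. f j \<in> A"
  shows "\<exists>r c. strict_mono (r :: nat \<Rightarrow> nat) \<and> (\<forall>j. f (r j) = c)"
proof -
  have "\<exists>c\<in>A. infinite {j \<in> UNIV. f j = c}"
    using assms by (intro pigeonhole_infinite_rel[of UNIV A "\<lambda>j c. f j = c"]) auto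
  then obtain c where c: "infinite {j. f j = c}" by auto
  have "f (enumerate {j. f j = c} j) = c" for j
    using enumerate_in_set[OF c, of j] by simp
  with strict_mono_enumerate[OF c] show ?thesis by blast
qed

text \<open>The number of intervals and the values on them form a code with finitely many
  possibilities, so the code is constant along a subsequence; then the bounded break points are made
  to converge.\<close>

lemma step_path_subsequence:
  fixes \<xi> :: "nat \<Rightarrow> real \<Rightarrow> 's"
  assumes step: "\<And>j. step_path T n (\<xi> j)" and E: "finite E" "\<And>j t. t \<in> {0..T} \<Longrightarrow> \<xi> j t \<in> E"
  shows "\<exists>r k \<sigma> \<tau> v. strict_mono (r :: nat \<Rightarrow> nat) \<and> (\<forall>j::nat. partition T n k (\<sigma> j)) \<and> partition T n k \<tau> \<and>
    (\<forall>j i t. i < k \<longrightarrow> \<sigma> j i \<le> t \<longrightarrow> t < \<sigma> j (Suc i) \<longrightarrow> \<xi> (r j) t = v i) \<and>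
    (\<forall>j. \<xi> (r j) T = v k) \<and> (\<forall>i\<le>k. (\<lambda>j. \<sigma> j i) \<longlonglongrightarrow> \<tau> i)"
proof -
  obtain kk ss where ks: "\<And>j. partition T n (kk j) (ss j)"
    "\<And>j i t. i < kk j \<Longrightarrow> ss j i \<le> t \<Longrightarrow> t < ss j (Suc i) \<Longrightarrow> \<xi> j t = \<xi> j (ss j i)"
    using step unfolding step_path_def by metis
  obtain e0 where e0: "e0 \<in> E"
  proof -
    have "T \<in> {0..T}" using partition_range[OF ks(1)[of 0], of "kk 0"] ks(1)[of 0] by (simp add: partition_def)
    then show ?thesis using E(2) that by blast
  qed
  \<comment> \<open>Padding with \<open>e0\<close> beyond the last interval gives all codes the same
    finite range.\<close>
  define c where "c j = (kk j, \<lambda>i\<in>{..n}. if i \<le> kk j then \<xi> j (ss j i) else e0)" for j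
  have cE: "c j \<in> {..n} \<times> ({..n} \<rightarrow>\<^sub>E E)" for j
    using ks(1)[of j] partition_range[OF ks(1)[of j]] E(2) e0 by (auto simp: c_def partition_def)
  have "finite ({..n} \<times> ({..n} \<rightarrow>\<^sub>E E))" using E(1) by (simp add: finite_PiE)
  from constant_subsequence[of _ c, OF this cE] obtain r1 :: "nat \<Rightarrow> nat" and c0
    where r1: "strict_mono r1" "\<forall>j. c (r1 j) = c0" by blast
  define k v where "k = fst c0" and "v = snd c0"
  have kk: "kk (r1 j) = k" for j using r1(2)[rule_format, of j] by (auto simp: c_def k_def)
  have kn: "k \<le> n" using ks(1)[of "r1 0"] by (simp add: kk partition_def)
  have vv: "\<xi> (r1 j) (ss (r1 j) i) = v i" if "i \<le> k" for i j
  proof -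
    have "v = (\<lambda>i\<in>{..n}. if i \<le> kk (r1 j) then \<xi> (r1 j) (ss (r1 j) i) else e0)"
      using r1(2)[rule_format, of j] by (auto simp: c_def v_def)
    then show ?thesis using that kn by (simp add: kk)
  qed
  define \<Phi> where "\<Phi> j i = (if i \<le> k then ss (r1 j) i else 0)" for j i
  have "\<exists>C. \<forall>j. \<bar>\<Phi> j i\<bar> \<le> C" for i
  proof (intro exI[of _ "\<bar>T\<bar>"] allI)
    fix j show "\<bar>\<Phi> j i\<bar> \<le> \<bar>T\<bar>"
      using partition_range[OF ks(1)[of "r1 j"], of i] by (auto simp: \<Phi>_def kk)
  qed
  then obtain r2 where r2: "strict_mono r2" "\<And>i. convergent (\<lambda>j. \<Phi> (r2 j) i)"
    using diagonal_bounded[of \<Phi>] by auto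
  define \<sigma> where "\<sigma> j = ss (r1 (r2 j))" for j
  define \<tau> where "\<tau> i = lim (\<lambda>j. \<Phi> (r2 j) i)" for i
  have lim: "(\<lambda>j. \<sigma> j i) \<longlonglongrightarrow> \<tau> i" if "i \<le> k" for i
    using r2(2)[of i] that by (simp add: convergent_LIMSEQ_iff \<tau>_def \<Phi>_def \<sigma>_def)
  have part: "partition T n k (\<sigma> j)" for j
    using ks(1)[of "r1 (r2 j)"] by (simp add: kk \<sigma>_def)
  have "\<tau> 0 = 0" "\<tau> k = T"
    using lim[of 0] lim[of k] part by (simp_all add: partition_def LIMSEQ_const_iff)
  moreover have "\<tau> i + 1 / real (Suc n) \<le> \<tau> (Suc i)" if "i < k" for i
    by (rule LIMSEQ_le[OF tendsto_add[OF lim tendsto_const] lim]) (use that part in \<open>auto simp: partition_def\<close>)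
  ultimately have part\<tau>: "partition T n k \<tau>" using kn by (simp add: partition_def)
  have "strict_mono (\<lambda>j. r1 (r2 j))" using r1(1) r2(1) by (simp add: strict_mono_def)
  moreover have "\<xi> (r1 (r2 j)) t = v i" if "i < k" "\<sigma> j i \<le> t" "t < \<sigma> j (Suc i)" for i j t
    using ks(2)[of i "r1 (r2 j)" t] vv[of i "r2 j"] that by (simp add: kk \<sigma>_def)
  moreover have "\<xi> (r1 (r2 j)) T = v k" for j
    using vv[of k "r2 j"] part[of j] by (simp add: partition_def \<sigma>_def)
  ultimately show ?thesis
    using part part\<tau> lim
    by (intro exI[of _ "\<lambda>j. r1 (r2 j)"] exI[of _ k] exI[of _ \<sigma>] exI[of _ \<tau>] exI[of _ v] conjI allI impI) blast+
qed

text \<open>Linear interpolation between matching break points: the displacement inside an interval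
  is a convex combination of those at its ends. The map is extended one interval at a time.\<close>

lemma piecewise_linear_time_change:
  assumes \<sigma>: "partition T n k \<sigma>" and \<tau>: "partition T n k \<tau>"
    and d: "\<And>i. i \<le> k \<Longrightarrow> \<bar>\<tau> i - \<sigma> i\<bar> \<le> d"
  shows "\<exists>\<gamma>\<in>time_changes T. (\<forall>i\<le>k. \<gamma> (\<sigma> i) = \<tau> i) \<and> (\<forall>t\<in>{0..T}. \<bar>\<gamma> t - t\<bar> \<le> d)"
proof -
  define Q where "Q l \<gamma> \<longleftrightarrow> (\<forall>s t. \<sigma> 0 \<le> s \<longrightarrow> s < t \<longrightarrow> t \<le> \<sigma> l \<longrightarrow> \<gamma> s < \<gamma> t) \<and> (\<forall>i\<le>l. \<gamma> (\<sigma> i) = \<tau> i) \<and>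
      (\<forall>y. \<tau> 0 \<le> y \<longrightarrow> y \<le> \<tau> l \<longrightarrow> (\<exists>t. \<sigma> 0 \<le> t \<and> t \<le> \<sigma> l \<and> \<gamma> t = y)) \<and>
      (\<forall>t. \<sigma> 0 \<le> t \<longrightarrow> t \<le> \<sigma> l \<longrightarrow> \<bar>\<gamma> t - t\<bar> \<le> d)" for l \<gamma>
  have QD: "\<sigma> 0 \<le> s \<Longrightarrow> s < t \<Longrightarrow> t \<le> \<sigma> l \<Longrightarrow> \<gamma> s < \<gamma> t" "i \<le> l \<Longrightarrow> \<gamma> (\<sigma> i) = \<tau> i"
      "\<tau> 0 \<le> y \<Longrightarrow> y \<le> \<tau> l \<Longrightarrow> \<exists>t. \<sigma> 0 \<le> t \<and> t \<le> \<sigma> l \<and> \<gamma> t = y"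
      "\<sigma> 0 \<le> t \<Longrightarrow> t \<le> \<sigma> l \<Longrightarrow> \<bar>\<gamma> t - t\<bar> \<le> d" if "Q l \<gamma>" for l \<gamma> s t i y
    using that unfolding Q_def by blast+
  have "\<exists>\<gamma>. Q l \<gamma>" if "l \<le> k" for l
    using that
  proof (induction l)
    case 0
    then show ?case using d[of 0] unfolding Q_def by (intro exI[of _ "\<lambda>_. \<tau> 0"]) auto
  next
    case (Suc l)
    then obtain \<gamma> where "Q l \<gamma>" by auto
    note g = QD[OF this]
    have s: "\<sigma> 0 \<le> \<sigma> l" "\<sigma> l < \<sigma> (Suc l)" and t: "\<tau> l < \<tau> (Suc l)"
      using partition_mono[OF \<sigma>, of 0 l] partition_less[OF \<sigma>, of l] partition_less[OF \<tau>, of l] Suc.prems by auto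
    define \<Delta> where "\<Delta> = \<sigma> (Suc l) - \<sigma> l"
    define \<Theta> where "\<Theta> = \<tau> (Suc l) - \<tau> l"
    have pos: "0 < \<Delta>" "0 < \<Theta>" using s t by (auto simp: \<Delta>_def \<Theta>_def)
    define h where "h u = (if u \<le> \<sigma> l then \<gamma> u else \<tau> l + (u - \<sigma> l) * (\<Theta> / \<Delta>))" for u
    have gl: "\<gamma> u \<le> \<tau> l" if "\<sigma> 0 \<le> u" "u \<le> \<sigma> l" for u
      using g(1)[of u "\<sigma> l"] g(2)[of l] that by (cases "u = \<sigma> l") auto
    have lin_pos: "0 < (u - \<sigma> l) * (\<Theta> / \<Delta>)" if "\<sigma> l < u" for u using that pos by simp
    have "h s < h t" if "\<sigma> 0 \<le> s" "s < t" "t \<le> \<sigma> (Suc l)" for s t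
    proof -
      consider "t \<le> \<sigma> l" | "s \<le> \<sigma> l" "\<sigma> l < t" | "\<sigma> l < s" by linarith
      then show ?thesis
      proof cases
        case 1 then show ?thesis using g(1) that by (simp add: h_def)
      next
        case 2 then show ?thesis using gl[of s] lin_pos[of t] that by (simp add: h_def)
      next
        case 3 then show ?thesis using that pos by (simp add: h_def divide_strict_right_mono)
      qed
    qed
    moreover have "h (\<sigma> i) = \<tau> i" if "i \<le> Suc l" for i
    proof (cases "i = Suc l")
      case True
      then show ?thesis using s pos by (simp add: h_def \<Delta>_def[symmetric] \<Theta>_def)
    next
      case False
      then show ?thesis using that g(2)[of i] partition_mono[OF \<sigma>, of i l] Suc.prems by (auto simp: h_def)
    qed
    moreover have "\<exists>t. \<sigma> 0 \<le> t \<and> t \<le> \<sigma> (Suc l) \<and> h t = y" if "\<tau> 0 \<le> y" "y \<le> \<tau> (Suc l)" for y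
    proof (cases "y \<le> \<tau> l")
      case True
      then obtain t where "\<sigma> 0 \<le> t" "t \<le> \<sigma> l" "\<gamma> t = y" using g(3) \<open>\<tau> 0 \<le> y\<close> by blast
      then show ?thesis using s by (intro exI[of _ t]) (auto simp: h_def)
    next
      case False
      define t where "t = \<sigma> l + (y - \<tau> l) * (\<Delta> / \<Theta>)"
      have "0 < (y - \<tau> l) * (\<Delta> / \<Theta>)" using False pos by simp
      moreover have "(y - \<tau> l) * (\<Delta> / \<Theta>) \<le> \<Theta> * (\<Delta> / \<Theta>)"
        using that pos by (intro mult_right_mono) (auto simp: \<Theta>_def)
      moreover have "h t = y" if "\<sigma> l < t" using that pos by (simp add: h_def t_def)
      ultimately show ?thesis using s pos by (intro exI[of _ t]) (auto simp: t_def \<Delta>_def)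
    qed
    moreover have "\<bar>h t - t\<bar> \<le> d" if "\<sigma> 0 \<le> t" "t \<le> \<sigma> (Suc l)" for t
    proof (cases "t \<le> \<sigma> l")
      case True
      then show ?thesis using g(4) that by (simp add: h_def)
    next
      case False
      define \<rho> where "\<rho> = (t - \<sigma> l) / \<Delta>"
      have "t - \<sigma> l \<le> \<Delta>" using that by (simp add: \<Delta>_def)
      then have l: "0 \<le> \<rho>" "\<rho> \<le> 1" using False pos by (simp_all add: \<rho>_def)
      have "t = \<sigma> l + \<rho> * \<Delta>" using pos by (simp add: \<rho>_def)
      moreover have "h t = \<tau> l + \<rho> * \<Theta>" using False by (simp add: h_def \<rho>_def)
      ultimately have "h t - t = (1 - \<rho>) * (\<tau> l - \<sigma> l) + \<rho> * (\<tau> (Suc l) - \<sigma> (Suc l))"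
        by (simp add: \<Delta>_def \<Theta>_def algebra_simps)
      also have "\<bar>\<dots>\<bar> \<le> (1 - \<rho>) * \<bar>\<tau> l - \<sigma> l\<bar> + \<rho> * \<bar>\<tau> (Suc l) - \<sigma> (Suc l)\<bar>"
        using l by (intro order_trans[OF abs_triangle_ineq]) (simp add: abs_mult)
      also have "\<dots> \<le> (1 - \<rho>) * d + \<rho> * d"
        using d Suc.prems l by (intro add_mono mult_left_mono) auto
      finally show ?thesis by (simp add: algebra_simps)
    qed
    ultimately have "Q (Suc l) h" unfolding Q_def by blast
    then show ?case by blast
  qed
  from this[of k] obtain \<gamma> where "Q k \<gamma>" by auto
  note g = QD[OF this]
  have ends: "\<sigma> 0 = 0" "\<sigma> k = T" "\<tau> 0 = 0" "\<tau> k = T" using \<sigma> \<tau> by (auto simp: partition_def)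
  have mono: "strict_mono_on {0..T} \<gamma>" using g(1) ends by (auto simp: strict_mono_on_def)
  have T: "0 \<le> T" using partition_range[OF \<sigma>, of k] ends by simp
  have e0: "\<gamma> 0 = 0" "\<gamma> T = T" using g(2)[of 0] g(2)[of k] ends by auto
  have "\<gamma> ` {0..T} = {0..T}"
  proof
    show "\<gamma> ` {0..T} \<subseteq> {0..T}"
      using strict_mono_on_leD[OF mono, of 0] strict_mono_on_leD[OF mono, of _ T] T e0 by fastforce
    show "{0..T} \<subseteq> \<gamma> ` {0..T}" using g(3) ends by force
  qed
  then have "\<gamma> \<in> time_changes T" using mono by (simp add: time_changes_def)
  then show ?thesis using g(2,4) ends by (intro bexI[of _ \<gamma>]) auto
qed

lemma time_change_interval:
  assumes \<gamma>: "\<gamma> \<in> time_changes T" and \<sigma>: "partition T n k \<sigma>" and g: "\<And>i. i \<le> k \<Longrightarrow> \<gamma> (\<sigma> i) = \<tau> i"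
    and i: "i < k" "\<sigma> i \<le> t" "t < \<sigma> (Suc i)"
  shows "\<tau> i \<le> \<gamma> t" "\<gamma> t < \<tau> (Suc i)"
proof -
  have mono: "strict_mono_on {0..T} \<gamma>" using \<gamma> by (simp add: time_changes_def)
  have r: "\<sigma> i \<in> {0..T}" "\<sigma> (Suc i) \<in> {0..T}" using partition_range[OF \<sigma>] i by auto
  then have t: "t \<in> {0..T}" using i by auto
  show "\<tau> i \<le> \<gamma> t" using strict_mono_on_leD[OF mono r(1) t i(2)] g i by simp
  show "\<gamma> t < \<tau> (Suc i)" using strict_mono_onD[OF mono t r(2) i(3)] g i by simp
qed

section \<open>Fields driven by step configurations\<close>

context exclusion_process
begin

definition conf_field :: "real \<Rightarrow> (nat \<Rightarrow> real) \<Rightarrow> (real \<Rightarrow> real) \<Rightarrow> real" where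
  "conf_field a z = (\<lambda>f\<in>torus_smooth. 1 / a * (\<Sum>x<N. z x * f (real x / real N)))"

definition field :: "real \<Rightarrow> real \<Rightarrow> (real \<Rightarrow> nat \<Rightarrow> nat) \<Rightarrow> real \<Rightarrow> (real \<Rightarrow> real) \<Rightarrow> real" where
  "field T a \<xi> = (\<lambda>t\<in>{0..T}. conf_field a (\<lambda>x. real (\<xi> t x) - m t x))"

lemma density_field_eq: "density_field T N a M X \<omega> = field T a (\<lambda>t. X t \<omega>)"
  by (simp add: density_field_def field_def conf_field_def m_def)

lemma conf_field_distribution: "conf_field a z \<in> torus_distributions"
proof (rule torus_distributionsI[where A = "\<bar>1 / a\<bar> * (\<Sum>x<N. \<bar>z x\<bar>)"])
  show "conf_field a z \<in> extensional torus_smooth" by (simp add: conf_field_def)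
  fix f g assume f: "f \<in> torus_smooth" and g: "g \<in> torus_smooth"
  have fg: "(\<lambda>x. f x + g x) \<in> torus_smooth" using smooth_add_cmult(2)[OF f g, of 1] by simp
  show "conf_field a z (\<lambda>x. f x + g x) = conf_field a z f + conf_field a z g"
    using f g fg by (simp add: conf_field_def algebra_simps sum.distrib add_divide_distrib)
next
  fix c f assume f: "f \<in> torus_smooth"
  have cf: "(\<lambda>x. c * f x) \<in> torus_smooth" using smooth_cmult[OF f] .
  show "conf_field a z (\<lambda>x. c * f x) = c * conf_field a z f"
    using f cf by (simp add: conf_field_def sum_distrib_left mult_ac)
next
  fix f B assume f: "f \<in> torus_smooth" "c2_bounded B f"
  have "\<bar>\<Sum>x<N. z x * f (real x / real N)\<bar> \<le> (\<Sum>x<N. \<bar>z x * f (real x / real N)\<bar>)"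
    by (rule sum_abs)
  also have "\<dots> \<le> (\<Sum>x<N. \<bar>z x\<bar> * B)"
    unfolding abs_mult using f(2) by (intro sum_mono mult_left_mono) (auto simp: c2_bounded_def)
  finally have "\<bar>1 / a\<bar> * \<bar>\<Sum>x<N. z x * f (real x / real N)\<bar> \<le> \<bar>1 / a\<bar> * ((\<Sum>x<N. \<bar>z x\<bar>) * B)"
    by (intro mult_left_mono) (auto simp: sum_distrib_right)
  then show "\<bar>conf_field a z f\<bar> \<le> \<bar>1 / a\<bar> * (\<Sum>x<N. \<bar>z x\<bar>) * B"
    using f(1) by (simp add: conf_field_def abs_mult)
qed

lemma conf_field_tendsto:
  assumes "\<And>x. x < N \<Longrightarrow> ((\<lambda>u. z u x) \<longlongrightarrow> y x) F" "f \<in> torus_smooth"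
  shows "((\<lambda>u. conf_field a (z u) f) \<longlongrightarrow> conf_field a y f) F"
  using assms unfolding conf_field_def by (simp only: restrict_apply' if_True) (intro tendsto_intros; simp)

lemma m_tendsto: "x < N \<Longrightarrow> 0 \<le> t \<Longrightarrow> ((\<lambda>u. m u x) \<longlongrightarrow> m t x) (at t within {0..T} \<inter> S)"
  using m_continuous[of x] by (auto simp: continuous_on_def intro: tendsto_within_subset)

text \<open>On either side of a time the configuration is locally constant and the mean is
  continuous, so both one-sided limits are again fields of a configuration.\<close>

lemma step_field_cadlag:
  assumes step: "step_path T n \<xi>"
  shows "field T a \<xi> \<in> cadlag_paths T"
proof (rule cadlag_pathsI)
  obtain k \<tau> where part: "partition T n k \<tau>"
    and const: "\<And>i t. i < k \<Longrightarrow> \<tau> i \<le> t \<Longrightarrow> t < \<tau> (Suc i) \<Longrightarrow> \<xi> t = \<xi> (\<tau> i)"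
    using step unfolding step_path_def by metis
  have ends: "\<tau> 0 = 0" "\<tau> k = T" using part by (auto simp: partition_def)
  show "field T a \<xi> \<in> extensional {0..T}" by (simp add: field_def)
  have lim: "((\<lambda>u. field T a \<xi> u f) \<longlongrightarrow> conf_field a (\<lambda>x. real (v x) - m t x) f) (at t within {0..T} \<inter> S)"
    if t: "t \<in> {0..T}" and f: "f \<in> torus_smooth"
      and ev: "eventually (\<lambda>u. \<xi> u = v) (at t within {0..T} \<inter> S)" for t f v S
  proof -
    have 1: "((\<lambda>u. conf_field a (\<lambda>x. real (v x) - m u x) f) \<longlongrightarrow> conf_field a (\<lambda>x. real (v x) - m t x) f)
        (at t within {0..T} \<inter> S)"
      using t f by (intro conf_field_tendsto tendsto_intros m_tendsto) auto
    have "eventually (\<lambda>u. u \<in> {0..T}) (at t within {0..T} \<inter> S)"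
      by (auto simp: eventually_at_filter)
    then have "eventually (\<lambda>u. conf_field a (\<lambda>x. real (v x) - m u x) f = field T a \<xi> u f) (at t within {0..T} \<inter> S)"
      using ev by eventually_elim (simp add: field_def)
    with 1 show ?thesis by (rule Lim_transform_eventually)
  qed
  fix t assume t: "t \<in> {0..T}"
  show "field T a \<xi> t \<in> torus_distributions" using t conf_field_distribution by (simp add: field_def)
  show "((\<lambda>u. field T a \<xi> u f) \<longlongrightarrow> field T a \<xi> t f) (at t within {0..T} \<inter> {t<..})" if f: "f \<in> torus_smooth" for f
  proof -
    have "eventually (\<lambda>u. \<xi> u = \<xi> t) (at t within {0..T} \<inter> {t<..})"
    proof (cases "t = T")
      case False
      then obtain i where i: "i < k" "\<tau> i \<le> t" "t < \<tau> (Suc i)"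
        using find_right_interval[of \<tau> t k] t ends by auto
      have "\<xi> u = \<xi> t" if "t < u" "dist u t < \<tau> (Suc i) - t" for u
      proof -
        have "u < \<tau> (Suc i)" using that by (simp add: dist_real_def)
        then show ?thesis using const[of i u] const[of i t] i that by simp
      qed
      then show ?thesis
        unfolding eventually_at using i by (intro exI[of _ "\<tau> (Suc i) - t"]) auto
    qed (auto simp: eventually_at_filter intro!: always_eventually)
    from lim[OF t f this] show ?thesis using t by (simp add: field_def)
  qed
  show "\<exists>l\<in>torus_distributions. \<forall>f\<in>torus_smooth. ((\<lambda>u. field T a \<xi> u f) \<longlongrightarrow> l f) (at t within {0..T} \<inter> {..<t})"
  proof -
    have "\<exists>v. eventually (\<lambda>u. \<xi> u = v) (at t within {0..T} \<inter> {..<t})"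
    proof (cases "t = 0")
      case False
      then obtain i where i: "i < k" "\<tau> i < t" "t \<le> \<tau> (Suc i)"
        using find_left_interval[of \<tau> t k] t ends by auto
      have "\<xi> u = \<xi> (\<tau> i)" if "u < t" "dist u t < t - \<tau> i" for u
        using const[of i u] i that by (simp add: dist_real_def)
      then have "eventually (\<lambda>u. \<xi> u = \<xi> (\<tau> i)) (at t within {0..T} \<inter> {..<t})"
        unfolding eventually_at using i by (intro exI[of _ "t - \<tau> i"]) auto
      then show ?thesis by blast
    qed (auto simp: eventually_at_filter intro!: always_eventually)
    then obtain v where "eventually (\<lambda>u. \<xi> u = v) (at t within {0..T} \<inter> {..<t})" by blast
    from lim[OF t _ this] show ?thesis using conf_field_distribution by blast
  qed
qed

lemma mean_field_uniformly_continuous: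
  assumes G: "finite G" "G \<subseteq> torus_smooth" "0 < (d::real)"
  shows "\<exists>\<delta>>0. \<forall>s\<in>{0..T}. \<forall>t\<in>{0..T}. \<bar>s - t\<bar> < \<delta> \<longrightarrow> (\<forall>f\<in>G. \<bar>conf_field a (m s) f - conf_field a (m t) f\<bar> < d)"
proof -
  have "\<exists>\<delta>>0. \<forall>s\<in>{0..T}. \<forall>t\<in>{0..T}. \<bar>s - t\<bar> < \<delta> \<longrightarrow> \<bar>conf_field a (m s) f - conf_field a (m t) f\<bar> < d"
    if f: "f \<in> G" for f
  proof -
    have "continuous_on {0..T} (\<lambda>s. conf_field a (m s) f)"
      unfolding continuous_on_def
      using f G m_tendsto[of _ _ T UNIV] by (intro ballI conf_field_tendsto) auto
    then have "uniformly_continuous_on {0..T} (\<lambda>s. conf_field a (m s) f)"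
      by (intro compact_uniformly_continuous) auto
    then show ?thesis
      using G(3) unfolding uniformly_continuous_on_def dist_real_def by (metis abs_minus_commute)
  qed
  then obtain \<delta> where \<delta>: "\<And>f. f \<in> G \<Longrightarrow> 0 < \<delta> f" "\<And>f s t. f \<in> G \<Longrightarrow> s \<in> {0..T} \<Longrightarrow> t \<in> {0..T} \<Longrightarrow>
      \<bar>s - t\<bar> < \<delta> f \<Longrightarrow> \<bar>conf_field a (m s) f - conf_field a (m t) f\<bar> < d"
    by metis
  define \<delta>0 where "\<delta>0 = Min (insert 1 (\<delta> ` G))"
  have "0 < \<delta>0" "\<And>f. f \<in> G \<Longrightarrow> \<delta>0 \<le> \<delta> f" using G(1) \<delta>(1) by (auto simp: \<delta>0_def)
  then show ?thesis using \<delta>(2) by (intro exI[of _ \<delta>0]) fastforce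
qed

text \<open>After matching break points by a time change the configurations coincide exactly. What
  remains is the mean evaluated at two nearby times, which is small by uniform continuity.\<close>

lemma step_fields_seq_compact:
  assumes T: "0 < T"
    and step: "\<And>j. step_path T n (\<xi> j)" and E: "\<And>j t. t \<in> {0..T} \<Longrightarrow> \<xi> j t \<in> E"
  shows "\<exists>r \<xi>'. strict_mono (r :: nat \<Rightarrow> nat) \<and> step_path T n \<xi>' \<and> (\<forall>t\<in>{0..T}. \<xi>' t \<in> E) \<and>
    skorokhod_converges T (\<lambda>j. field T a (\<xi> (r j))) (field T a \<xi>')"
proof -
  obtain r k \<sigma> \<tau> v where r: "strict_mono (r :: nat \<Rightarrow> nat)" and part0: "\<forall>j::nat. partition T n k (\<sigma> j)"
    and part': "partition T n k \<tau>"
    and v0: "\<forall>j i t. i < k \<longrightarrow> \<sigma> j i \<le> t \<longrightarrow> t < \<sigma> j (Suc i) \<longrightarrow> \<xi> (r j) t = v i"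
    and vk0: "\<forall>j. \<xi> (r j) T = v k" and lim0: "\<forall>i\<le>k. (\<lambda>j. \<sigma> j i) \<longlonglongrightarrow> \<tau> i"
    using step_path_subsequence[of T n \<xi>, OF step finite_states E] by blast
  note part = part0[rule_format] and v = v0[rule_format] and vk = vk0[rule_format] and lim = lim0[rule_format]
  have ends: "\<tau> 0 = 0" "\<tau> k = T" "\<sigma> j 0 = 0" "\<sigma> j k = T" for j
    using part[of j] part' by (auto simp: partition_def)
  have "\<bar>\<sigma> 0 i - \<tau> i\<bar> \<le> T" if "i \<le> k" for i
    using partition_range[OF part that, of 0] partition_range[OF part' that] by auto
  then obtain \<gamma>0 where g0: "\<gamma>0 \<in> time_changes T" "\<And>i. i \<le> k \<Longrightarrow> \<gamma>0 (\<tau> i) = \<sigma> 0 i"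
    using piecewise_linear_time_change[OF part' part[of 0], of T] by blast
  \<comment> \<open>The limit path is the first path of the subsequence carried over to the limiting
    break points; the bound \<open>T\<close> on the displacement is the trivial one.\<close>
  define \<xi>' where "\<xi>' t = \<xi> (r 0) (\<gamma>0 t)" for t
  have v': "\<xi>' t = v i" if "i < k" "\<tau> i \<le> t" "t < \<tau> (Suc i)" for i t
    using time_change_interval[OF g0(1) part' g0(2) that] v[OF that(1)] by (simp add: \<xi>'_def)
  have vk': "\<xi>' T = v k" using g0(2)[of k] vk[of 0] by (simp add: \<xi>'_def ends)
  have step': "step_path T n \<xi>'"
    unfolding step_path_def
  proof (intro exI[of _ k] exI[of _ \<tau>] conjI part' allI impI)
    fix i t assume "i < k" "\<tau> i \<le> t \<and> t < \<tau> (Suc i)"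
    then show "\<xi>' t = \<xi>' (\<tau> i)" using v'[of i t] v'[of i "\<tau> i"] partition_less[OF part'] by simp
  qed
  have E': "\<forall>t\<in>{0..T}. \<xi>' t \<in> E"
    using E time_change_range[OF g0(1)] by (simp add: \<xi>'_def)
  have "eventually (\<lambda>j. field T a (\<xi> (r j)) \<in> skorokhod_near T G d (field T a \<xi>')) sequentially"
    if G: "finite G" "G \<subseteq> torus_smooth" "0 < d" for G d
  proof -
    obtain \<delta> where \<delta>: "0 < \<delta>" "\<And>s t f. s \<in> {0..T} \<Longrightarrow> t \<in> {0..T} \<Longrightarrow> \<bar>s - t\<bar> < \<delta> \<Longrightarrow> f \<in> G \<Longrightarrow>
        \<bar>conf_field a (m s) f - conf_field a (m t) f\<bar> < d"
      using mean_field_uniformly_continuous[OF G, of T a] by auto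
    define c where "c = min \<delta> d / 2"
    have c: "0 < c" "c < \<delta>" "c < d" using \<delta> G by (auto simp: c_def)
    have "eventually (\<lambda>j. \<forall>i\<in>{..k}. \<bar>\<tau> i - \<sigma> j i\<bar> \<le> c) sequentially"
    proof (intro eventually_ball_finite ballI)
      fix i assume "i \<in> {..k}"
      then have "eventually (\<lambda>j. dist (\<sigma> j i) (\<tau> i) < c) sequentially"
        using tendstoD[OF lim c(1)] by simp
      then show "eventually (\<lambda>j. \<bar>\<tau> i - \<sigma> j i\<bar> \<le> c) sequentially"
        by eventually_elim (simp add: dist_real_def)
    qed simp
    then show ?thesis
    proof eventually_elim
      fix j assume j: "\<forall>i\<in>{..k}. \<bar>\<tau> i - \<sigma> j i\<bar> \<le> c"
      then obtain \<gamma> where g: "\<gamma> \<in> time_changes T" "\<And>i. i \<le> k \<Longrightarrow> \<gamma> (\<sigma> j i) = \<tau> i"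
          "\<And>t. t \<in> {0..T} \<Longrightarrow> \<bar>\<gamma> t - t\<bar> \<le> c"
        using piecewise_linear_time_change[OF part[of j] part', of c] by fastforce
      have eq: "\<xi>' (\<gamma> t) = \<xi> (r j) t" if t: "t \<in> {0..T}" for t
      proof (cases "t = T")
        case True
        then show ?thesis using g(2)[of k] vk vk' by (simp add: ends)
      next
        case False
        then obtain i where i: "i < k" "\<sigma> j i \<le> t" "t < \<sigma> j (Suc i)"
          using find_right_interval[of "\<sigma> j" t k] t by (auto simp: ends)
        show ?thesis
          using v[OF i] v'[OF i(1) time_change_interval[OF g(1) part g(2) i]] by simp
      qed
      have "\<bar>\<gamma> t - t\<bar> < d \<and> (\<forall>f\<in>G. \<bar>field T a \<xi>' (\<gamma> t) f - field T a (\<xi> (r j)) t f\<bar> < d)" if t: "t \<in> {0..T}" for t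
      proof (intro conjI ballI)
        show "\<bar>\<gamma> t - t\<bar> < d" using g(3)[OF t] c by linarith
        fix f assume f: "f \<in> G"
        have gt: "\<gamma> t \<in> {0..T}" using time_change_range[OF g(1) t] .
        have fs: "f \<in> torus_smooth" using f G by blast
        have "field T a \<xi>' (\<gamma> t) f - field T a (\<xi> (r j)) t f = conf_field a (m t) f - conf_field a (m (\<gamma> t)) f"
          using gt t fs eq[OF t] by (simp add: field_def conf_field_def algebra_simps sum_subtractf)
        moreover have "\<bar>t - \<gamma> t\<bar> < \<delta>" using g(3)[OF t] c by linarith
        ultimately show "\<bar>field T a \<xi>' (\<gamma> t) f - field T a (\<xi> (r j)) t f\<bar> < d"
          using \<delta>(2)[OF t gt _ f] by simp
      qed
      then show "field T a (\<xi> (r j)) \<in> skorokhod_near T G d (field T a \<xi>')"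
        unfolding skorokhod_near_def using g(1) step_field_cadlag[OF step] by blast
    qed
  qed
  then show ?thesis using r step' E' by blast
qed

text \<open>Enumerates a countable dense set of times, so that a property of the whole path can be
  expressed by countably many events.\<close>

definition sample :: "real \<Rightarrow> nat \<Rightarrow> real" where
  "sample T l = (if l = 0 then T else max 0 (min T (real_of_rat (from_nat (l - 1)))))"

lemma sample_range: "0 < T \<Longrightarrow> sample T l \<in> {0..T}"
  by (auto simp: sample_def)

lemma sample_dense:
  assumes "0 \<le> s" "s < b" "b \<le> T"
  shows "\<exists>l. s < sample T l \<and> sample T l < b"
proof -
  obtain q where q: "s < real_of_rat q" "real_of_rat q < b" using of_rat_dense[OF assms(2)] by blast
  then have "sample T (Suc (to_nat q)) = real_of_rat q" using assms by (simp add: sample_def)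
  with q show ?thesis by metis
qed

lemma X_step_path:
  assumes T: "0 < T" and \<omega>: "\<omega> \<in> space M"
  shows "\<exists>n. step_path T n (\<lambda>t. X t \<omega>)"
proof (rule step_path_exists)
  fix t assume t: "t \<in> {0..T}"
  have "eventually (\<lambda>u. X u \<omega> = X t \<omega>) (at_right t)"
    using X_right_continuous[OF \<omega>] t by simp
  then obtain b where b: "t < b" "\<And>u. t < u \<Longrightarrow> u < b \<Longrightarrow> X u \<omega> = X t \<omega>"
    unfolding eventually_at_right_field by blast
  then show "\<exists>d>0. \<forall>u. t < u \<and> u < t + d \<longrightarrow> X u \<omega> = X t \<omega>"
    by (intro exI[of _ "b - t"]) auto
  obtain l where "limitin (discrete_topology E) (\<lambda>t. X t \<omega>) l (at t within {0..} \<inter> {..<t})"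
    using cadlag[OF \<omega>] t unfolding cadlag_on_def by auto
  then have "l \<in> E" "eventually (\<lambda>u. X u \<omega> \<in> {l}) (at t within {0..} \<inter> {..<t})"
    unfolding limitin_def by auto
  then obtain d where d: "0 < d" "\<And>u. u \<in> {0..} \<inter> {..<t} \<Longrightarrow> u \<noteq> t \<Longrightarrow> dist u t < d \<Longrightarrow> X u \<omega> = l"
    unfolding eventually_at by auto
  then show "\<exists>d>0. \<exists>l. \<forall>u. 0 \<le> u \<and> t - d < u \<and> u < t \<longrightarrow> X u \<omega> = l"
    by (intro exI[of _ d] conjI exI[of _ l]) (auto simp: dist_real_def)
qed (use T in simp)

text \<open>Step paths agreeing with \<open>X\<close> on longer and longer samples have convergent
  break points along a subsequence. This fixes \<open>X\<close> at sample times inside the limiting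
  intervals, and right continuity fixes it at all other times, left end points included.\<close>

lemma step_path_closed:
  assumes T: "0 < T" and \<omega>: "\<omega> \<in> space M"
    and match: "\<And>j. \<exists>\<xi>. step_path T n \<xi> \<and> (\<forall>t\<in>{0..T}. \<xi> t \<in> E) \<and> (\<forall>l\<le>j. X (sample T l) \<omega> = \<xi> (sample T l))"
  shows "step_path T n (\<lambda>t. X t \<omega>)"
proof -
  obtain \<xi> where xi: "\<And>j. step_path T n (\<xi> j)" "\<And>j t. t \<in> {0..T} \<Longrightarrow> \<xi> j t \<in> E"
    "\<And>j l. l \<le> j \<Longrightarrow> X (sample T l) \<omega> = \<xi> j (sample T l)"
    using match by metis
  obtain r k \<sigma> \<tau> v where r: "strict_mono (r :: nat \<Rightarrow> nat)" and part0: "\<forall>j::nat. partition T n k (\<sigma> j)"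
    and part': "partition T n k \<tau>"
    and v0: "\<forall>j i t. i < k \<longrightarrow> \<sigma> j i \<le> t \<longrightarrow> t < \<sigma> j (Suc i) \<longrightarrow> \<xi> (r j) t = v i"
    and vk0: "\<forall>j. \<xi> (r j) T = v k" and lim0: "\<forall>i\<le>k. (\<lambda>j. \<sigma> j i) \<longlonglongrightarrow> \<tau> i"
    using step_path_subsequence[of T n \<xi>, OF xi(1) finite_states xi(2)] by blast
  note part = part0[rule_format] and v = v0[rule_format] and vk = vk0[rule_format] and lim = lim0[rule_format]
  have inner: "X (sample T l) \<omega> = v i" if i: "i < k" "\<tau> i < sample T l" "sample T l < \<tau> (Suc i)" for i l
  proof -
    have "eventually (\<lambda>j. \<sigma> j i < sample T l) sequentially" "eventually (\<lambda>j. sample T l < \<sigma> j (Suc i)) sequentially"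
      using order_tendstoD[OF lim[of i]] order_tendstoD[OF lim[of "Suc i"]] i by auto
    moreover have "eventually (\<lambda>j. l \<le> j) sequentially" by (rule eventually_ge_at_top)
    ultimately have "eventually (\<lambda>j. X (sample T l) \<omega> = v i) sequentially"
    proof eventually_elim
      fix j assume j: "\<sigma> j i < sample T l" "sample T l < \<sigma> j (Suc i)" "l \<le> j"
      then have "l \<le> r j" using seq_suble[OF r, of j] by linarith
      from xi(3)[OF this] v[OF i(1), of j "sample T l"] j show "X (sample T l) \<omega> = v i" by simp
    qed
    then show ?thesis by simp
  qed
  have "X t \<omega> = v i" if i: "i < k" "\<tau> i \<le> t" "t < \<tau> (Suc i)" for i t
  proof -
    have t: "0 \<le> t" "\<tau> (Suc i) \<le> T"
      using partition_range[OF part', of i] partition_range[OF part', of "Suc i"] i by auto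
    obtain b where b: "t < b" "\<And>u. t < u \<Longrightarrow> u < b \<Longrightarrow> X u \<omega> = X t \<omega>"
      using X_right_continuous[OF \<omega> t(1)] unfolding eventually_at_right_field by blast
    have "t < min b (\<tau> (Suc i))" "min b (\<tau> (Suc i)) \<le> T" using b i t by auto
    then obtain l where l: "t < sample T l" "sample T l < min b (\<tau> (Suc i))"
      using sample_dense[OF t(1)] by blast
    then show ?thesis using inner[of i l] b(2)[of "sample T l"] i by auto
  qed
  then have "X t \<omega> = X (\<tau> i) \<omega>" if "i < k" "\<tau> i \<le> t" "t < \<tau> (Suc i)" for i t
    using that partition_less[OF part' that(1)] by (metis order_refl)
  then show ?thesis using part' unfolding step_path_def by blast
qed

text \<open>Being a step path refers to uncountably many times; \<open>step_path_closed\<close>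
  makes it equivalent to countably many conditions, each on finitely many sampled values.\<close>

lemma step_event:
  assumes T: "0 < T"
  shows "{\<omega>\<in>space M. step_path T n (\<lambda>t. X t \<omega>)} \<in> sets M"
proof -
  define good where "good j u \<longleftrightarrow> (\<exists>\<xi>. step_path T n \<xi> \<and> (\<forall>t\<in>{0..T}. \<xi> t \<in> E) \<and> (\<forall>l\<le>j. u l = \<xi> (sample T l)))"
    for j :: nat and u
  have pos: "0 \<le> sample T l" for l using sample_range[OF T, of l] by simp
  have "{\<omega>\<in>space M. good j (\<lambda>l. X (sample T l) \<omega>)} \<in> sets M" for j
  proof -
    have "good j (path j (sample T) \<omega>) = good j (\<lambda>l. X (sample T l) \<omega>)" for \<omega>
      unfolding good_def by (simp add: path_def)
    then have "{\<omega>\<in>space M. good j (\<lambda>l. X (sample T l) \<omega>)} =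
        path j (sample T) -` {u \<in> {..j} \<rightarrow>\<^sub>E E. good j u} \<inter> space M"
      using measurable_space[OF path_measurable[of j "sample T", OF pos]] by auto
    also have "\<dots> \<in> sets M"
      by (rule measurable_sets[OF path_measurable[OF pos]]) auto
    finally show ?thesis .
  qed
  then have "(\<Inter>j. {\<omega>\<in>space M. good j (\<lambda>l. X (sample T l) \<omega>)}) \<in> sets M"
    by (intro sets.countable_INT) auto
  also have "(\<Inter>j. {\<omega>\<in>space M. good j (\<lambda>l. X (sample T l) \<omega>)}) = {\<omega>\<in>space M. step_path T n (\<lambda>t. X t \<omega>)}"
  proof (intro equalityI subsetI)
    fix \<omega> assume *: "\<omega> \<in> (\<Inter>j. {\<omega>\<in>space M. good j (\<lambda>l. X (sample T l) \<omega>)})"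
    then have \<omega>: "\<omega> \<in> space M" by auto
    have "step_path T n (\<lambda>t. X t \<omega>)"
      by (rule step_path_closed[OF T \<omega>]) (use * in \<open>simp add: good_def\<close>)
    with \<omega> show "\<omega> \<in> {\<omega>\<in>space M. step_path T n (\<lambda>t. X t \<omega>)}" by simp
  next
    fix \<omega> assume *: "\<omega> \<in> {\<omega>\<in>space M. step_path T n (\<lambda>t. X t \<omega>)}"
    then have "good j (\<lambda>l. X (sample T l) \<omega>)" for j
      unfolding good_def using X_in by (intro exI[of _ "\<lambda>t. X t \<omega>"]) auto
    with * show "\<omega> \<in> (\<Inter>j. {\<omega>\<in>space M. good j (\<lambda>l. X (sample T l) \<omega>)})" by simp
  qed
  finally show ?thesis .
qed

text \<open>Every cadlag path in a finite discrete space is a step path for some \<open>n\<close>,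
  so the events increase to the whole space.\<close>

lemma step_probability:
  assumes T: "0 < T" and e: "0 < e"
  shows "\<exists>n. prob {\<omega>\<in>space M. \<not> step_path T n (\<lambda>t. X t \<omega>)} < e"
proof -
  define A where "A n = {\<omega>\<in>space M. step_path T n (\<lambda>t. X t \<omega>)}" for n
  have A: "A n \<in> sets M" for n unfolding A_def by (rule step_event[OF T])
  have "incseq A" unfolding incseq_def A_def using step_path_mono by blast
  then have "(\<lambda>n. prob (A n)) \<longlonglongrightarrow> prob (\<Union>n. A n)"
    using A by (intro finite_Lim_measure_incseq) auto
  moreover have "(\<Union>n. A n) = space M" using X_step_path[OF T] by (auto simp: A_def)
  ultimately have "(\<lambda>n. prob (A n)) \<longlonglongrightarrow> 1" by (simp add: prob_space)
  then have "eventually (\<lambda>n. 1 - e < prob (A n)) sequentially"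
    using e by (intro order_tendstoD) auto
  then obtain n where n: "1 - e < prob (A n)" by (meson eventually_happens trivial_limit_sequentially)
  have "prob {\<omega>\<in>space M. \<not> step_path T n (\<lambda>t. X t \<omega>)} = prob (space M - A n)"
    by (rule arg_cong[where f = prob]) (auto simp: A_def)
  also have "\<dots> = 1 - prob (A n)" by (rule prob_compl[OF A])
  finally show ?thesis using n by (intro exI[of _ n]) simp
qed

end

section \<open>Discrete Fourier transform\<close>

text \<open>Taylor expansion to order four: since \<open>u \<le> 3.2\<close>, the quartic term is at
  most \<open>10.8 / 24 = 0.45\<close> times the square, and
  \<open>0.5 - 0.45 = 1 / 20\<close>.\<close>

lemma one_minus_cos_ge:
  fixes u :: real
  assumes "0 \<le> u" "u \<le> pi"
  shows "u\<^sup>2 / 20 \<le> 1 - cos u"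
proof -
  obtain t where t: "cos u = (\<Sum>m<4. cos_coeff m * u ^ m) + (cos (t + 1/2 * real 4 * pi) / fact 4) * u ^ 4"
    using Maclaurin_cos_expansion[of u 4] by blast
  have "(\<Sum>m<4. cos_coeff m * u ^ m) = 1 - u\<^sup>2 / 2"
  proof -
    have "(\<Sum>m<4. f m) = f 0 + f 1 + f 2 + f 3" for f :: "nat \<Rightarrow> real"
      by (simp add: eval_nat_numeral)
    then show ?thesis by (simp add: cos_coeff_def fact_numeral)
  qed
  moreover have "(cos (t + 1/2 * real 4 * pi) / fact 4) * u ^ 4 \<le> (1 / 24) * u ^ 4"
  proof -
    have "cos (t + 1/2 * real 4 * pi) / fact 4 \<le> 1 / fact 4" by (intro divide_right_mono) auto
    also have "1 / fact 4 = (1 / 24 :: real)" by (simp add: fact_numeral)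
    finally show ?thesis by (intro mult_right_mono) auto
  qed
  ultimately have "cos u \<le> 1 - u\<^sup>2 / 2 + (1 / 24) * u ^ 4" using t by linarith
  moreover have "u ^ 4 \<le> 10.8 * u\<^sup>2"
  proof -
    have "u \<le> 3.2" using assms(2) pi_approx by simp
    then have "u\<^sup>2 \<le> 3.2\<^sup>2" using assms(1) by (intro power_mono) auto
    then have "u\<^sup>2 * u\<^sup>2 \<le> 10.8 * u\<^sup>2" by (intro mult_right_mono) (auto simp: power2_eq_square)
    then show ?thesis by (simp add: power4_eq_xxxx power2_eq_square mult.assoc)
  qed
  ultimately show ?thesis by simp
qed

definition wave :: "nat \<Rightarrow> nat \<Rightarrow> nat \<Rightarrow> complex" where
  "wave N k x = cis (2 * pi * real k * real x / real N)"

lemma wave_rsite: "x < N \<Longrightarrow> wave N k (rsite N x) = wave N k x * cis (2 * pi * real k / real N)"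
proof (cases "x + 1 = N")
  case True
  assume "x < N"
  with True have "rsite N x = 0" by (simp add: rsite_def)
  moreover have "wave N k x * cis (2 * pi * real k / real N) = cis (2 * pi * real k * (real x + 1) / real N)"
    by (simp add: wave_def cis_mult add_divide_distrib algebra_simps)
  moreover have "real x + 1 = real N" using True by linarith
  ultimately show ?thesis using \<open>x < N\<close> by (simp add: wave_def)
next
  case False
  assume "x < N"
  with False have "rsite N x = x + 1" by (simp add: rsite_def)
  then show ?thesis by (simp add: wave_def cis_mult add_divide_distrib algebra_simps)
qed

lemma wave_lsite: "x < N \<Longrightarrow> wave N k (lsite N x) = wave N k x * cis (- (2 * pi * real k / real N))"
proof -
  assume x: "x < N"
  have "wave N k x * cis (- (2 * pi * real k / real N)) =
      wave N k (lsite N x) * (cis (2 * pi * real k / real N) * cis (- (2 * pi * real k / real N)))"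
    using wave_rsite[OF lsite_less[OF x], of k] by (simp add: rsite_lsite[OF x])
  then show ?thesis by (simp add: cis_mult)
qed

lemma wave_orthogonal:
  assumes "x < N" "y < N"
  shows "(\<Sum>k<N. wave N k x * cnj (wave N k y)) = (if x = y then of_nat N else 0)"
proof -
  define \<theta> where "\<theta> = 2 * pi * (real x - real y) / real N"
  have N: "0 < real N" using assms by simp
  have pow: "wave N k x * cnj (wave N k y) = cis \<theta> ^ k" for k
  proof -
    have "2 * pi * real k * real x / real N + - (2 * pi * real k * real y / real N) = real k * \<theta>"
      by (simp add: \<theta>_def algebra_simps diff_divide_distrib)
    then show ?thesis by (simp only: wave_def cis_cnj cis_mult Complex.DeMoivre)
  qed
  show ?thesis
  proof (cases "x = y")
    case True
    then show ?thesis unfolding pow by (simp add: \<theta>_def)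
  next
    case False
    have "cis \<theta> \<noteq> 1"
    proof
      assume "cis \<theta> = 1"
      from arg_cong[OF this, of Re] have "cos \<theta> = 1" by simp
      then obtain n :: int where "\<theta> = of_int n * 2 * pi" using cos_one_2pi_int by blast
      then have "(2 * pi) * ((real x - real y) / real N) = (2 * pi) * of_int n" by (simp add: \<theta>_def)
      then have "(real x - real y) / real N = of_int n" by (subst (asm) mult_cancel_left) simp
      then have eq: "real x - real y = of_int n * real N" using N by (simp add: field_simps)
      have "\<bar>real x - real y\<bar> < real N" using assms by (auto simp: abs_if)
      then have "\<bar>of_int n * real N\<bar> < 1 * real N" unfolding eq by simp
      then have "\<bar>real_of_int n\<bar> < 1" using N unfolding abs_mult by simp
      then have "n = 0" by linarith
      with eq False show False by simp
    qed
    then have "(\<Sum>k<N. cis \<theta> ^ k) = (cis \<theta> ^ N - 1) / (cis \<theta> - 1)" by (rule geometric_sum)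
    moreover have "cis \<theta> ^ N = 1"
    proof -
      have "real N * \<theta> = 2 * pi * of_int (int x - int y)" using N by (simp add: \<theta>_def)
      moreover have "cis (2 * pi * of_int (int x - int y)) = 1" by (rule cis_multiple_2pi) simp
      ultimately show ?thesis by (simp only: Complex.DeMoivre)
    qed
    ultimately show ?thesis unfolding pow using False by simp
  qed
qed

text \<open>The factor \<open>1 / N\<close> sits in the forward transform, so coefficients are
  bounded by the supremum of \<open>F\<close> uniformly in \<open>N\<close>.\<close>

definition dft :: "nat \<Rightarrow> (nat \<Rightarrow> real) \<Rightarrow> nat \<Rightarrow> complex" where
  "dft N F k = (\<Sum>x<N. of_real (F x) * cnj (wave N k x)) / of_nat N"

lemma dft_inversion:
  assumes "x < N"
  shows "of_real (F x) = (\<Sum>k<N. dft N F k * wave N k x)"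
proof -
  have "(\<Sum>k<N. dft N F k * wave N k x) =
      (\<Sum>k<N. \<Sum>y<N. of_real (F y) / of_nat N * (wave N k x * cnj (wave N k y)))"
    by (simp add: dft_def sum_divide_distrib sum_distrib_right sum_distrib_left mult_ac)
  also have "\<dots> = (\<Sum>y<N. of_real (F y) / of_nat N * (\<Sum>k<N. wave N k x * cnj (wave N k y)))"
    by (subst sum.swap) (simp add: sum_distrib_left)
  also have "\<dots> = (\<Sum>y<N. if x = y then of_real (F y) else 0)"
    using assms by (intro sum.cong) (auto simp: wave_orthogonal)
  also have "\<dots> = of_real (F x)" using assms by simp
  finally show ?thesis by simp
qed

lemma dft_zero_bound:
  assumes "1 \<le> N" "\<And>x. x < N \<Longrightarrow> \<bar>F x\<bar> \<le> B"
  shows "cmod (dft N F 0) \<le> B"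
proof -
  have "cmod (\<Sum>x<N. of_real (F x) * cnj (wave N 0 x)) \<le> (\<Sum>x<N. B)"
    using assms(2) by (intro order_trans[OF norm_sum] sum_mono) (simp add: norm_mult wave_def)
  then show ?thesis using assms(1) by (simp add: dft_def norm_divide field_simps)
qed

text \<open>Reindexing moves the shifts from \<open>F\<close> to the wave, which is an eigenvector
  of both shifts.\<close>

lemma dft_lap: "dft N (lap N F) k = of_real (2 * cos (2 * pi * real k / real N) - 2) * dft N F k"
proof -
  let ?w = "\<lambda>x. cnj (wave N k x)"
  let ?\<theta> = "2 * pi * real k / real N"
  have 1: "(\<Sum>x<N. of_real (F (rsite N x)) * ?w x) = (\<Sum>x<N. of_real (F x) * ?w (lsite N x))"
  proof -
    have "(\<Sum>x<N. of_real (F (rsite N x)) * ?w x) = (\<Sum>x<N. of_real (F (rsite N x)) * ?w (lsite N (rsite N x)))"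
      by (intro sum.cong) (auto simp: lsite_rsite)
    also have "\<dots> = (\<Sum>x<N. of_real (F x) * ?w (lsite N x))"
      by (rule sum.reindex_bij_betw[OF bij_rsite])
    finally show ?thesis .
  qed
  have 2: "(\<Sum>x<N. of_real (F (lsite N x)) * ?w x) = (\<Sum>x<N. of_real (F x) * ?w (rsite N x))"
  proof -
    have "(\<Sum>x<N. of_real (F x) * ?w (rsite N x)) = (\<Sum>x<N. of_real (F (lsite N (rsite N x))) * ?w (rsite N x))"
      by (intro sum.cong) (auto simp: lsite_rsite)
    also have "\<dots> = (\<Sum>x<N. of_real (F (lsite N x)) * ?w x)"
      by (rule sum.reindex_bij_betw[OF bij_rsite])
    finally show ?thesis by simp
  qed
  have c: "cis ?\<theta> + cis (- ?\<theta>) = of_real (2 * cos ?\<theta>)"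
    by (simp add: complex_eq_iff)
  have "(\<Sum>x<N. of_real (lap N F x) * ?w x) =
      (\<Sum>x<N. of_real (F (rsite N x)) * ?w x) + (\<Sum>x<N. of_real (F (lsite N x)) * ?w x)
      - 2 * (\<Sum>x<N. of_real (F x) * ?w x)"
    by (simp add: lap_def algebra_simps sum.distrib sum_subtractf sum_distrib_left)
  also have "\<dots> = (\<Sum>x<N. of_real (F x) * ?w x * (cis ?\<theta> + cis (- ?\<theta>))) - 2 * (\<Sum>x<N. of_real (F x) * ?w x)"
    unfolding 1 2 sum.distrib[symmetric]
    by (intro arg_cong2[where f = "(-)"] sum.cong refl)
      (simp add: wave_lsite wave_rsite cis_cnj distrib_left mult.assoc)
  also have "\<dots> = of_real (2 * cos ?\<theta> - 2) * (\<Sum>x<N. of_real (F x) * ?w x)"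
    unfolding c sum_distrib_right[symmetric] by (simp add: algebra_simps)
  finally show ?thesis by (simp add: dft_def)
qed

text \<open>In terms of the effective frequency \<open>k' = min k (N - k)\<close> the angle is at
  most \<open>pi\<close>, where the eigenvalue of the Laplacian is of order
  \<open>(k' / N)\<^sup>2\<close>. Dividing by it cancels the \<open>N\<^sup>2\<close> of the
  hypothesis.\<close>

lemma dft_decay:
  assumes k: "1 \<le> k" "k < N" and F: "\<And>x. x < N \<Longrightarrow> \<bar>lap N F x\<bar> \<le> B / (real N)\<^sup>2"
  shows "cmod (dft N F k) \<le> B / (2 * (real (min k (N - k)))\<^sup>2)"
proof -
  define k' where "k' = min k (N - k)"
  have k': "1 \<le> k'" "2 * k' \<le> N" using k by (auto simp: k'_def)
  have N: "1 \<le> N" "0 < real N" using k by auto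
  have cos_eq: "cos (2 * pi * real k / real N) = cos (2 * pi * real k' / real N)"
  proof (cases "k \<le> N - k")
    case False
    then have "k' = N - k" by (simp add: k'_def)
    then have "2 * pi * real k' / real N = 2 * pi - 2 * pi * real k / real N"
      using k N by (simp add: of_nat_diff field_simps)
    then show ?thesis by (simp add: cos_diff)
  qed (simp add: k'_def)
  define u where "u = 2 * pi * real k' / real N"
  have "2 * real k' \<le> real N" using k'(2) by linarith
  then have u: "0 \<le> u" "u \<le> pi" using N by (simp_all add: u_def field_simps)
  \<comment> \<open>From \<open>2 * pi \<ge> 6\<close> the square of \<open>u\<close> is at least 36
    times \<open>(k' / N)\<^sup>2\<close>, and \<open>2 * 36 / 20\<close> exceeds the required
    2.\<close>
  have "6 * real k' / real N \<le> u"
    unfolding u_def using pi_gt3 N by (intro divide_right_mono mult_right_mono) auto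
  then have "(6 * real k' / real N)\<^sup>2 \<le> u\<^sup>2" by (intro power_mono) auto
  then have "36 * ((real k')\<^sup>2 / (real N)\<^sup>2) \<le> u\<^sup>2" by (simp add: power_divide power_mult_distrib)
  moreover have "0 \<le> (real k')\<^sup>2 / (real N)\<^sup>2" by simp
  ultimately have low: "2 * ((real k')\<^sup>2 / (real N)\<^sup>2) \<le> 2 - 2 * cos u"
    using one_minus_cos_ge[OF u] by linarith
  have "cmod (dft N (lap N F) k) \<le> B / (real N)\<^sup>2"
  proof -
    have "cmod (\<Sum>x<N. of_real (lap N F x) * cnj (wave N k x)) \<le> (\<Sum>x<N. B / (real N)\<^sup>2)"
      using F by (intro order_trans[OF norm_sum] sum_mono) (simp add: norm_mult wave_def)
    also have "\<dots> = real N * (B / (real N)\<^sup>2)" by simp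
    finally show ?thesis using N by (simp add: dft_def norm_divide field_simps)
  qed
  moreover have "cmod (dft N (lap N F) k) = (2 - 2 * cos u) * cmod (dft N F k)"
    unfolding dft_lap cos_eq u_def[symmetric] norm_mult norm_of_real by simp
  ultimately have "2 * ((real k')\<^sup>2 / (real N)\<^sup>2) * cmod (dft N F k) \<le> B / (real N)\<^sup>2"
    using mult_right_mono[OF low, of "cmod (dft N F k)"] by simp
  then have "2 * (real k')\<^sup>2 * cmod (dft N F k) \<le> B"
    using N by (simp add: field_simps)
  moreover have "0 < 2 * (real k')\<^sup>2" using k' by simp
  ultimately have "cmod (dft N F k) \<le> B / (2 * (real k')\<^sup>2)"
    by (simp add: pos_le_divide_eq mult.commute)
  then show ?thesis by (simp add: k'_def)
qed

text \<open>The size \<open>sqrt (1 + k)\<close> allowed for mode \<open>k\<close> of the field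
  against the decay \<open>1 / k\<^sup>2\<close> of the Fourier coefficients of a test
  function.\<close>

lemma summable_sqrt_over_square: "summable (\<lambda>k. sqrt (1 + real k) / (real k)\<^sup>2)"
proof (rule summable_comparison_test)
  show "summable (\<lambda>k. 2 * (real k powr (- (3 / 2))))"
    using summable_real_powr_iff[of "- (3 / 2)"] by (intro summable_mult) simp
  show "\<exists>n0. \<forall>k\<ge>n0. norm (sqrt (1 + real k) / (real k)\<^sup>2) \<le> 2 * (real k powr (- (3 / 2)))"
  proof (intro exI[of _ 1] allI impI)
    fix k :: nat assume k: "1 \<le> k"
    have "sqrt (1 + real k) \<le> sqrt (2\<^sup>2 * real k)" using k by (intro real_sqrt_le_mono) simp
    also have "\<dots> = 2 * sqrt (real k)" by (simp add: real_sqrt_mult)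
    finally have "sqrt (1 + real k) / (real k)\<^sup>2 \<le> 2 * sqrt (real k) / (real k)\<^sup>2" by (intro divide_right_mono) auto
    also have "\<dots> = 2 * (real k powr (1 / 2) / real k powr 2)"
      using k by (simp add: powr_half_sqrt powr_numeral)
    also have "\<dots> = 2 * (real k powr (- (3 / 2)))"
      by (simp only: powr_diff[symmetric]) simp
    finally show "norm (sqrt (1 + real k) / (real k)\<^sup>2) \<le> 2 * (real k powr (- (3 / 2)))" by simp
  qed
qed

text \<open>Frequency \<open>k\<close> and \<open>N - k\<close> are conjugate, so the effective frequency is at most \<open>N/2\<close>.\<close>

lemma wave_sum_bound:
  assumes z: "\<And>k. k \<le> N \<Longrightarrow> \<bar>pairing N (\<lambda>x. cos (2 * pi * real k * (real x / real N))) z\<bar> \<le> D * sqrt (1 + real k)"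
    "\<And>k. k \<le> N \<Longrightarrow> \<bar>pairing N (\<lambda>x. sin (2 * pi * real k * (real x / real N))) z\<bar> \<le> D * sqrt (1 + real k)"
    and k: "k < N"
  shows "cmod (\<Sum>x<N. of_real (z x) * wave N k x) \<le> 2 * D * sqrt (1 + real (min k (N - k)))"
proof -
  have bound: "cmod (\<Sum>x<N. of_real (z x) * wave N k x) \<le> 2 * D * sqrt (1 + real k)" if "k \<le> N" for k
  proof -
    have "Re (\<Sum>x<N. of_real (z x) * wave N k x) = pairing N (\<lambda>x. cos (2 * pi * real k * (real x / real N))) z"
      "Im (\<Sum>x<N. of_real (z x) * wave N k x) = pairing N (\<lambda>x. sin (2 * pi * real k * (real x / real N))) z"
      by (simp_all add: pairing_def wave_def mult.commute)
    then show ?thesis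
      using cmod_le[of "\<Sum>x<N. of_real (z x) * wave N k x"] z[OF that] by simp
  qed
  have "cmod (\<Sum>x<N. of_real (z x) * wave N k x) = cmod (\<Sum>x<N. of_real (z x) * wave N (N - k) x)"
  proof -
    have "wave N (N - k) x = cnj (wave N k x)" for x
    proof -
      have "2 * pi * real (N - k) * real x / real N = 2 * pi * real x + - (2 * pi * real k * real x / real N)"
        using k by (simp add: of_nat_diff field_simps)
      then have "wave N (N - k) x = cis (2 * pi * real x) * cnj (wave N k x)"
        by (simp only: wave_def cis_cnj cis_mult)
      moreover have "cis (2 * pi * real x) = 1" by (rule cis_multiple_2pi) simp
      ultimately show ?thesis by simp
    qed
    then have "(\<Sum>x<N. of_real (z x) * wave N (N - k) x) = cnj (\<Sum>x<N. of_real (z x) * wave N k x)"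
      by simp
    then show ?thesis by (simp only: complex_mod_cnj)
  qed
  then show ?thesis using bound[of k] bound[of "N - k"] k by (auto simp: min_def)
qed

text \<open>A predicate, so that one constant can be fixed for all \<open>N\<close> and all
  processes. The weight \<open>sqrt (1 + k)\<close> grows, to make the tails of the modes summable,
  but more slowly than \<open>k\<close>, to remain summable against coefficients of order
  \<open>1 / k\<^sup>2\<close>.\<close>

definition fourier_controls :: "real \<Rightarrow> bool" where
  "fourier_controls C \<longleftrightarrow> 0 \<le> C \<and> (\<forall>N z F B D. 1 \<le> N \<longrightarrow> 0 \<le> B \<longrightarrow> 0 \<le> D \<longrightarrow>
    (\<forall>k\<le>N. \<bar>pairing N (\<lambda>x. cos (2 * pi * real k * (real x / real N))) z\<bar> \<le> D * sqrt (1 + real k)) \<longrightarrow>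
    (\<forall>k\<le>N. \<bar>pairing N (\<lambda>x. sin (2 * pi * real k * (real x / real N))) z\<bar> \<le> D * sqrt (1 + real k)) \<longrightarrow>
    (\<forall>x<N. \<bar>F x\<bar> \<le> B) \<longrightarrow> (\<forall>x<N. \<bar>lap N F x\<bar> \<le> B / (real N)\<^sup>2) \<longrightarrow>
    \<bar>pairing N F z\<bar> \<le> C * D * B)"

text \<open>Expand \<open>F\<close> in waves and bound mode by mode: frequency 0 by the supremum of
  \<open>F\<close>, the others by \<open>dft_decay\<close>.\<close>

lemma fourier_bound: "\<exists>C. fourier_controls C"
proof -
  define g where "g k = sqrt (1 + real k) / (real k)\<^sup>2" for k
  define G where "G = suminf g"
  have sg: "summable g" unfolding g_def[abs_def] by (rule summable_sqrt_over_square)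
  have g0: "0 \<le> g k" for k by (simp add: g_def)
  have G: "sum g A \<le> G" if "finite A" for A unfolding G_def using sum_le_suminf[OF sg that] g0 by blast
  have "0 \<le> G" unfolding G_def by (intro suminf_nonneg sg g0)
  show ?thesis
    unfolding fourier_controls_def
  proof (intro exI[of _ "2 + 2 * G"] conjI allI impI)
    fix N :: nat and z F :: "nat \<Rightarrow> real" and B D :: real
    assume N: "1 \<le> N" and B: "0 \<le> B" and D: "0 \<le> D"
      and z0: "\<forall>k\<le>N. \<bar>pairing N (\<lambda>x. cos (2 * pi * real k * (real x / real N))) z\<bar> \<le> D * sqrt (1 + real k)"
        "\<forall>k\<le>N. \<bar>pairing N (\<lambda>x. sin (2 * pi * real k * (real x / real N))) z\<bar> \<le> D * sqrt (1 + real k)"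
      and F0: "\<forall>x<N. \<bar>F x\<bar> \<le> B" "\<forall>x<N. \<bar>lap N F x\<bar> \<le> B / (real N)\<^sup>2"
    note z = z0[rule_format] and F = F0[rule_format]
    define W where "W k = (\<Sum>x<N. of_real (z x) * wave N k x)" for k
    have W: "cmod (W k) \<le> 2 * D * sqrt (1 + real (min k (N - k)))" if "k < N" for k
      unfolding W_def using wave_sum_bound[OF z that] .
    have "of_real (pairing N F z) = (\<Sum>x<N. (\<Sum>k<N. dft N F k * wave N k x) * of_real (z x))"
      unfolding pairing_def of_real_sum of_real_mult by (intro sum.cong) (auto simp: dft_inversion)
    also have "\<dots> = (\<Sum>k<N. dft N F k * W k)"
      unfolding W_def sum_distrib_left sum_distrib_right by (subst sum.swap) (simp add: mult_ac)
    finally have eq: "of_real (pairing N F z) = (\<Sum>k<N. dft N F k * W k)" .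
    have split: "{..<N} = insert 0 {1..<N}" using N by auto
    have "\<bar>pairing N F z\<bar> = cmod (of_real (pairing N F z))" by simp
    also have "\<dots> \<le> (\<Sum>k<N. cmod (dft N F k) * cmod (W k))"
      unfolding eq by (rule order_trans[OF norm_sum]) (simp add: norm_mult)
    also have "\<dots> = cmod (dft N F 0) * cmod (W 0) + (\<Sum>k\<in>{1..<N}. cmod (dft N F k) * cmod (W k))"
      unfolding split by simp
    \<comment> \<open>The term at the effective frequency is one of \<open>g k\<close> and
      \<open>g (N - k)\<close>; bounding it by both makes the sum split into two equal
      halves.\<close>
    also have "\<dots> \<le> B * (2 * D) + (\<Sum>k\<in>{1..<N}. B * D * (g k + g (N - k)))"
    proof (rule add_mono)
      show "cmod (dft N F 0) * cmod (W 0) \<le> B * (2 * D)"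
        using dft_zero_bound[OF N F(1)] W[of 0] N B by (intro mult_mono) auto
      show "(\<Sum>k\<in>{1..<N}. cmod (dft N F k) * cmod (W k)) \<le> (\<Sum>k\<in>{1..<N}. B * D * (g k + g (N - k)))"
      proof (rule sum_mono)
        fix k assume k: "k \<in> {1..<N}"
        define k' where "k' = min k (N - k)"
        have "cmod (dft N F k) * cmod (W k) \<le> B / (2 * (real k')\<^sup>2) * (2 * D * sqrt (1 + real k'))"
          unfolding k'_def using k B D by (intro mult_mono dft_decay W F(2)) auto
        also have "\<dots> = B * D * g k'" by (simp add: g_def)
        also have "\<dots> \<le> B * D * (g k + g (N - k))"
          using B D g0[of k] g0[of "N - k"] by (intro mult_left_mono) (auto simp: k'_def min_def)
        finally show "cmod (dft N F k) * cmod (W k) \<le> B * D * (g k + g (N - k))" .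
      qed
    qed
    also have "(\<Sum>k\<in>{1..<N}. B * D * (g k + g (N - k))) = B * D * (sum g {1..<N} + (\<Sum>k\<in>{1..<N}. g (N - k)))"
      by (simp only: sum.distrib[symmetric] sum_distrib_left)
    also have "(\<Sum>k\<in>{1..<N}. g (N - k)) = sum g {1..<N}"
      by (rule sum.reindex_bij_witness[of _ "\<lambda>k. N - k" "\<lambda>k. N - k"]) auto
    also have "B * (2 * D) + B * D * (sum g {1..<N} + sum g {1..<N}) \<le> B * (2 * D) + B * D * (G + G)"
      using G[of "{1..<N}"] B D by (intro add_left_mono mult_left_mono add_mono) auto
    finally show "\<bar>pairing N F z\<bar> \<le> (2 + 2 * G) * D * B" by (simp add: algebra_simps)
  qed (use \<open>0 \<le> G\<close> in simp)
qed

section \<open>Moderate deviation bounds for the density field\<close>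

definition sampled :: "nat \<Rightarrow> (real \<Rightarrow> real) \<Rightarrow> nat \<Rightarrow> real" where
  "sampled N f x = f (real x / real N)"

text \<open>The wrap-around at the sites 0 and \<open>N - 1\<close> is absorbed by the periodicity
  of \<open>f\<close>; the rest is the mean value bound at mesh \<open>1 / N\<close>.\<close>

lemma sampled_differences:
  assumes N: "1 \<le> N" and x: "x < N" and per: "\<And>u. f (u + 1) = f u"
    and D: "\<And>x. (f has_field_derivative f' x) (at x)" "\<And>x. (f' has_field_derivative f'' x) (at x)"
    and B: "\<And>x. \<bar>f' x\<bar> \<le> B1" "\<And>x. \<bar>f'' x\<bar> \<le> (B2 :: real)"
  shows "\<bar>grad N (sampled N f) x\<bar> \<le> B1 / real N" "\<bar>lap N (sampled N f) x\<bar> \<le> B2 / (real N)\<^sup>2"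
proof -
  have pos: "0 < real N" using N by simp
  have r: "sampled N f (rsite N x) = f (real x / real N + 1 / real N)"
  proof (cases "x + 1 = N")
    case True
    then have "real x / real N + 1 / real N = 0 + 1" using pos by (simp add: field_simps)
    then show ?thesis using per[of 0] True by (simp add: sampled_def rsite_def)
  next
    case False
    then show ?thesis using x by (simp add: sampled_def rsite_def add_divide_distrib add.commute)
  qed
  have l: "sampled N f (lsite N x) = f (real x / real N - 1 / real N)"
  proof (cases "x = 0")
    case True
    have "(real N - 1) / real N = - 1 / real N + 1" using pos by (simp add: field_simps)
    then show ?thesis using per[of "- 1 / real N"] True N by (simp add: sampled_def lsite_def of_nat_diff)
  next
    case False
    then have "(x + N - 1) mod N = x - 1" using x by (simp add: mod_if)
    then show ?thesis using False by (simp add: sampled_def lsite_def of_nat_diff diff_divide_distrib)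
  qed
  have "\<bar>f (real x / real N + 1 / real N) - f (real x / real N)\<bar> \<le> B1 * \<bar>(real x / real N + 1 / real N) - real x / real N\<bar>"
    by (rule first_difference_bound[OF D(1) B(1)])
  then show "\<bar>grad N (sampled N f) x\<bar> \<le> B1 / real N" unfolding grad_def r by (simp add: sampled_def)
  have "\<bar>f (real x / real N + 1 / real N) + f (real x / real N - 1 / real N) - 2 * f (real x / real N)\<bar>
      \<le> B2 * (1 / real N)\<^sup>2"
    by (rule second_difference_bound[OF D B(2)]) (use pos in simp)
  then show "\<bar>lap N (sampled N f) x\<bar> \<le> B2 / (real N)\<^sup>2"
    unfolding lap_def r l by (simp add: sampled_def power_divide)
qed

lemma square_le_if_abs_le: "\<bar>x\<bar> \<le> y \<Longrightarrow> x\<^sup>2 \<le> y\<^sup>2" for x y :: real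
  using power_mono[of "\<bar>x\<bar>" y 2] by simp

text \<open>The eighth power is chosen for \<open>y = s * sqrt u\<close>: it puts
  \<open>u ^ 4\<close> in the denominator, which absorbs a factor \<open>u\<^sup>2\<close> and
  leaves the summable \<open>1 / u\<^sup>2\<close>.\<close>

lemma exp_neg_le_power: "0 < y \<Longrightarrow> exp (- y) \<le> (8 / y) ^ 8" for y :: real
proof -
  assume y: "0 < y"
  have "y / 8 \<le> exp (y / 8)" using exp_ge_add_one_self[of "y / 8"] by linarith
  then have "(y / 8) ^ 8 \<le> exp (y / 8) ^ 8" using y by (intro power_mono) auto
  also have "\<dots> = exp y" by (simp add: exp_of_nat_mult[symmetric])
  finally have "inverse (exp y) \<le> inverse ((y / 8) ^ 8)" using y by (intro le_imp_inverse_le) auto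
  then show ?thesis by (simp add: exp_minus power_inverse[symmetric])
qed

text \<open>\<open>Q * (1 + k)\<^sup>2\<close> has the order of the number of time windows used for
  mode \<open>k\<close>. The bound obtained is proportional to \<open>1 / s\<close>, hence small for
  large \<open>s\<close>.\<close>

lemma small_exponential_sum:
  assumes \<eta>: "0 < \<eta>" and Q: "0 \<le> Q"
  shows "\<exists>s>0. \<forall>n. (\<Sum>k\<le>n. Q * (1 + real k)\<^sup>2 * exp (- (s * sqrt (1 + real k)))) \<le> \<eta>"
proof -
  have sm: "summable (\<lambda>k. 1 / (1 + real k)\<^sup>2)"
    using inverse_power_summable[of 2, where 'a = real] summable_Suc_iff[of "\<lambda>k. inverse (real k ^ 2)"]
    by (simp add: inverse_eq_divide)
  define S where "S = (\<Sum>k. 1 / (1 + real k)\<^sup>2)"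
  have S: "(\<Sum>k\<le>n. 1 / (1 + real k)\<^sup>2) \<le> S" for n
    unfolding S_def by (intro sum_le_suminf sm) auto
  have S0: "0 \<le> S" using S[of 0] by simp
  define s where "s = 1 + Q * 8 ^ 8 * S / \<eta>"
  have s: "1 \<le> s" using \<eta> Q S0 by (simp add: s_def)
  have t: "Q * (1 + real k)\<^sup>2 * exp (- (s * sqrt (1 + real k))) \<le> Q * 8 ^ 8 / s * (1 / (1 + real k)\<^sup>2)" for k
  proof -
    define u where "u = 1 + real k"
    have u: "1 \<le> u" by (simp add: u_def)
    have p: "0 < s * sqrt u" using s u by simp
    have "sqrt u ^ 8 = ((sqrt u)\<^sup>2) ^ 4" by (simp flip: power_mult)
    also have "\<dots> = u ^ 4" using u by simp
    finally have su: "sqrt u ^ 8 = u\<^sup>2 * u\<^sup>2" by (simp flip: power_add)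
    have "exp (- (s * sqrt u)) \<le> (8 / (s * sqrt u)) ^ 8" by (rule exp_neg_le_power[OF p])
    also have "\<dots> = 8 ^ 8 / (s ^ 8 * (u\<^sup>2 * u\<^sup>2))" by (simp only: power_divide power_mult_distrib su)
    also have "\<dots> \<le> 8 ^ 8 / (s * (u\<^sup>2 * u\<^sup>2))"
    proof -
      have "s ^ 1 \<le> s ^ 8" using s by (intro power_increasing) auto
      then show ?thesis using s u by (intro divide_left_mono mult_right_mono) auto
    qed
    finally have "Q * u\<^sup>2 * exp (- (s * sqrt u)) \<le> Q * u\<^sup>2 * (8 ^ 8 / (s * (u\<^sup>2 * u\<^sup>2)))"
      using Q by (intro mult_left_mono) auto
    also have "\<dots> = Q * 8 ^ 8 / s * (1 / u\<^sup>2)" using u s by (simp add: field_simps)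
    finally show ?thesis by (simp add: u_def)
  qed
  have "(\<Sum>k\<le>n. Q * (1 + real k)\<^sup>2 * exp (- (s * sqrt (1 + real k)))) \<le> \<eta>" for n
  proof -
    have "(\<Sum>k\<le>n. Q * (1 + real k)\<^sup>2 * exp (- (s * sqrt (1 + real k)))) \<le>
        Q * 8 ^ 8 / s * (\<Sum>k\<le>n. 1 / (1 + real k)\<^sup>2)"
      unfolding sum_distrib_left by (intro sum_mono t)
    also have "\<dots> \<le> Q * 8 ^ 8 / s * S" using S Q s by (intro mult_left_mono) auto
    also have "\<dots> \<le> \<eta>"
      using s \<eta> by (simp add: divide_le_eq) (simp add: s_def field_simps)
    finally show ?thesis .
  qed
  then show ?thesis using s by (intro exI[of _ s]) auto
qed

context exclusion_process
begin

lemma excursion_scale: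
  assumes "0 < k"
  shows "excursion s \<delta> (\<lambda>x. k * c x) (k * r) = excursion s \<delta> c r"
proof -
  have "k * r \<le> \<bar>Z t (\<lambda>x. k * c x) \<omega> - Z u (\<lambda>x. k * c x) \<omega>\<bar> \<longleftrightarrow> r \<le> \<bar>Z t c \<omega> - Z u c \<omega>\<bar>" for t u \<omega>
    using assms by (simp add: Z_cmult abs_mult flip: right_diff_distrib)
  then show ?thesis unfolding excursion_def by simp
qed

text \<open>\<open>excursion_bound\<close> for \<open>c = l * (a / N) * F\<close>. Every exponent is
  then a multiple of \<open>a\<^sup>2 / N\<close>; the gain is linear in the free slope
  \<open>l\<close>, while the quadratic loss carries a factor \<open>\<delta>\<close> or its
  square.\<close>

lemma scaled_excursion_bound:
  assumes s: "0 \<le> s" and \<delta>: "0 < \<delta>" and a: "0 < a" and l: "0 < l"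
    and F: "\<And>x. x < N \<Longrightarrow> \<bar>F x\<bar> \<le> B0" "\<And>x. x < N \<Longrightarrow> \<bar>grad N F x\<bar> \<le> B1 / real N"
      "\<And>x. x < N \<Longrightarrow> \<bar>lap N F x\<bar> \<le> B2 / (real N)\<^sup>2"
    and small: "l * (a / real N) * B0 \<le> 1 / 2" "\<delta> * l * (a / real N) * B2 \<le> 1 / 2"
  shows "prob (excursion s \<delta> F (e * a)) \<le> 2 * exp (- (l * (a\<^sup>2 / real N) * e / 2)) *
    (exp (\<delta> * l\<^sup>2 * (a\<^sup>2 / real N) * B1\<^sup>2) + 2 * exp (\<delta>\<^sup>2 * l\<^sup>2 * (a\<^sup>2 / real N) * B2\<^sup>2))"
proof -
  have N: "0 < real N" using N_pos by simp
  define k where "k = l * (a / real N)"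
  have k: "0 < k" using a l N by (simp add: k_def)
  define c where "c = (\<lambda>x. k * F x)"
  have c: "\<bar>c x\<bar> \<le> 1 / 2" if "x < N" for x
  proof -
    have "\<bar>c x\<bar> \<le> k * B0" unfolding c_def abs_mult using k F(1)[OF that] by (simp add: mult_left_mono)
    then show ?thesis using small(1) unfolding k_def by linarith
  qed
  have lapc: "\<bar>\<delta> * (real N)\<^sup>2 * lap N c x\<bar> \<le> \<delta> * k * B2" if "x < N" for x
  proof -
    have "\<bar>\<delta> * (real N)\<^sup>2 * lap N c x\<bar> = \<delta> * (real N)\<^sup>2 * (k * \<bar>lap N F x\<bar>)"
      using \<delta> k by (simp add: c_def lap_cmult abs_mult)
    also have "\<dots> \<le> \<delta> * (real N)\<^sup>2 * (k * (B2 / (real N)\<^sup>2))"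
      using \<delta> k F(3)[OF that] by (intro mult_left_mono) auto
    also have "\<dots> = \<delta> * k * B2" using N by simp
    finally show ?thesis .
  qed
  have "energy N F \<le> (\<Sum>x<N. (B1 / real N)\<^sup>2)"
    unfolding energy_def using F(2) by (intro sum_mono square_le_if_abs_le) auto
  then have "(real N)\<^sup>2 * energy N F \<le> (real N)\<^sup>2 * (real N * (B1 / real N)\<^sup>2)"
    by (intro mult_left_mono) auto
  also have "\<dots> = real N * B1\<^sup>2" using N by (simp add: power_divide)
  finally have en: "(real N)\<^sup>2 * energy N F \<le> real N * B1\<^sup>2" .
  have kN: "k\<^sup>2 * real N = l\<^sup>2 * (a\<^sup>2 / real N)"
    using N by (simp add: k_def power_mult_distrib power_divide power2_eq_square)
  have e1: "\<delta> * (real N)\<^sup>2 * energy N c \<le> \<delta> * l\<^sup>2 * (a\<^sup>2 / real N) * B1\<^sup>2"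
  proof -
    have "\<delta> * (real N)\<^sup>2 * energy N c = \<delta> * k\<^sup>2 * ((real N)\<^sup>2 * energy N F)"
      by (simp add: c_def energy_cmult)
    also have "\<dots> \<le> \<delta> * k\<^sup>2 * (real N * B1\<^sup>2)" using \<delta> en by (intro mult_left_mono) auto
    also have "\<dots> = \<delta> * (k\<^sup>2 * real N) * B1\<^sup>2" by simp
    finally show ?thesis unfolding kN by (simp add: mult.assoc)
  qed
  have e2: "(\<Sum>x<N. (\<delta> * (real N)\<^sup>2 * lap N c x)\<^sup>2) \<le> \<delta>\<^sup>2 * l\<^sup>2 * (a\<^sup>2 / real N) * B2\<^sup>2"
  proof -
    have "(\<Sum>x<N. (\<delta> * (real N)\<^sup>2 * lap N c x)\<^sup>2) \<le> (\<Sum>x<N. (\<delta> * k * B2)\<^sup>2)"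
      using lapc by (intro sum_mono square_le_if_abs_le) auto
    also have "\<dots> = \<delta>\<^sup>2 * (k\<^sup>2 * real N) * B2\<^sup>2" by (simp add: power_mult_distrib)
    finally show ?thesis unfolding kN by (simp add: mult.assoc)
  qed
  have ka: "k * (e * a) = 2 * (l * (a\<^sup>2 / real N) * e / 2)" by (simp add: k_def power2_eq_square)
  have "prob (excursion s \<delta> F (e * a)) = prob (excursion s \<delta> c (2 * (l * (a\<^sup>2 / real N) * e / 2)))"
    unfolding c_def ka[symmetric] excursion_scale[OF k] ..
  also have "\<dots> \<le> 2 * exp (- (l * (a\<^sup>2 / real N) * e / 2)) *
      (exp (\<delta> * (real N)\<^sup>2 * energy N c) + 2 * exp (\<Sum>x<N. (\<delta> * (real N)\<^sup>2 * lap N c x)\<^sup>2))"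
  proof (rule excursion_bound[OF s \<delta> c])
    show "\<bar>\<delta> * (real N)\<^sup>2 * lap N c x\<bar> \<le> 1 / 2" if "x < N" for x
      using order_trans[OF lapc[OF that], of "1 / 2"] small(2) unfolding k_def mult.assoc .
  qed
  also have "\<dots> \<le> 2 * exp (- (l * (a\<^sup>2 / real N) * e / 2)) *
      (exp (\<delta> * l\<^sup>2 * (a\<^sup>2 / real N) * B1\<^sup>2) + 2 * exp (\<delta>\<^sup>2 * l\<^sup>2 * (a\<^sup>2 / real N) * B2\<^sup>2))"
    using e1 e2 by (intro mult_left_mono add_mono) auto
  finally show ?thesis .
qed

lemma scaled_tail_bound:
  assumes t: "0 \<le> t" and a: "0 < a" and l: "0 < l"
    and F: "\<And>x. x < N \<Longrightarrow> \<bar>F x\<bar> \<le> B0" and small: "l * (a / real N) * B0 \<le> 1 / 2"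
  shows "{\<omega>\<in>space M. e * a \<le> \<bar>Z t F \<omega>\<bar>} \<in> sets M"
    "prob {\<omega>\<in>space M. e * a \<le> \<bar>Z t F \<omega>\<bar>} \<le> 2 * exp (- (l * (a\<^sup>2 / real N) * e)) * exp (l\<^sup>2 * (a\<^sup>2 / real N) * B0\<^sup>2)"
proof -
  have N: "0 < real N" using N_pos by simp
  define k where "k = l * (a / real N)"
  have k: "0 < k" using a l N by (simp add: k_def)
  define c where "c = (\<lambda>x. k * F x)"
  have cB: "\<bar>c x\<bar> \<le> k * B0" if "x < N" for x
    unfolding c_def abs_mult using k F(1)[OF that] by (simp add: mult_left_mono)
  have c: "\<bar>c x\<bar> \<le> 1 / 2" if "x < N" for x
    using cB[OF that] small unfolding k_def by linarith
  have ka: "k * (e * a) = l * (a\<^sup>2 / real N) * e" by (simp add: k_def power2_eq_square)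
  have "e * a \<le> \<bar>Z t F \<omega>\<bar> \<longleftrightarrow> k * (e * a) \<le> \<bar>Z t c \<omega>\<bar>" for \<omega>
    using k by (simp add: c_def Z_cmult abs_mult)
  then have eq: "{\<omega>\<in>space M. e * a \<le> \<bar>Z t F \<omega>\<bar>} = {\<omega>\<in>space M. l * (a\<^sup>2 / real N) * e \<le> \<bar>Z t c \<omega>\<bar>}"
    by (simp add: ka)
  show "{\<omega>\<in>space M. e * a \<le> \<bar>Z t F \<omega>\<bar>} \<in> sets M" unfolding eq by (rule tail_bound(1)[OF t c])
  have "(\<Sum>x<N. (c x)\<^sup>2) \<le> (\<Sum>x<N. (k * B0)\<^sup>2)"
    using cB by (intro sum_mono square_le_if_abs_le) auto
  also have "\<dots> = l\<^sup>2 * (a\<^sup>2 / real N) * B0\<^sup>2"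
    using N by (simp add: k_def power_mult_distrib power_divide power2_eq_square)
  finally have "2 * exp (- (l * (a\<^sup>2 / real N) * e)) * exp (\<Sum>x<N. (c x)\<^sup>2) \<le>
      2 * exp (- (l * (a\<^sup>2 / real N) * e)) * exp (l\<^sup>2 * (a\<^sup>2 / real N) * B0\<^sup>2)"
    by (intro mult_left_mono) auto
  with tail_bound(2)[where c = c and r = "l * (a\<^sup>2 / real N) * e", OF t c]
  show "prob {\<omega>\<in>space M. e * a \<le> \<bar>Z t F \<omega>\<bar>} \<le> 2 * exp (- (l * (a\<^sup>2 / real N) * e)) * exp (l\<^sup>2 * (a\<^sup>2 / real N) * B0\<^sup>2)"
    unfolding eq by linarith
qed

text \<open>Rounding up costs at most one window and index 0 adds another, whence the count
  \<open>T / \<delta> + 2\<close> in the bounds.\<close>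

definition excursions :: "real \<Rightarrow> real \<Rightarrow> (nat \<Rightarrow> real) \<Rightarrow> real \<Rightarrow> 'w set" where
  "excursions T \<delta> F r = (\<Union>i\<in>{..nat \<lceil>T / \<delta>\<rceil>}. excursion (real i * \<delta>) \<delta> F r)"

lemma grid_index:
  assumes "0 < \<delta>" "t \<in> {0..T}"
  obtains i where "i \<le> nat \<lceil>T / \<delta>\<rceil>" "real i * \<delta> \<le> t" "t < real i * \<delta> + \<delta>"
proof -
  define i where "i = nat \<lfloor>t / \<delta>\<rfloor>"
  have ir: "real i = of_int \<lfloor>t / \<delta>\<rfloor>" using assms by (simp add: i_def)
  have "real i \<le> t / \<delta>" "t / \<delta> < real i + 1" unfolding ir by linarith+
  then have "real i * \<delta> \<le> t" "t < real i * \<delta> + \<delta>" using assms by (simp_all add: field_simps)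
  moreover have "t / \<delta> \<le> T / \<delta>" using assms by (simp add: divide_right_mono)
  then have "i \<le> nat \<lceil>T / \<delta>\<rceil>" unfolding i_def by (intro nat_mono) linarith
  ultimately show ?thesis using that by blast
qed

lemma excursions_sets: "0 < \<delta> \<Longrightarrow> excursions T \<delta> F r \<in> sets M"
  unfolding excursions_def by (intro sets.finite_UN excursion_sets) auto

lemma grid_count: "0 < \<delta> \<Longrightarrow> 0 < T \<Longrightarrow> real (card {..nat \<lceil>T / \<delta>\<rceil>}) \<le> T / \<delta> + 2"
proof -
  assume "0 < \<delta>" "0 < T"
  then have "0 < T / \<delta>" by simp
  then have "real (nat \<lceil>T / \<delta>\<rceil>) = of_int \<lceil>T / \<delta>\<rceil>" by simp
  also have "\<dots> \<le> T / \<delta> + 1" by linarith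
  finally show ?thesis by simp
qed

lemma excursions_prob:
  assumes "0 < \<delta>" "0 < T" "\<And>s. 0 \<le> s \<Longrightarrow> prob (excursion s \<delta> F r) \<le> q"
  shows "prob (excursions T \<delta> F r) \<le> (T / \<delta> + 2) * q"
proof -
  have "0 \<le> q" using assms(3)[of 0] measure_nonneg[of M] by (meson order_refl order_trans)
  have "prob (excursions T \<delta> F r) \<le> (\<Sum>i\<in>{..nat \<lceil>T / \<delta>\<rceil>}. prob (excursion (real i * \<delta>) \<delta> F r))"
    unfolding excursions_def using assms by (intro measure_UNION_le excursion_sets) auto
  also have "\<dots> \<le> (\<Sum>i\<in>{..nat \<lceil>T / \<delta>\<rceil>}. q)" using assms by (intro sum_mono) auto
  also have "\<dots> = real (card {..nat \<lceil>T / \<delta>\<rceil>}) * q" by simp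
  also have "\<dots> \<le> (T / \<delta> + 2) * q"
    using grid_count[OF assms(1,2)] \<open>0 \<le> q\<close> by (intro mult_right_mono)
  finally show ?thesis .
qed

lemma excursions_grid:
  assumes \<omega>: "\<omega> \<in> space M" "\<omega> \<notin> excursions T \<delta> F r" and \<delta>: "0 < \<delta>" and i: "i \<le> nat \<lceil>T / \<delta>\<rceil>"
    and t: "real i * \<delta> \<le> t" "t \<le> real i * \<delta> + \<delta>"
  shows "\<bar>Z t F \<omega> - Z (real i * \<delta>) F \<omega>\<bar> \<le> r"
  using \<omega> i \<delta> by (intro excursion_complement[OF \<omega>(1) _ _ \<delta> t]) (auto simp: excursions_def)

text \<open>Times closer than \<open>\<delta>\<close> lie in the same window or in adjacent ones: at
  most two increments from a window start and one across a full window.\<close>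

lemma excursions_osc:
  assumes \<omega>: "\<omega> \<in> space M" "\<omega> \<notin> excursions T \<delta> F r" and \<delta>: "0 < \<delta>"
    and st: "s \<in> {0..T}" "t \<in> {0..T}" "\<bar>s - t\<bar> < \<delta>"
  shows "\<bar>Z s F \<omega> - Z t F \<omega>\<bar> \<le> 3 * r"
proof -
  have le: "\<bar>Z s F \<omega> - Z t F \<omega>\<bar> \<le> 3 * r" if st: "s \<in> {0..T}" "t \<in> {0..T}" "s \<le> t" "t < s + \<delta>" for s t
  proof -
    obtain i where i: "i \<le> nat \<lceil>T / \<delta>\<rceil>" "real i * \<delta> \<le> s" "s < real i * \<delta> + \<delta>"
      by (rule grid_index[OF \<delta> st(1)])
    obtain j where j: "j \<le> nat \<lceil>T / \<delta>\<rceil>" "real j * \<delta> \<le> t" "t < real j * \<delta> + \<delta>"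
      by (rule grid_index[OF \<delta> st(2)])
    note a = excursions_grid[OF \<omega> \<delta>]
    have 1: "\<bar>Z s F \<omega> - Z (real i * \<delta>) F \<omega>\<bar> \<le> r" using a[OF i(1,2)] i by simp
    have 2: "\<bar>Z t F \<omega> - Z (real j * \<delta>) F \<omega>\<bar> \<le> r" using a[OF j(1,2)] j by simp
    have 3: "\<bar>Z (real i * \<delta> + \<delta>) F \<omega> - Z (real i * \<delta>) F \<omega>\<bar> \<le> r" using a[OF i(1), of "real i * \<delta> + \<delta>"] \<delta> by simp
    have "real i * \<delta> < (real j + 1) * \<delta>" using i j st by (simp add: algebra_simps)
    then have "real i < real j + 1" using \<delta> by simp
    moreover have "real j * \<delta> < (real i + 2) * \<delta>" using i j st by (simp add: algebra_simps)
    then have "real j < real i + 2" using \<delta> by simp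
    ultimately consider "j = i" | "j = Suc i" by linarith
    then show ?thesis
    proof cases
      case 1
      with \<open>\<bar>Z s F \<omega> - _\<bar> \<le> r\<close> 2 3 show ?thesis by auto
    next
      case 2
      then have "real j * \<delta> = real i * \<delta> + \<delta>" by (simp add: algebra_simps)
      with \<open>\<bar>Z s F \<omega> - _\<bar> \<le> r\<close> \<open>\<bar>Z t F \<omega> - _\<bar> \<le> r\<close> 3 show ?thesis by auto
    qed
  qed
  show ?thesis
  proof (cases "s \<le> t")
    case True then show ?thesis using le[of s t] st by auto
  next
    case False then show ?thesis using le[of t s] st by (auto simp: abs_minus_commute)
  qed
qed

lemma density_field_Z:
  "t \<in> {0..T} \<Longrightarrow> f \<in> torus_smooth \<Longrightarrow> density_field T N a M X \<omega> t f = Z t (sampled N f) \<omega> / a"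
  by (simp add: density_field_eq field_def conf_field_def Z_def pairing_def sampled_def mult.commute)

lemma modulus_event:
  assumes T: "0 < T" and a: "0 < a" and f: "f \<in> torus_smooth" and \<delta>: "0 < \<delta>" and l: "0 < l"
    and B: "\<And>x. \<bar>f x\<bar> \<le> B0" "\<And>x. \<bar>(deriv ^^ 1) f x\<bar> \<le> B1" "\<And>x. \<bar>(deriv ^^ 2) f x\<bar> \<le> B2"
    and small: "l * (a / real N) * B0 \<le> 1 / 2" "\<delta> * l * (a / real N) * B2 \<le> 1 / 2"
  shows "\<exists>S\<in>sets M. prob S \<le> (T / \<delta> + 2) * (2 * exp (- (l * (a\<^sup>2 / real N) * e / 2)) *
      (exp (\<delta> * l\<^sup>2 * (a\<^sup>2 / real N) * B1\<^sup>2) + 2 * exp (\<delta>\<^sup>2 * l\<^sup>2 * (a\<^sup>2 / real N) * B2\<^sup>2))) \<and>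
    (\<forall>\<omega>\<in>space M - S. osc_le T (density_field T N a M X \<omega>) f \<delta> (3 * e))"
proof -
  have per: "f (u + 1) = f u" for u using f by (simp add: torus_smooth_def)
  have D: "(f has_field_derivative (deriv ^^ 1) f x) (at x)"
    "((deriv ^^ 1) f has_field_derivative (deriv ^^ 2) f x) (at x)" for x
    using smooth_DERIV[OF f, of 0 x] smooth_DERIV[OF f, of 1 x] by (simp_all add: numeral_2_eq_2)
  note diff = sampled_differences[OF N_pos _ per D B(2,3)]
  let ?S = "excursions T \<delta> (sampled N f) (e * a)"
  have "prob ?S \<le> (T / \<delta> + 2) * (2 * exp (- (l * (a\<^sup>2 / real N) * e / 2)) *
      (exp (\<delta> * l\<^sup>2 * (a\<^sup>2 / real N) * B1\<^sup>2) + 2 * exp (\<delta>\<^sup>2 * l\<^sup>2 * (a\<^sup>2 / real N) * B2\<^sup>2)))"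
    by (intro excursions_prob \<delta> T scaled_excursion_bound[OF _ \<delta> a l _ diff small])
      (auto simp: sampled_def B)
  moreover have "osc_le T (density_field T N a M X \<omega>) f \<delta> (3 * e)" if "\<omega> \<in> space M - ?S" for \<omega>
    unfolding osc_le_def
  proof (intro ballI impI)
    fix s t assume st: "s \<in> {0..T}" "t \<in> {0..T}" "\<bar>s - t\<bar> < \<delta>"
    have "\<bar>Z s (sampled N f) \<omega> - Z t (sampled N f) \<omega>\<bar> \<le> 3 * (e * a)"
      using excursions_osc[OF _ _ \<delta> st] that by blast
    then have "\<bar>Z s (sampled N f) \<omega> - Z t (sampled N f) \<omega>\<bar> / a \<le> 3 * (e * a) / a"
      using a by (intro divide_right_mono) auto
    then show "\<bar>density_field T N a M X \<omega> s f - density_field T N a M X \<omega> t f\<bar> \<le> 3 * e"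
      using a st f by (simp add: density_field_Z diff_divide_distrib[symmetric] abs_divide)
  qed
  ultimately show ?thesis using excursions_sets[OF \<delta>] by blast
qed


text \<open>Half of the permitted size is granted to the values at window starts, controlled by the
  fixed-time tail, and half to the excursion inside a window. The slope is \<open>l = 1\<close>, so
  the decay in \<open>k\<close> comes from the threshold alone.\<close>

lemma mode_event:
  fixes k :: nat
  assumes T: "0 < T" and a: "0 < a" and A: "0 < A" and aN: "a / real N \<le> 1 / 2"
    and F: "\<And>x. x < N \<Longrightarrow> \<bar>F x\<bar> \<le> 1" "\<And>x. x < N \<Longrightarrow> \<bar>grad N F x\<bar> \<le> 2 * pi * (1 + real k) / real N"
      "\<And>x. x < N \<Longrightarrow> \<bar>lap N F x\<bar> \<le> (2 * pi * (1 + real k))\<^sup>2 / (real N)\<^sup>2"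
  shows "\<exists>S\<in>sets M. prob S \<le> 8 * (T * (2 * pi * (1 + real k))\<^sup>2 + 2) *
      exp (a\<^sup>2 / real N * (1 - A * sqrt (1 + real k) / 4)) \<and>
    (\<forall>\<omega>\<in>space M - S. \<forall>t\<in>{0..T}. \<bar>Z t F \<omega>\<bar> \<le> A * a * sqrt (1 + real k))"
proof -
  define b where "b = a\<^sup>2 / real N"
  have b: "0 \<le> b" by (simp add: b_def)
  define \<kappa> where "\<kappa> = (2 * pi * (1 + real k))\<^sup>2"
  have \<kappa>: "0 < \<kappa>" by (simp add: \<kappa>_def)
  \<comment> \<open>The window is the relaxation time of the mode: with
    \<open>\<delta> * \<kappa> = 1\<close> both loss exponents equal \<open>b\<close>, whatever
    \<open>k\<close> is.\<close>
  define \<delta> where "\<delta> = 1 / \<kappa>"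
  have \<delta>: "0 < \<delta>" "\<delta> * \<kappa> = 1" using \<kappa> by (simp_all add: \<delta>_def)
  define e where "e = A * sqrt (1 + real k) / 2"
  have e: "0 \<le> e" using A by (simp add: e_def)
  define J where "J = nat \<lceil>T / \<delta>\<rceil>"
  define S1 where "S1 = excursions T \<delta> F (e * a)"
  define S2 where "S2 = (\<Union>i\<in>{..J}. {\<omega>\<in>space M. e * a \<le> \<bar>Z (real i * \<delta>) F \<omega>\<bar>})"
  define E0 where "E0 = exp (b * (1 - A * sqrt (1 + real k) / 4))"
  have pos: "0 \<le> real i * \<delta>" for i using \<delta> by simp
  have small: "1 * (a / real N) * 1 \<le> 1 / 2" "\<delta> * 1 * (a / real N) * \<kappa> \<le> 1 / 2"
  proof -
    have eq: "\<delta> * 1 * (a / real N) * \<kappa> = (\<delta> * \<kappa>) * (a / real N)" by simp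
    show "\<delta> * 1 * (a / real N) * \<kappa> \<le> 1 / 2" unfolding eq \<delta>(2) using aN by simp
  qed (use aN in simp)
  have S1m: "S1 \<in> sets M" unfolding S1_def by (rule excursions_sets[OF \<delta>(1)])
  have S2m: "{\<omega>\<in>space M. e * a \<le> \<bar>Z (real i * \<delta>) F \<omega>\<bar>} \<in> sets M" for i
    by (rule scaled_tail_bound(1)[OF pos a zero_less_one F(1) small(1)])
  have E1: "exp (- (b * e / 2)) * exp b = E0"
    unfolding mult_exp_exp E0_def e_def by (rule arg_cong[where f = exp]) (simp add: algebra_simps)
  have p1: "prob (excursion s \<delta> F (e * a)) \<le> 6 * E0" if s: "0 \<le> s" for s
  proof -
    have "prob (excursion s \<delta> F (e * a)) \<le> 2 * exp (- (1 * (a\<^sup>2 / real N) * e / 2)) *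
      (exp (\<delta> * 1\<^sup>2 * (a\<^sup>2 / real N) * (2 * pi * (1 + real k))\<^sup>2) + 2 * exp (\<delta>\<^sup>2 * 1\<^sup>2 * (a\<^sup>2 / real N) * \<kappa>\<^sup>2))"
      by (rule scaled_excursion_bound[OF s \<delta>(1) a zero_less_one F(1,2) F(3)[folded \<kappa>_def] small])
    also have "\<delta> * 1\<^sup>2 * (a\<^sup>2 / real N) * (2 * pi * (1 + real k))\<^sup>2 = (\<delta> * \<kappa>) * b" by (simp add: b_def \<kappa>_def)
    also have "\<delta>\<^sup>2 * 1\<^sup>2 * (a\<^sup>2 / real N) * \<kappa>\<^sup>2 = (\<delta> * \<kappa>)\<^sup>2 * b" by (simp add: b_def power_mult_distrib)
    also have "2 * exp (- (1 * (a\<^sup>2 / real N) * e / 2)) * (exp ((\<delta> * \<kappa>) * b) + 2 * exp ((\<delta> * \<kappa>)\<^sup>2 * b)) =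
        6 * (exp (- (b * e / 2)) * exp b)"
      unfolding \<delta>(2) by (simp add: b_def)
    finally show ?thesis unfolding E1 .
  qed
  have P1: "prob S1 \<le> (T / \<delta> + 2) * (6 * E0)"
    unfolding S1_def by (rule excursions_prob[OF \<delta>(1) T p1])
  have p2: "prob {\<omega>\<in>space M. e * a \<le> \<bar>Z (real i * \<delta>) F \<omega>\<bar>} \<le> 2 * E0" for i
  proof -
    have "prob {\<omega>\<in>space M. e * a \<le> \<bar>Z (real i * \<delta>) F \<omega>\<bar>} \<le>
        2 * exp (- (1 * (a\<^sup>2 / real N) * e)) * exp (1\<^sup>2 * (a\<^sup>2 / real N) * 1\<^sup>2)"
      by (rule scaled_tail_bound(2)[OF pos a zero_less_one F(1) small(1)])
    also have "\<dots> = 2 * (exp (- (b * e)) * exp b)" by (simp add: b_def)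
    also have "\<dots> \<le> 2 * (exp (- (b * e / 2)) * exp b)"
      using b e by (intro mult_left_mono mult_right_mono) auto
    finally show ?thesis unfolding E1 .
  qed
  have P2: "prob S2 \<le> (T / \<delta> + 2) * (2 * E0)"
  proof -
    have "prob S2 \<le> (\<Sum>i\<in>{..J}. prob {\<omega>\<in>space M. e * a \<le> \<bar>Z (real i * \<delta>) F \<omega>\<bar>})"
      unfolding S2_def using S2m by (intro measure_UNION_le) auto
    also have "\<dots> \<le> (\<Sum>i\<in>{..J}. 2 * E0)" by (intro sum_mono p2)
    also have "\<dots> = real (card {..J}) * (2 * E0)" by simp
    also have "\<dots> \<le> (T / \<delta> + 2) * (2 * E0)"
      using grid_count[OF \<delta>(1) T] by (intro mult_right_mono) (auto simp: J_def E0_def)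
    finally show ?thesis .
  qed
  have S2s: "S2 \<in> sets M" unfolding S2_def using S2m by (intro sets.finite_UN) auto
  have "prob (S1 \<union> S2) \<le> (T / \<delta> + 2) * (6 * E0) + (T / \<delta> + 2) * (2 * E0)"
    using measure_Un_le[OF S1m S2s] P1 P2 by linarith
  also have "\<dots> = 8 * (T * \<kappa> + 2) * E0" by (simp add: \<delta>_def algebra_simps)
  finally have P: "prob (S1 \<union> S2) \<le> 8 * (T * \<kappa> + 2) * E0" .
  have "\<bar>Z t F \<omega>\<bar> \<le> A * a * sqrt (1 + real k)" if \<omega>: "\<omega> \<in> space M - (S1 \<union> S2)" and t: "t \<in> {0..T}" for \<omega> t
  proof -
    obtain i where i: "i \<le> nat \<lceil>T / \<delta>\<rceil>" "real i * \<delta> \<le> t" "t < real i * \<delta> + \<delta>"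
      by (rule grid_index[OF \<delta>(1) t])
    have "\<bar>Z t F \<omega> - Z (real i * \<delta>) F \<omega>\<bar> \<le> e * a"
      using excursions_grid[OF _ _ \<delta>(1) i(1,2), of \<omega> F "e * a"] \<omega> i(3) by (auto simp: S1_def)
    moreover have "\<bar>Z (real i * \<delta>) F \<omega>\<bar> < e * a"
      using \<omega> i(1) by (auto simp: S2_def J_def not_le)
    ultimately have "\<bar>Z t F \<omega>\<bar> \<le> 2 * (e * a)" by linarith
    then show ?thesis by (simp add: e_def mult_ac)
  qed
  then show ?thesis
    using P S1m S2s unfolding \<kappa>_def E0_def b_def by (intro bexI[of _ "S1 \<union> S2"]) auto
qed

text \<open>Stating the bounds with \<open>1 + k\<close> instead of \<open>k\<close> keeps the
  window length of \<open>mode_event\<close> finite for the constant mode as well.\<close>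

lemma wave_differences:
  fixes k :: nat
  assumes x: "x < N"
  shows "\<bar>grad N (\<lambda>x. cos (2 * pi * real k * (real x / real N))) x\<bar> \<le> 2 * pi * (1 + real k) / real N"
    "\<bar>lap N (\<lambda>x. cos (2 * pi * real k * (real x / real N))) x\<bar> \<le> (2 * pi * (1 + real k))\<^sup>2 / (real N)\<^sup>2"
    "\<bar>grad N (\<lambda>x. sin (2 * pi * real k * (real x / real N))) x\<bar> \<le> 2 * pi * (1 + real k) / real N"
    "\<bar>lap N (\<lambda>x. sin (2 * pi * real k * (real x / real N))) x\<bar> \<le> (2 * pi * (1 + real k))\<^sup>2 / (real N)\<^sup>2"
proof -
  define w where "w = 2 * pi * real k"
  have w: "0 \<le> w" "w \<le> 2 * pi * (1 + real k)" by (simp_all add: w_def)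
  then have w2: "w\<^sup>2 \<le> (2 * pi * (1 + real k))\<^sup>2" by (intro power_mono) auto
  have shift: "w * (u + 1) = w * u + 2 * real k * pi" for u by (simp add: w_def algebra_simps)
  have per: "cos (w * (u + 1)) = cos (w * u)" "sin (w * (u + 1)) = sin (w * u)" for u
    unfolding shift cos_add sin_add by simp_all
  have D: "((\<lambda>u. cos (w * u)) has_field_derivative - w * sin (w * x)) (at x)"
    "((\<lambda>u. sin (w * u)) has_field_derivative w * cos (w * x)) (at x)"
    "((\<lambda>u. - w * sin (w * u)) has_field_derivative - w\<^sup>2 * cos (w * x)) (at x)"
    "((\<lambda>u. w * cos (w * u)) has_field_derivative - w\<^sup>2 * sin (w * x)) (at x)" for x
    by (auto intro!: derivative_eq_intros simp: power2_eq_square)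
  have le1: "w * \<bar>y\<bar> \<le> 2 * pi * (1 + real k)" "w\<^sup>2 * \<bar>y\<bar> \<le> (2 * pi * (1 + real k))\<^sup>2" if "\<bar>y\<bar> \<le> 1" for y :: real
  proof -
    have "w * \<bar>y\<bar> \<le> w * 1" "w\<^sup>2 * \<bar>y\<bar> \<le> w\<^sup>2 * 1" using w that by (intro mult_left_mono; simp)+
    then show "w * \<bar>y\<bar> \<le> 2 * pi * (1 + real k)" "w\<^sup>2 * \<bar>y\<bar> \<le> (2 * pi * (1 + real k))\<^sup>2" using w w2 by linarith+
  qed
  have B: "\<bar>- w * sin (w * x)\<bar> \<le> 2 * pi * (1 + real k)" "\<bar>w * cos (w * x)\<bar> \<le> 2 * pi * (1 + real k)"
    "\<bar>- w\<^sup>2 * cos (w * x)\<bar> \<le> (2 * pi * (1 + real k))\<^sup>2" "\<bar>- w\<^sup>2 * sin (w * x)\<bar> \<le> (2 * pi * (1 + real k))\<^sup>2" for x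
    using le1[of "sin (w * x)"] le1[of "cos (w * x)"] w by (simp_all add: abs_mult)
  have c: "(\<lambda>x. cos (2 * pi * real k * (real x / real N))) = sampled N (\<lambda>u. cos (w * u))"
    "(\<lambda>x. sin (2 * pi * real k * (real x / real N))) = sampled N (\<lambda>u. sin (w * u))"
    by (simp_all add: sampled_def w_def fun_eq_iff)
  show "\<bar>grad N (\<lambda>x. cos (2 * pi * real k * (real x / real N))) x\<bar> \<le> 2 * pi * (1 + real k) / real N"
    "\<bar>lap N (\<lambda>x. cos (2 * pi * real k * (real x / real N))) x\<bar> \<le> (2 * pi * (1 + real k))\<^sup>2 / (real N)\<^sup>2"
    unfolding c by (rule sampled_differences[OF N_pos x per(1) D(1,3) B(1,3)])+
  show "\<bar>grad N (\<lambda>x. sin (2 * pi * real k * (real x / real N))) x\<bar> \<le> 2 * pi * (1 + real k) / real N"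
    "\<bar>lap N (\<lambda>x. sin (2 * pi * real k * (real x / real N))) x\<bar> \<le> (2 * pi * (1 + real k))\<^sup>2 / (real N)\<^sup>2"
    unfolding c by (rule sampled_differences[OF N_pos x per(2) D(2,4) B(2,4)])+
qed

text \<open>Outside the bad events of the modes up to \<open>N\<close>,
  \<open>fourier_controls\<close> with \<open>D = A * a\<close> bounds all test functions at once.
  The factor 16 counts the cosine and the sine mode.\<close>

lemma bounded_event:
  assumes T: "0 < T" and a: "0 < a" and A: "0 < A" and aN: "a / real N \<le> 1 / 2" and C: "fourier_controls C"
  shows "\<exists>S\<in>sets M. prob S \<le> (\<Sum>k\<le>N. 16 * (T * (2 * pi * (1 + real k))\<^sup>2 + 2) *
      exp (a\<^sup>2 / real N * (1 - A * sqrt (1 + real k) / 4))) \<and>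
    (\<forall>\<omega>\<in>space M - S. field_bounded T (C * A) (density_field T N a M X \<omega>))"
proof -
  define q where "q k = 8 * (T * (2 * pi * (1 + real k))\<^sup>2 + 2) *
      exp (a\<^sup>2 / real N * (1 - A * sqrt (1 + real k) / 4))" for k :: nat
  have dbl: "2 * (8 * u * v) = 16 * u * v" for u v :: real by simp
  let ?c = "\<lambda>k x. cos (2 * pi * real k * (real x / real N))"
  let ?s = "\<lambda>k x. sin (2 * pi * real k * (real x / real N))"
  have "\<exists>S\<in>sets M. prob S \<le> q k \<and> (\<forall>\<omega>\<in>space M - S. \<forall>t\<in>{0..T}. \<bar>Z t (?c k) \<omega>\<bar> \<le> A * a * sqrt (1 + real k))" for k :: nat
    unfolding q_def by (rule mode_event[OF T a A aN _ wave_differences(1) wave_differences(2)]) auto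
  then obtain S1 where S1: "\<And>k. S1 k \<in> sets M" "\<And>k. prob (S1 k) \<le> q k"
    "\<And>k \<omega> t. \<omega> \<in> space M - S1 k \<Longrightarrow> t \<in> {0..T} \<Longrightarrow> \<bar>Z t (?c k) \<omega>\<bar> \<le> A * a * sqrt (1 + real k)"
    by metis
  have "\<exists>S\<in>sets M. prob S \<le> q k \<and> (\<forall>\<omega>\<in>space M - S. \<forall>t\<in>{0..T}. \<bar>Z t (?s k) \<omega>\<bar> \<le> A * a * sqrt (1 + real k))" for k :: nat
    unfolding q_def by (rule mode_event[OF T a A aN _ wave_differences(3) wave_differences(4)]) auto
  then obtain S2 where S2: "\<And>k. S2 k \<in> sets M" "\<And>k. prob (S2 k) \<le> q k"
    "\<And>k \<omega> t. \<omega> \<in> space M - S2 k \<Longrightarrow> t \<in> {0..T} \<Longrightarrow> \<bar>Z t (?s k) \<omega>\<bar> \<le> A * a * sqrt (1 + real k)"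
    by metis
  define S where "S = (\<Union>k\<in>{..N}. S1 k \<union> S2 k)"
  have S: "S \<in> sets M" unfolding S_def using S1 S2 by (intro sets.finite_UN) auto
  have "prob S \<le> (\<Sum>k\<in>{..N}. prob (S1 k \<union> S2 k))"
    unfolding S_def using S1 S2 by (intro measure_UNION_le) auto
  also have "\<dots> \<le> (\<Sum>k\<in>{..N}. 2 * q k)"
  proof (rule sum_mono)
    fix k show "prob (S1 k \<union> S2 k) \<le> 2 * q k"
      using measure_Un_le[OF S1(1)[of k] S2(1)[of k]] S1(2)[of k] S2(2)[of k] by linarith
  qed
  finally have P: "prob S \<le> (\<Sum>k\<le>N. 16 * (T * (2 * pi * (1 + real k))\<^sup>2 + 2) *
      exp (a\<^sup>2 / real N * (1 - A * sqrt (1 + real k) / 4)))"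
    unfolding q_def by (simp only: dbl)
  have "field_bounded T (C * A) (density_field T N a M X \<omega>)" if \<omega>: "\<omega> \<in> space M - S" for \<omega>
    unfolding field_bounded_def
  proof (intro ballI conjI allI impI)
    fix t assume t: "t \<in> {0..T}"
    show "density_field T N a M X \<omega> t \<in> torus_distributions"
      using t conf_field_distribution by (simp add: density_field_eq field_def)
    fix f B assume f: "f \<in> torus_smooth" and fB: "c2_bounded B f"
    let ?z = "\<lambda>x. real (X t \<omega> x) - m t x"
    have B0: "0 \<le> B" using fB abs_ge_zero order_trans unfolding c2_bounded_def by blast
    have per: "f (u + 1) = f u" for u using f by (simp add: torus_smooth_def)
    have D: "(f has_field_derivative (deriv ^^ 1) f x) (at x)"
      "((deriv ^^ 1) f has_field_derivative (deriv ^^ 2) f x) (at x)" for x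
      using smooth_DERIV[OF f, of 0 x] smooth_DERIV[OF f, of 1 x] by (simp_all add: numeral_2_eq_2)
    obtain B1 where B1: "\<forall>x. \<bar>(deriv ^^ 1) f x\<bar> \<le> B1" using smooth_bounded[OF f] by blast
    have F: "\<forall>x<N. \<bar>sampled N f x\<bar> \<le> B" using fB by (simp add: sampled_def c2_bounded_def)
    have L: "\<forall>x<N. \<bar>lap N (sampled N f) x\<bar> \<le> B / (real N)\<^sup>2"
      using sampled_differences(2)[OF N_pos _ per D spec[OF B1], of _ B] fB by (simp add: c2_bounded_def)
    have Aa: "0 \<le> A * a" using A a by simp
    have c: "\<forall>k\<le>N. \<bar>pairing N (?c k) ?z\<bar> \<le> A * a * sqrt (1 + real k)"
      using S1(3)[of \<omega> _ t] \<omega> t unfolding S_def Z_def by blast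
    have s: "\<forall>k\<le>N. \<bar>pairing N (?s k) ?z\<bar> \<le> A * a * sqrt (1 + real k)"
      using S2(3)[of \<omega> _ t] \<omega> t unfolding S_def Z_def by blast
    have "\<bar>pairing N (sampled N f) ?z\<bar> \<le> C * (A * a) * B"
      using C[unfolded fourier_controls_def] N_pos B0 Aa c s F L by simp
    then have "\<bar>Z t (sampled N f) \<omega>\<bar> / a \<le> C * (A * a) * B / a"
      using a unfolding Z_def by (intro divide_right_mono) auto
    then show "\<bar>density_field T N a M X \<omega> t f\<bar> \<le> C * A * B"
      using a by (simp add: density_field_Z[OF t f] abs_divide)
  qed
  then show ?thesis using S P by blast
qed

text \<open>The separation \<open>n\<close> of the jumps may depend on the process and on
  \<open>\<eta>\<close>, so plain continuity of the measure suffices and no rate in \<open>N\<close>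
  enters.\<close>

lemma tight_single:
  assumes T: "0 < T" and \<eta>: "0 < \<eta>"
  shows "\<exists>R\<subseteq>cadlag_paths T.
    (\<forall>s. (\<forall>j::nat. s j \<in> R) \<longrightarrow> (\<exists>r x. strict_mono r \<and> x \<in> R \<and>
      skorokhod_converges T (\<lambda>j. s (r j)) x)) \<and>
    (\<exists>S\<in>sets M. prob S < \<eta> \<and> (\<forall>\<omega>\<in>space M - S. density_field T N a M X \<omega> \<in> R))"
proof -
  obtain n where n: "prob {\<omega>\<in>space M. \<not> step_path T n (\<lambda>t. X t \<omega>)} < \<eta>"
    using step_probability[OF T \<eta>] by blast
  define R where "R = {field T a \<xi> | \<xi>. step_path T n \<xi> \<and> (\<forall>t\<in>{0..T}. \<xi> t \<in> E)}"
  show ?thesis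
  proof (intro exI[of _ R] conjI allI impI)
    show "R \<subseteq> cadlag_paths T" unfolding R_def using step_field_cadlag by blast
    fix s :: "nat \<Rightarrow> real \<Rightarrow> (real \<Rightarrow> real) \<Rightarrow> real" assume s: "\<forall>j. s j \<in> R"
    then have "\<forall>j. \<exists>\<xi>. s j = field T a \<xi> \<and> step_path T n \<xi> \<and> (\<forall>t\<in>{0..T}. \<xi> t \<in> E)"
      unfolding R_def by blast
    then obtain \<xi> where \<xi>: "\<And>j. s j = field T a (\<xi> j)" "\<And>j. step_path T n (\<xi> j)" "\<And>j t. t \<in> {0..T} \<Longrightarrow> \<xi> j t \<in> E"
      by metis
    obtain r \<xi>' where r: "strict_mono (r :: nat \<Rightarrow> nat)" "step_path T n \<xi>'" "\<forall>t\<in>{0..T}. \<xi>' t \<in> E"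
      "skorokhod_converges T (\<lambda>j. field T a (\<xi> (r j))) (field T a \<xi>')"
      using step_fields_seq_compact[where \<xi> = \<xi> and a = a, OF T \<xi>(2,3)] by blast
    have "field T a \<xi>' \<in> R" using r unfolding R_def by blast
    then show "\<exists>r x. strict_mono r \<and> x \<in> R \<and>
      skorokhod_converges T (\<lambda>j. s (r j)) x"
      using r(1,4) unfolding \<xi>(1) by blast
  next
    have "{\<omega>\<in>space M. \<not> step_path T n (\<lambda>t. X t \<omega>)} = space M - {\<omega>\<in>space M. step_path T n (\<lambda>t. X t \<omega>)}" by auto
    then have S: "{\<omega>\<in>space M. \<not> step_path T n (\<lambda>t. X t \<omega>)} \<in> sets M"
      using step_event[OF T] by (metis sets.compl_sets)
    show "\<exists>S\<in>sets M. prob S < \<eta> \<and> (\<forall>\<omega>\<in>space M - S. density_field T N a M X \<omega> \<in> R)"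
    proof (intro bexI[OF _ S] conjI n ballI)
      fix \<omega> assume "\<omega> \<in> space M - {\<omega>\<in>space M. \<not> step_path T n (\<lambda>t. X t \<omega>)}"
      then show "density_field T N a M X \<omega> \<in> R"
        unfolding R_def density_field_eq using X_in by fastforce
    qed
  qed
qed

end

section \<open>Constants uniform in the process and in \<open>N\<close>\<close>

lemma markov_process_exclusion:
  assumes "markov_process M (configurations N) (exclusion_generator N) X" "1 \<le> N"
    and "prob_space.indep_vars M (\<lambda>_. count_space UNIV) (\<lambda>x \<omega>. X 0 \<omega> x) {..<N}"
  shows "\<exists>p. exclusion_process M N p X"
proof -
  obtain p where p: "transition_function (configurations N) p" "has_generator (configurations N) p (exclusion_generator N)"
    "\<forall>n (t :: nat \<Rightarrow> real) s. 0 \<le> t 0 \<and> (\<forall>i\<le>n. t i < t (Suc i)) \<and> (\<forall>i\<le>Suc n. s i \<in> configurations N) \<longrightarrow>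
         measure M {\<omega> \<in> space M. \<forall>i\<le>Suc n. X (t i) \<omega> = s i} =
         measure M {\<omega> \<in> space M. \<forall>i\<le>n. X (t i) \<omega> = s i} * p (t (Suc n) - t n) (s n) (s (Suc n))"
    using assms(1) unfolding markov_process_def by blast
  interpret prob_space M using assms(1) by (simp add: markov_process_def)
  have "exclusion_process M N p X"
  proof
    show "X t \<in> measurable M (count_space (configurations N))" if "0 \<le> t" for t
      using assms(1) that by (simp add: markov_process_def)
    show "cadlag_on (discrete_topology (configurations N)) {0..} (\<lambda>t. X t \<omega>)" if "\<omega> \<in> space M" for \<omega>
      using assms(1) that by (simp add: markov_process_def)
    show "prob {\<omega> \<in> space M. \<forall>i\<le>Suc n. X (t i) \<omega> = s i} =
         prob {\<omega> \<in> space M. \<forall>i\<le>n. X (t i) \<omega> = s i} * p (t (Suc n) - t n) (s n) (s (Suc n))"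
      if "0 \<le> t 0" "\<And>i. i \<le> n \<Longrightarrow> t i < t (Suc i)" "\<And>i. i \<le> Suc n \<Longrightarrow> s i \<in> configurations N"
      for t :: "nat \<Rightarrow> real" and n s
      using p(3) that by blast
  qed (use assms p finite_configurations in auto)
  then show ?thesis by blast
qed

text \<open>\<open>A\<close> is fixed before the process, so a single bound serves all large
  \<open>N\<close>.\<close>

lemma uniform_bounded_event:
  assumes T: "0 < T" and L: "0 \<le> L"
  obtains A where "0 \<le> A" "\<And>(M :: 'w measure) N p X a. exclusion_process M N p X \<Longrightarrow> 0 < a \<Longrightarrow>
    a / real N \<le> 1 / 2 \<Longrightarrow> 1 \<le> a\<^sup>2 / real N \<Longrightarrow>
    \<exists>S\<in>sets M. measure M S \<le> exp (- (L * (a\<^sup>2 / real N))) / 4 \<and>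
      (\<forall>\<omega>\<in>space M - S. field_bounded T A (density_field T N a M X \<omega>))"
proof -
  obtain C where C: "fourier_controls C" using fourier_bound by blast
  define Q where "Q = 16 * (4 * pi\<^sup>2 * T + 2)"
  have Q: "0 \<le> Q" using T by (simp add: Q_def)
  obtain s where s: "0 < s" "\<And>n. (\<Sum>k\<le>n. Q * (1 + real k)\<^sup>2 * exp (- (s * sqrt (1 + real k)))) \<le> 1 / 4"
    using small_exponential_sum[of "1/4" Q] Q by auto
  \<comment> \<open>After division by 4, the part \<open>1 + L\<close> pays for the loss
    \<open>b\<close> and yields the rate \<open>L\<close>, and the part \<open>s\<close> gives
    summability in \<open>k\<close>, using \<open>1 \<le> b\<close>.\<close>
  define A where "A = 4 * (1 + L) + 4 * s"
  have A: "0 < A" using s L by (simp add: A_def)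
  show ?thesis
  proof
    show "0 \<le> C * A" using C A by (simp add: fourier_controls_def)
    fix M :: "'w measure" and N p X a
    assume ep: "exclusion_process M N p X" and a: "0 < a" "a / real N \<le> 1 / 2" and b1: "1 \<le> a\<^sup>2 / real N"
    interpret exclusion_process M N p X by fact
    define b where "b = a\<^sup>2 / real N"
    have b: "1 \<le> b" using b1 by (simp add: b_def)
    have summand: "16 * (T * (2 * pi * (1 + real k))\<^sup>2 + 2) * exp (b * (1 - A * sqrt (1 + real k) / 4)) \<le>
        exp (- (L * b)) * (Q * (1 + real k)\<^sup>2 * exp (- (s * sqrt (1 + real k))))" for k
    proof -
      define r where "r = sqrt (1 + real k)"
      have r: "1 \<le> r" by (simp add: r_def)
      have "1 * (s * r) \<le> b * (s * r)" using b s r by (intro mult_right_mono) auto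
      moreover have "b * ((1 + L) * 1) \<le> b * ((1 + L) * r)" using b L r by (intro mult_left_mono) auto
      ultimately have "b * (1 - A * r / 4) \<le> - (L * b) + - (s * r)" by (simp add: A_def algebra_simps)
      then have 1: "exp (b * (1 - A * r / 4)) \<le> exp (- (L * b)) * exp (- (s * r))"
        by (simp flip: exp_add)
      have "2 * 1 \<le> 2 * (1 + real k)\<^sup>2" by (intro mult_left_mono) (auto simp: one_le_power)
      then have 2: "16 * (T * (2 * pi * (1 + real k))\<^sup>2 + 2) \<le> Q * (1 + real k)\<^sup>2"
        unfolding power_mult_distrib by (simp add: Q_def distrib_left distrib_right mult_ac)
      have "16 * (T * (2 * pi * (1 + real k))\<^sup>2 + 2) * exp (b * (1 - A * r / 4)) \<le>
        (Q * (1 + real k)\<^sup>2) * (exp (- (L * b)) * exp (- (s * r)))"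
        using T Q by (intro mult_mono 1 2) auto
      then show ?thesis by (simp add: r_def mult_ac)
    qed
    obtain S where S: "S \<in> sets M" "prob S \<le> (\<Sum>k\<le>N. 16 * (T * (2 * pi * (1 + real k))\<^sup>2 + 2) *
        exp (b * (1 - A * sqrt (1 + real k) / 4)))"
      "\<forall>\<omega>\<in>space M - S. field_bounded T (C * A) (density_field T N a M X \<omega>)"
      using bounded_event[OF T a(1) A a(2) C] unfolding b_def by blast
    have "prob S \<le> (\<Sum>k\<le>N. exp (- (L * b)) * (Q * (1 + real k)\<^sup>2 * exp (- (s * sqrt (1 + real k)))))"
      using S(2) sum_mono[OF summand] by (rule order_trans)
    also have "\<dots> \<le> exp (- (L * b)) * (1 / 4)"
      unfolding sum_distrib_left[symmetric] by (intro mult_left_mono s) simp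
    finally have "prob S \<le> exp (- (L * b)) / 4" by simp
    then show "\<exists>S\<in>sets M. prob S \<le> exp (- (L * (a\<^sup>2 / real N))) / 4 \<and>
      (\<forall>\<omega>\<in>space M - S. field_bounded T (C * A) (density_field T N a M X \<omega>))"
      using S unfolding b_def by blast
  qed
qed

text \<open>The slope \<open>l\<close> is fixed first, large enough for the rate; the window is then
  taken so short that the quadratic losses are at most one unit of \<open>a\<^sup>2 / N\<close>. The
  condition on \<open>B\<close> keeps the scaled test function below 1/2.\<close>

lemma uniform_modulus_event:
  assumes T: "0 < T" and L: "0 \<le> L" and f: "f \<in> torus_smooth" and \<epsilon>: "0 < \<epsilon>"
  obtains \<delta> B :: real where "0 < \<delta>" "\<And>(M :: 'w measure) N p X a. exclusion_process M N p X \<Longrightarrow> 0 < a \<Longrightarrow>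
    a / real N \<le> 1 / 2 \<Longrightarrow> B * (a / real N) \<le> 1 / 2 \<Longrightarrow>
    \<exists>S\<in>sets M. measure M S \<le> 6 * (T / \<delta> + 2) * exp (- ((L + 1) * (a\<^sup>2 / real N))) \<and>
      (\<forall>\<omega>\<in>space M - S. osc_le T (density_field T N a M X \<omega>) f \<delta> \<epsilon>)"
proof -
  obtain B0 B1 B2 where B: "0 \<le> B0" "\<And>x. \<bar>f x\<bar> \<le> B0" "0 \<le> B1" "\<And>x. \<bar>(deriv ^^ 1) f x\<bar> \<le> B1"
    "0 \<le> B2" "\<And>x. \<bar>(deriv ^^ 2) f x\<bar> \<le> B2"
    using smooth_bounded[OF f, of 0] smooth_bounded[OF f, of 1] smooth_bounded[OF f, of 2] by (metis funpow_0)
  define e where "e = \<epsilon> / 3"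
  \<comment> \<open>Makes the gain \<open>l * e / 2\<close> equal to \<open>L + 2\<close>: one unit
    pays the quadratic losses, one is kept in reserve to absorb constants.\<close>
  define l where "l = 2 * (L + 2) / e"
  \<comment> \<open>Inverse window length, large enough that both loss exponents are at most
    \<open>a\<^sup>2 / N\<close>; the 1 makes it positive.\<close>
  define D where "D = l\<^sup>2 * B1\<^sup>2 + l * B2 + 1"
  have e: "0 < e" using \<epsilon> by (simp add: e_def)
  have l: "0 < l" using e L by (simp add: l_def)
  have D: "l\<^sup>2 * B1\<^sup>2 \<le> D" "l * B2 \<le> D" "0 < D"
    using l B by (simp_all add: D_def add_nonneg_pos)
  have \<delta>: "0 < 1 / D" "1 / D * (l\<^sup>2 * B1\<^sup>2) \<le> 1" "1 / D * (l * B2) \<le> 1" using D by simp_all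
  show ?thesis
  proof (rule that[of "1 / D" "l * B0"])
    fix M :: "'w measure" and N p X a
    assume ep: "exclusion_process M N p X" and a: "0 < a" "a / real N \<le> 1 / 2" "l * B0 * (a / real N) \<le> 1 / 2"
    interpret exclusion_process M N p X by fact
    define b where "b = a\<^sup>2 / real N"
    have b: "0 \<le> b" by (simp add: b_def)
    have "1 / D * (l * B2) * (a / real N) \<le> 1 * (a / real N)"
      using a by (intro mult_right_mono \<delta>(3)) simp
    also have "1 / D * (l * B2) * (a / real N) = 1 / D * l * (a / real N) * B2" by simp
    finally have small: "1 / D * l * (a / real N) * B2 \<le> 1 / 2" using a(2) by linarith
    have small0: "l * (a / real N) * B0 \<le> 1 / 2" using a(3) by (simp add: mult_ac)
    have "1 / D * (l\<^sup>2 * B1\<^sup>2) * b \<le> 1 * b" using b by (intro mult_right_mono \<delta>(2))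
    then have E1: "exp (1 / D * l\<^sup>2 * b * B1\<^sup>2) \<le> exp b" by (simp add: mult_ac)
    have "(1 / D * (l * B2))\<^sup>2 * b \<le> 1 * b"
      using b \<delta>(3) B l D by (intro mult_right_mono power_le_one) auto
    then have E2: "exp ((1 / D)\<^sup>2 * l\<^sup>2 * b * B2\<^sup>2) \<le> exp b" by (simp add: power_mult_distrib power_divide mult_ac)
    obtain S where S: "S \<in> sets M" "prob S \<le> (T / (1 / D) + 2) * (2 * exp (- (l * b * e / 2)) *
        (exp (1 / D * l\<^sup>2 * b * B1\<^sup>2) + 2 * exp ((1 / D)\<^sup>2 * l\<^sup>2 * b * B2\<^sup>2)))"
      "\<forall>\<omega>\<in>space M - S. osc_le T (density_field T N a M X \<omega>) f (1 / D) (3 * e)"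
      using modulus_event[OF T a(1) f \<delta>(1) l B(2,4,6) small0 small, of e] unfolding b_def by blast
    have le: "l * b * e / 2 = (L + 2) * b" using e by (simp add: l_def)
    have "prob S \<le> (T / (1 / D) + 2) * (2 * exp (- ((L + 2) * b)) * (exp b + 2 * exp b))"
      using S(2)[unfolded le] by (rule order_trans) (use T D E1 E2 in \<open>intro mult_left_mono add_mono; simp\<close>)
    also have "\<dots> = 6 * (T / (1 / D) + 2) * (exp (- ((L + 2) * b)) * exp b)" by simp
    also have "exp (- ((L + 2) * b)) * exp b = exp (- ((L + 1) * b))"
      by (simp flip: exp_add add: algebra_simps)
    finally show "\<exists>S\<in>sets M. prob S \<le> 6 * (T / (1 / D) + 2) * exp (- ((L + 1) * (a\<^sup>2 / real N))) \<and>
      (\<forall>\<omega>\<in>space M - S. osc_le T (density_field T N a M X \<omega>) f (1 / D) \<epsilon>)"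
      using S unfolding b_def e_def by auto
  qed (use \<delta> in simp)
qed

section \<open>Exponential tightness\<close>

lemma scaled_ln_ereal_le:
  assumes "0 < n" "0 < a" "0 \<le> p" "p \<le> exp (- (L * (a\<^sup>2 / n)))"
  shows "ereal (n / a\<^sup>2) * ln_ereal p \<le> - ereal L"
proof (cases "p = 0")
  case True
  then show ?thesis using assms by (simp add: ln_ereal_def)
next
  case False
  then have "0 < p" using assms by simp
  then have "ln p \<le> - (L * (a\<^sup>2 / n))" using assms(4) by (metis ln_exp ln_le_cancel_iff exp_gt_zero)
  then have "n / a\<^sup>2 * ln p \<le> n / a\<^sup>2 * (- (L * (a\<^sup>2 / n)))" using assms by (intro mult_left_mono) auto
  then show ?thesis using False assms by (simp add: ln_ereal_def)
qed

text \<open>The shares are \<open>q / 4\<close>, \<open>q / 4\<close> and \<open>q / 2\<close>, the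
  last from the geometric series. \<open>B\<close> is not assumed measurable, as the complement of a
  compact set of paths need not pull back to a measurable event; in that case \<open>measure\<close>
  takes its default value 0.\<close>

lemma (in finite_measure) measure_le_countable_union:
  assumes S: "S1 \<in> sets M" "S3 \<in> sets M" "\<And>i::nat. S2 i \<in> sets M"
    and q: "measure M S1 \<le> q / 4" "measure M S3 \<le> q / 4" "\<And>i. measure M (S2 i) \<le> (1 / 2) ^ (i + 2) * q"
    and sub: "B \<subseteq> S1 \<union> S3 \<union> (\<Union>i. S2 i)"
  shows "measure M B \<le> q"
proof (cases "B \<in> sets M")
  case True
  have "(\<lambda>i. (1 / 2) ^ Suc i * (q / 2)) sums (1 * (q / 2))"
    by (intro sums_mult2 power_half_series)
  then have s: "(\<lambda>i. (1 / 2) ^ (i + 2) * q) sums (q / 2)" by simp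
  then have sm: "summable (\<lambda>i. measure M (S2 i))"
    using q(3) by (intro summable_comparison_test'[OF sums_summable[OF s], of 0]) auto
  have "measure M (\<Union>i. S2 i) \<le> (\<Sum>i. measure M (S2 i))"
    using S(3) sm by (intro finite_measure_subadditive_countably) auto
  also have "\<dots> \<le> q / 2"
    using suminf_le[OF q(3) sm sums_summable[OF s]] sums_unique[OF s] by simp
  finally have 2: "measure M (\<Union>i. S2 i) \<le> q / 2" .
  have U: "(\<Union>i. S2 i) \<in> sets M" using S(3) by auto
  have "measure M B \<le> measure M (S1 \<union> S3 \<union> (\<Union>i. S2 i))"
    using S U sub by (intro finite_measure_mono) auto
  also have "\<dots> \<le> measure M S1 + measure M S3 + measure M (\<Union>i. S2 i)"
    using measure_Un_le[of "S1 \<union> S3" M "\<Union>i. S2 i"] measure_Un_le[of S1 M S3] S U by fastforce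
  finally show ?thesis using 2 q(1,2) by linarith
next
  case False
  have "0 \<le> q / 4" using q(1) measure_nonneg[of M S1] by linarith
  then show ?thesis using False by (simp add: measure_notin_sets)
qed

theorem lemma3p1:
  fixes T :: real
    and a :: "nat \<Rightarrow> real"
    and \<phi> :: "real \<Rightarrow> real"
    and M :: "nat \<Rightarrow> 'w measure"
    and \<eta> :: "nat \<Rightarrow> real \<Rightarrow> 'w \<Rightarrow> nat \<Rightarrow> nat"
  assumes "0 < T"
    and "\<And>N. 1 \<le> N \<Longrightarrow> 0 < a N"
    and "(\<lambda>N. a N / real N) \<longlonglongrightarrow> 0"
    and "(\<lambda>N. sqrt (real N) / a N) \<longlonglongrightarrow> 0"
    and "\<phi> \<in> torus_continuous"
    and "\<And>u. 0 < \<phi> u \<and> \<phi> u < 1"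
    and "\<And>N. 1 \<le> N \<Longrightarrow>
           markov_process (M N) (configurations N) (exclusion_generator N) (\<eta> N)"
    and "\<And>N. 1 \<le> N \<Longrightarrow>
           prob_space.indep_vars (M N) (\<lambda>_. count_space UNIV) (\<lambda>x \<omega>. \<eta> N 0 \<omega> x) {..<N}"
    and "\<And>N x. 1 \<le> N \<Longrightarrow> x < N \<Longrightarrow>
           measure (M N) {\<omega> \<in> space (M N). \<eta> N 0 \<omega> x = 1} = \<phi> (real x / real N)"
  shows "\<forall>L>0. \<exists>K. compactin (skorokhod_topology T) K \<and>
           limsup (\<lambda>N. ereal (real N / (a N)\<^sup>2) *
             ln_ereal (measure (M N)
               {\<omega> \<in> space (M N). density_field T N (a N) (M N) (\<eta> N) \<omega> \<notin> K}))
           \<le> - ereal L"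
proof (intro allI impI)
  fix L :: real assume L: "0 < L"
  note T = \<open>0 < T\<close> and a = assms(2)
  define b where "b N = (a N)\<^sup>2 / real N" for N
  define field where "field N = density_field T N (a N) (M N) (\<eta> N)" for N
  have "\<exists>p. exclusion_process (M N) N p (\<eta> N)" if "1 \<le> N" for N
    by (rule markov_process_exclusion[OF assms(7)[OF that] that assms(8)[OF that]])
  then obtain p where ep: "\<And>N. 1 \<le> N \<Longrightarrow> exclusion_process (M N) N (p N) (\<eta> N)" by metis
  have ps: "prob_space (M N)" if "1 \<le> N" for N
    using assms(7)[OF that] by (simp add: markov_process_def)
  \<comment> \<open>The speed is the inverse square of \<open>sqrt N / a N\<close>, so the second
    limit hypothesis says exactly that it diverges.\<close>
  have "filterlim (\<lambda>N. inverse ((sqrt (real N) / a N)\<^sup>2)) at_top sequentially"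
  proof (rule filterlim_inverse_at_top)
    show "(\<lambda>N. (sqrt (real N) / a N)\<^sup>2) \<longlonglongrightarrow> 0" using tendsto_power[OF assms(4), of 2] by simp
    show "\<forall>\<^sub>F N in sequentially. 0 < (sqrt (real N) / a N)\<^sup>2"
      using eventually_ge_at_top[of 1] by eventually_elim (use a in force)
  qed
  then have b_lim: "filterlim b at_top sequentially"
    by (simp add: b_def[abs_def] power_divide)
  have a_le: "\<forall>\<^sub>F N in sequentially. a N / real N \<le> 1 / 2"
    using order_tendstoD(2)[OF assms(3), of "1/2"] by (auto elim: eventually_mono)

  obtain A where A: "0 \<le> A" and bounded: "\<And>(M :: 'w measure) N p X a. exclusion_process M N p X \<Longrightarrow> 0 < a \<Longrightarrow>
      a / real N \<le> 1 / 2 \<Longrightarrow> 1 \<le> a\<^sup>2 / real N \<Longrightarrow>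
      \<exists>S\<in>sets M. measure M S \<le> exp (- (L * (a\<^sup>2 / real N))) / 4 \<and>
        (\<forall>\<omega>\<in>space M - S. field_bounded T A (density_field T N a M X \<omega>))"
    using uniform_bounded_event[OF T less_imp_le[OF L], where 'w = 'w] by metis
  obtain g :: "nat \<Rightarrow> real \<Rightarrow> real" where g: "(\<forall>i. g i \<in> torus_smooth) \<and>
      (\<forall>f\<in>torus_smooth. \<forall>e>0. \<exists>i. c2_bounded e (\<lambda>x. f x - g i x))"
    by (rule exE[OF countable_dense_smooth])
  \<comment> \<open>Through \<open>prod_decode\<close> each \<open>g i\<close> is listed once with
    every tolerance \<open>1 / (k + 1)\<close>.\<close>
  define w where "w i = g (fst (prod_decode i))" for i
  define tol where "tol i = 1 / (real (snd (prod_decode i)) + 1)" for i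
  have w: "w i \<in> torus_smooth" for i by (simp add: w_def conjunct1[OF g])
  have tol: "0 < tol i" for i by (simp add: tol_def)

  have "\<forall>i. \<exists>d n. 0 < d \<and> (\<forall>N\<ge>n. \<exists>S\<in>sets (M N). measure (M N) S \<le> (1 / 2) ^ (i + 2) * exp (- (L * b N)) \<and>
      (\<forall>\<omega>\<in>space (M N) - S. osc_le T (field N \<omega>) (w i) d (tol i)))"
  proof
    fix i
    obtain d B where d: "0 < d" and modulus: "\<And>(M :: 'w measure) N p X a. exclusion_process M N p X \<Longrightarrow> 0 < a \<Longrightarrow>
        a / real N \<le> 1 / 2 \<Longrightarrow> B * (a / real N) \<le> 1 / 2 \<Longrightarrow>
        \<exists>S\<in>sets M. measure M S \<le> 6 * (T / d + 2) * exp (- ((L + 1) * (a\<^sup>2 / real N))) \<and>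
          (\<forall>\<omega>\<in>space M - S. osc_le T (density_field T N a M X \<omega>) (w i) d (tol i))"
      using uniform_modulus_event[OF T less_imp_le[OF L] w tol[of i], where 'w = 'w] by metis
    have "(\<lambda>N. B * (a N / real N)) \<longlonglongrightarrow> B * 0" by (intro tendsto_mult tendsto_const assms(3))
    then have B: "\<forall>\<^sub>F N in sequentially. B * (a N / real N) \<le> 1 / 2"
      by (rule eventually_mono[OF order_tendstoD(2)[where a = "1 / 2"]]) simp_all
    \<comment> \<open>The reserve in the exponent \<open>L + 1\<close> beats both the number of
      windows and the weight \<open>(1 / 2) ^ (i + 2)\<close> once \<open>N\<close> is large,
      depending on \<open>i\<close>.\<close>
    have "((\<lambda>N. exp (- b N)) \<longlongrightarrow> 0) sequentially"
      by (rule filterlim_compose[OF exp_at_bot]) (simp add: filterlim_uminus_at_bot b_lim)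
    then have "((\<lambda>N. 6 * (T / d + 2) * exp (- b N)) \<longlongrightarrow> 6 * (T / d + 2) * 0) sequentially"
      by (intro tendsto_mult tendsto_const)
    then have E: "\<forall>\<^sub>F N in sequentially. 6 * (T / d + 2) * exp (- b N) < (1 / 2) ^ (i + 2)"
      by (rule order_tendstoD(2)) simp
    have "\<forall>\<^sub>F N in sequentially. \<exists>S\<in>sets (M N). measure (M N) S \<le> (1 / 2) ^ (i + 2) * exp (- (L * b N)) \<and>
      (\<forall>\<omega>\<in>space (M N) - S. osc_le T (field N \<omega>) (w i) d (tol i))"
      using eventually_ge_at_top[of 1] a_le B E
    proof eventually_elim
      case (elim N)
      obtain S where S: "S \<in> sets (M N)" "measure (M N) S \<le> 6 * (T / d + 2) * exp (- ((L + 1) * b N))"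
        "\<forall>\<omega>\<in>space (M N) - S. osc_le T (field N \<omega>) (w i) d (tol i)"
        using modulus[OF ep[OF elim(1)] a[OF elim(1)] elim(2,3)] unfolding b_def field_def by blast
      have "6 * (T / d + 2) * exp (- ((L + 1) * b N)) = 6 * (T / d + 2) * exp (- b N) * exp (- (L * b N))"
        by (simp add: algebra_simps flip: exp_add)
      also have "\<dots> \<le> (1 / 2) ^ (i + 2) * exp (- (L * b N))"
        using elim(4) by (intro mult_right_mono) auto
      finally have "measure (M N) S \<le> (1 / 2) ^ (i + 2) * exp (- (L * b N))" using S(2) by (rule order_trans[rotated])
      then show ?case using S(1,3) by blast
    qed
    then show "\<exists>d n. 0 < d \<and> (\<forall>N\<ge>n. \<exists>S\<in>sets (M N). measure (M N) S \<le> (1 / 2) ^ (i + 2) * exp (- (L * b N)) \<and>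
      (\<forall>\<omega>\<in>space (M N) - S. osc_le T (field N \<omega>) (w i) d (tol i)))"
      using d unfolding eventually_sequentially by blast
  qed
  then obtain \<delta> n0 where \<delta>_n0: "\<forall>i. 0 < \<delta> i \<and> (\<forall>N\<ge>n0 i. \<exists>S\<in>sets (M N).
      measure (M N) S \<le> (1 / 2) ^ (i + 2) * exp (- (L * b N)) \<and>
      (\<forall>\<omega>\<in>space (M N) - S. osc_le T (field N \<omega>) (w i) (\<delta> i) (tol i)))"
    unfolding choice_iff by (elim exE)
  note \<delta> = conjunct1[OF spec[OF \<delta>_n0]] and osc = conjunct2[OF spec[OF \<delta>_n0], rule_format]

  have "\<forall>N. \<exists>R. 1 \<le> N \<longrightarrow> R \<subseteq> cadlag_paths T \<and>
    (\<forall>s. (\<forall>j::nat. s j \<in> R) \<longrightarrow> (\<exists>r x. strict_mono r \<and> x \<in> R \<and>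
      skorokhod_converges T (\<lambda>j. s (r j)) x)) \<and>
    (\<exists>S\<in>sets (M N). measure (M N) S < exp (- (L * b N)) / 4 \<and> (\<forall>\<omega>\<in>space (M N) - S. field N \<omega> \<in> R))"
  proof
    fix N
    show "\<exists>R. 1 \<le> N \<longrightarrow> R \<subseteq> cadlag_paths T \<and>
      (\<forall>s. (\<forall>j::nat. s j \<in> R) \<longrightarrow> (\<exists>r x. strict_mono r \<and> x \<in> R \<and>
        skorokhod_converges T (\<lambda>j. s (r j)) x)) \<and>
      (\<exists>S\<in>sets (M N). measure (M N) S < exp (- (L * b N)) / 4 \<and> (\<forall>\<omega>\<in>space (M N) - S. field N \<omega> \<in> R))"
    proof (cases "1 \<le> N")
      case True
      show ?thesis
        using exclusion_process.tight_single[OF ep[OF True] T, of "exp (- (L * b N)) / 4" "a N"]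
        unfolding field_def by auto
    qed simp
  qed
  then obtain R where R_all: "\<forall>N. 1 \<le> N \<longrightarrow> R N \<subseteq> cadlag_paths T \<and>
    (\<forall>s. (\<forall>j::nat. s j \<in> R N) \<longrightarrow> (\<exists>r x. strict_mono r \<and> x \<in> R N \<and>
      skorokhod_converges T (\<lambda>j. s (r j)) x)) \<and>
    (\<exists>S\<in>sets (M N). measure (M N) S < exp (- (L * b N)) / 4 \<and> (\<forall>\<omega>\<in>space (M N) - S. field N \<omega> \<in> R N))"
    unfolding choice_iff by (elim exE)
  note R = conjunct1[OF mp[OF spec[OF R_all]]]
    and R_seq = conjunct1[OF conjunct2[OF mp[OF spec[OF R_all]]]]
    and R_prob = conjunct2[OF conjunct2[OF mp[OF spec[OF R_all]]]]

  \<comment> \<open>The compact set for a single \<open>N\<close>, cut down by the common bound and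
    by those moduli that are already guaranteed at \<open>N\<close>.\<close>
  define P where "P N = (if 1 \<le> N then {x \<in> R N. field_bounded T A x \<and>
      (\<forall>i. n0 i \<le> N \<longrightarrow> osc_le T x (w i) (\<delta> i) (tol i))} else {})" for N
  have family: "test_family w tol \<delta> T A"
  proof
    fix f :: "real \<Rightarrow> real" and e :: real assume f: "f \<in> torus_smooth" and e: "0 < e"
    obtain i where i: "c2_bounded e (\<lambda>x. f x - g i x)" using conjunct2[OF g, rule_format, OF f e] by blast
    obtain k where "inverse (real (Suc k)) < e" using reals_Archimedean[OF e] by blast
    with i have "c2_bounded e (\<lambda>x. f x - w (prod_encode (i, k)) x) \<and> tol (prod_encode (i, k)) \<le> e"
      by (simp add: w_def tol_def inverse_eq_divide add.commute)
    then show "\<exists>i. c2_bounded e (\<lambda>x. f x - w i x) \<and> tol i \<le> e" by blast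
  qed (use T A w \<delta> in auto)
  have P_cadlag: "P N \<subseteq> cadlag_paths T" for N using R by (auto simp: P_def)
  have P_bounded: "field_bounded T A x" if "x \<in> P N" for N x using that by (auto simp: P_def split: if_splits)
  have P_osc: "osc_le T x (w i) (\<delta> i) (tol i)" if "n0 i \<le> N" "x \<in> P N" for N i x
    using that by (auto simp: P_def split: if_splits)
  \<comment> \<open>Both conditions that cut \<open>R N\<close> down to \<open>P N\<close> are
    closed under the convergence, so sequential compactness is inherited.\<close>
  have P_seq: "\<exists>r x. strict_mono r \<and> x \<in> P N \<and> skorokhod_converges T (\<lambda>j. s (r j)) x" if s: "\<And>j::nat. s j \<in> P N" for s N
  proof -
    have N: "1 \<le> N" using s[of 0] by (auto simp: P_def split: if_splits)
    have sR: "\<forall>j. s j \<in> R N" and sb: "\<And>j. field_bounded T A (s j)"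
      and so: "\<And>i j. n0 i \<le> N \<Longrightarrow> osc_le T (s j) (w i) (\<delta> i) (tol i)"
      using s N by (auto simp: P_def)
    obtain r x where r: "strict_mono (r :: nat \<Rightarrow> nat)" "x \<in> R N" and near: "skorokhod_converges T (\<lambda>j. s (r j)) x"
      using R_seq[OF N, rule_format, of s] sR by blast
    have ex: "\<exists>j. s j \<in> skorokhod_near T {f} d x" if "f \<in> torus_smooth" "0 < d" for f d
      using eventually_happens'[OF _ near[rule_format, of "{f}" d]] that by auto
    have "field_bounded T A x"
      using near_limit_field_bounded[of x T A] ex sb r(2) R[OF N] by (meson subsetD)
    moreover have "osc_le T x (w i) (\<delta> i) (tol i)" if "n0 i \<le> N" for i
      using near_limit_osc_le[of T "w i" "\<delta> i" "tol i" x] ex[OF w] so[OF that] by blast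
    ultimately show ?thesis using r near N unfolding P_def by auto
  qed
  obtain K where K: "compactin (skorokhod_topology T) K" "\<And>N. P N \<subseteq> K"
    by (rule test_family.compactin_Union[OF family, of P n0])
      (rule P_cadlag P_bounded P_osc P_seq that; (assumption | blast))+

  have "\<forall>\<^sub>F N in sequentially. 1 \<le> b N" using b_lim by (simp add: filterlim_at_top)
  then have "\<forall>\<^sub>F N in sequentially. ereal (real N / (a N)\<^sup>2) *
      ln_ereal (measure (M N) {\<omega> \<in> space (M N). field N \<omega> \<notin> K}) \<le> - ereal L"
    using eventually_ge_at_top[of 1] a_le
  proof eventually_elim
    case (elim N)
    interpret prob_space "M N" using ps elim by simp
    let ?q = "exp (- (L * b N))"
    obtain S1 where S1: "S1 \<in> sets (M N)" "measure (M N) S1 \<le> ?q / 4"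
      "\<And>\<omega>. \<omega> \<in> space (M N) - S1 \<Longrightarrow> field_bounded T A (field N \<omega>)"
      using bounded[OF ep a] elim unfolding b_def field_def by meson
    obtain S3 where S3: "S3 \<in> sets (M N)" "measure (M N) S3 \<le> ?q / 4"
      "\<And>\<omega>. \<omega> \<in> space (M N) - S3 \<Longrightarrow> field N \<omega> \<in> R N"
      using R_prob[OF elim(2)] by (meson less_imp_le)
    \<comment> \<open>For indices with \<open>n0 i > N\<close> nothing is demanded and the empty set
      serves as the exceptional event.\<close>
    have "\<exists>S\<in>sets (M N). measure (M N) S \<le> (1 / 2) ^ (i + 2) * ?q \<and>
        (\<forall>\<omega>\<in>space (M N) - S. n0 i \<le> N \<longrightarrow> osc_le T (field N \<omega>) (w i) (\<delta> i) (tol i))" for i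
    proof (cases "n0 i \<le> N")
      case True
      then show ?thesis using osc[OF True] by auto
    next
      case False
      then show ?thesis by (intro bexI[of _ "{}"]) auto
    qed
    then obtain S2 where S2: "\<And>i. S2 i \<in> sets (M N)" "\<And>i. measure (M N) (S2 i) \<le> (1 / 2) ^ (i + 2) * ?q"
      "\<And>i \<omega>. \<omega> \<in> space (M N) - S2 i \<Longrightarrow> n0 i \<le> N \<Longrightarrow> osc_le T (field N \<omega>) (w i) (\<delta> i) (tol i)"
      by metis
    have "field N \<omega> \<in> K" if "\<omega> \<in> space (M N) - (S1 \<union> S3 \<union> (\<Union>i. S2 i))" for \<omega>
    proof -
      have "field N \<omega> \<in> P N" using that S1(3) S3(3) S2(3) elim(2) unfolding P_def by auto
      then show ?thesis using K(2) by blast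
    qed
    then have "measure (M N) {\<omega> \<in> space (M N). field N \<omega> \<notin> K} \<le> ?q"
      by (intro measure_le_countable_union[OF S1(1) S3(1) S2(1) S1(2) S3(2) S2(2)]) auto
    then show ?case
      using elim a by (intro scaled_ln_ereal_le) (auto simp: b_def)
  qed
  then have "limsup (\<lambda>N. ereal (real N / (a N)\<^sup>2) *
      ln_ereal (measure (M N) {\<omega> \<in> space (M N). field N \<omega> \<notin> K})) \<le> - ereal L"
    by (rule Limsup_bounded)
  then show "\<exists>K. compactin (skorokhod_topology T) K \<and>
      limsup (\<lambda>N. ereal (real N / (a N)\<^sup>2) *
        ln_ereal (measure (M N)
          {\<omega> \<in> space (M N). density_field T N (a N) (M N) (\<eta> N) \<omega> \<notin> K})) \<le> - ereal L"
    using K(1) unfolding field_def by blast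
qed

end
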